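(* Let $N\ge3$, $\bar\mu:=\left(\frac{N-2}{2}\right)^2$, $\mu\in(0,\bar\mu)$, $\nu:=\sqrt{\bar\mu}-\sqrt{\bar\mu-\mu}$, $\alpha:=N-2-2\nu$, $q=\frac{2+\nu}{\nu}$, and $2^*-1\le p<q$ with $2^*=\frac{2N}{N-2}$. Let $\Omega\subseteq\mathbb{R}^N$ be a smooth domain (bounded or unbounded) with $0\in\Omega$. Then any radial solution $u$ (that is, $u(x)=u(|x|)$) of $$-\Delta u-\mu\frac{u}{|x|^2}=u^p-u^q\ \text{ in }\Omega,\qquad u>0\ \text{ in }\Omega,\qquad u\in H_0^1(\Omega)\cap L^{q+1}(\Omega),$$ satisfies $$\lim_{|x|\to0}\frac{u(x)}{|x|^{-\nu}\,\big|\log|x|\big|^{-\frac{\nu}{2}}}=\left(\frac{\alpha\nu}{2}\right)^{\frac{\nu}{2}}.$$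
   Context: Solutions are understood in the weak sense. *)

theory Defs
  imports "HOL-Analysis.Analysis"
begin

(* C^k and C^infinity on an open set: in finite dimension, f is C^(k+1) iff it is differentiable
   and all its directional derivatives are C^k. *)
fun Ck_on :: "nat \<Rightarrow> 'a::real_normed_vector set \<Rightarrow> ('a \<Rightarrow> 'b::real_normed_vector) \<Rightarrow> bool" where
  "Ck_on 0 S f \<longleftrightarrow> continuous_on S f"
| "Ck_on (Suc k) S f \<longleftrightarrow>
     (\<forall>x\<in>S. f differentiable (at x)) \<and> (\<forall>h. Ck_on k S (\<lambda>x. frechet_derivative f (at x) h))"

definition smooth_on :: "'a::real_normed_vector set \<Rightarrow> ('a \<Rightarrow> 'b::real_normed_vector) \<Rightarrow> bool" where
  "smooth_on S f \<longleftrightarrow> (\<forall>k. Ck_on k S f)"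

(* Each boundary point has a neighbourhood U that a smooth diffeomorphism \<Phi> (with inverse \<Psi>)
   straightens: \<Omega> becomes the part of the open set D lying in an open half-space. *)
definition smooth_domain :: "(real^'n) set \<Rightarrow> bool" where
  "smooth_domain \<Omega> \<longleftrightarrow> open \<Omega> \<and> connected \<Omega> \<and> \<Omega> \<noteq> {} \<and>
     (\<forall>x0\<in>frontier \<Omega>. \<exists>(U :: (real^'n) set) (D :: (real^'n) set) \<Phi> \<Psi> k.
        open U \<and> x0 \<in> U \<and> open D \<and> homeomorphism U D \<Phi> \<Psi> \<and> smooth_on U \<Phi> \<and> smooth_on D \<Psi> \<and>
        \<Phi> ` (U \<inter> \<Omega>) = D \<inter> {y. 0 < y $ k} \<and>
        \<Phi> ` (U \<inter> frontier \<Omega>) = D \<inter> {y. y $ k = 0})"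

definition test_functions :: "(real^'n) set \<Rightarrow> (real^'n \<Rightarrow> real) set" where
  "test_functions \<Omega> =
     {\<phi>. smooth_on UNIV \<phi> \<and> compact (closure {x. \<phi> x \<noteq> 0}) \<and> closure {x. \<phi> x \<noteq> 0} \<subseteq> \<Omega>}"

definition grad :: "(real^'n \<Rightarrow> real) \<Rightarrow> real^'n \<Rightarrow> real^'n" where
  "grad \<phi> x = (\<chi> i. frechet_derivative \<phi> (at x) (axis i 1))"

definition Lp :: "real \<Rightarrow> (real^'n) set \<Rightarrow> (real^'n \<Rightarrow> 'b::euclidean_space) set" where
  "Lp s \<Omega> = {f. set_borel_measurable lebesgue \<Omega> f \<and>
                set_integrable lebesgue \<Omega> (\<lambda>x. norm (f x) powr s)}"

definition L1_loc :: "(real^'n) set \<Rightarrow> (real^'n \<Rightarrow> 'b::euclidean_space) set" where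
  "L1_loc \<Omega> = {f. \<forall>K. compact K \<and> K \<subseteq> \<Omega> \<longrightarrow> set_integrable lebesgue K f}"

definition weak_gradient ::
  "(real^'n) set \<Rightarrow> (real^'n \<Rightarrow> real) \<Rightarrow> (real^'n \<Rightarrow> real^'n) \<Rightarrow> bool" where
  "weak_gradient \<Omega> u g \<longleftrightarrow> u \<in> L1_loc \<Omega> \<and> g \<in> L1_loc \<Omega> \<and>
     (\<forall>\<phi>\<in>test_functions \<Omega>. \<forall>i.
        (LINT x:\<Omega>|lebesgue. u x * grad \<phi> x $ i) = - (LINT x:\<Omega>|lebesgue. g x $ i * \<phi> x))"

(* The closure of the test functions in the H^1 norm. *)
definition H10 :: "(real^'n) set \<Rightarrow> (real^'n \<Rightarrow> real) set" where
  "H10 \<Omega> = {u. \<exists>g. u \<in> Lp 2 \<Omega> \<and> g \<in> Lp 2 \<Omega> \<and> weak_gradient \<Omega> u g \<and>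
     (\<exists>\<phi>. (\<forall>k. \<phi> k \<in> test_functions \<Omega>) \<and>
        (\<lambda>k::nat. LINT x:\<Omega>|lebesgue. (u x - \<phi> k x)\<^sup>2 + (norm (g x - grad (\<phi> k) x))\<^sup>2)
          \<longlonglongrightarrow> 0)}"

(* Weak form of  - Laplacian u - \<mu> u / |x|^2 = u^p - u^q  in \<Omega>, tested against C_c^infinity(\<Omega>).
   The L1_loc conditions make every integral exist, so that none of them silently takes the default
   value 0; for u > 0 in H10 \<Omega> with u in L^(q+1), 1 <= p <= q, in dimension at least 3, they hold
   automatically (the first one by Hardy's inequality). *)
definition weak_solution ::
  "(real^'n) set \<Rightarrow> real \<Rightarrow> real \<Rightarrow> real \<Rightarrow> (real^'n \<Rightarrow> real) \<Rightarrow> bool" where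
  "weak_solution \<Omega> \<mu> p q u \<longleftrightarrow>
     (\<lambda>x. u x / (norm x)\<^sup>2) \<in> L1_loc \<Omega> \<and>
     (\<lambda>x. u x powr p) \<in> L1_loc \<Omega> \<and> (\<lambda>x. u x powr q) \<in> L1_loc \<Omega> \<and>
     (\<exists>g. weak_gradient \<Omega> u g \<and>
       (\<forall>\<phi>\<in>test_functions \<Omega>.
          (LINT x:\<Omega>|lebesgue. g x \<bullet> grad \<phi> x)
            - \<mu> * (LINT x:\<Omega>|lebesgue. u x / (norm x)\<^sup>2 * \<phi> x)
          = (LINT x:\<Omega>|lebesgue. (u x powr p - u x powr q) * \<phi> x)))"

(* Elements of H10 are functions up to null sets, so radiality is required almost everywhere. *)
definition radial_on :: "(real^'n) set \<Rightarrow> (real^'n \<Rightarrow> real) \<Rightarrow> bool" where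
  "radial_on \<Omega> u \<longleftrightarrow> (\<exists>w. AE x in lebesgue. x \<in> \<Omega> \<longrightarrow> u x = w (norm x))"

end

theory Submission
  imports Defs "HOL-Real_Asymp.Real_Asymp"
begin

text \<open>
  In the variable \<open>s = - ln |x|\<close> a radial solution, written as \<open>u(x) = |x| powr (-\<nu>) * y(s)\<close>,
  satisfies the asymptotically autonomous equation \<open>y'' = \<alpha> y' + y^q - e^(-\<delta> s) y^p\<close> on a half-line, with
  \<open>\<delta> = (q - p) \<nu> > 0\<close>. Since \<open>y\<close> is positive and exists for all large \<open>s\<close>, it cannot grow (it would blow up
  in finite time) and cannot drop below \<open>e^(-\<nu> s)\<close>, where the nonlinearity changes sign (it would become
  negative). Hence it eventually decreases to \<open>0\<close>, and \<open>v = - y' / y^q\<close> obeys \<open>v' = \<alpha> v - 1 + o(1)\<close> while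
  staying in \<open>[0, 1 / \<alpha>]\<close>. This forces \<open>v \<longlonglongrightarrow> 1 / \<alpha>\<close>, that is \<open>y^(1 - q) / s \<longlonglongrightarrow> (q - 1) / \<alpha>\<close>.

  The passage from the weak to the classical equation tests with functions of \<open>s\<close> times a function \<open>b\<close> of
  the direction \<open>x / |x|\<close>: \<open>b = 1\<close> near the origin, and a cutoff to a narrow cone around any other point
  of \<open>\<Omega>\<close>, which need not be invariant under rotations. The density of \<open>b(x) dx\<close> in the variable \<open>s\<close> is a
  constant times \<open>e^(-N s)\<close>, so only one-dimensional du Bois-Reymond arguments remain.
\<close>

section \<open>Calculus of smooth functions\<close>

text \<open>The exponent \<open>\<nu>\<close> is the smaller root of
  \<open>\<nu> * (N - 2 - \<nu>) = \<mu>\<close>, so the substitution removes the zero-order term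
  and leaves a linear part with the rates \<open>0\<close> and \<open>\<alpha>\<close>;
  \<open>q\<close> is the power for which the coefficient of \<open>y^q\<close> becomes constant.
  Along the neutral rate \<open>0\<close> the decay is decided by the nonlinearity alone:
  \<open>\<alpha> y'\<close> balances \<open>- y^q\<close>, which suggests \<open>v\<close>, and
  \<open>q - 1 = 2 / \<nu>\<close> produces both the power \<open>- \<nu> / 2\<close> of
  \<open>s\<close> and the constant of the limit. The equation for \<open>v\<close> repels from
  \<open>1 / \<alpha>\<close>, so convergence comes only from \<open>v\<close> remaining in a
  bounded strip for all time.

  Two obstacles shape the regularity part. Radiality and positivity are known only almost
  everywhere, while a limit at a point asks for a continuous representative on all of
  \<open>\<Omega> - {0}\<close>. The weak gradient \<open>g\<close> is not known to be radial, and
  this is never shown: the tests are arranged so that only \<open>g x \<bullet> x\<close> occurs,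
  and the definition of the weak gradient then moves this term back to \<open>u\<close>.\<close>

declare Ck_on.simps(2) [simp del]
lemmas Ck_on_Suc = Ck_on.simps(2)

lemma Ck_on_cong:
  assumes "open S" "\<And>x. x \<in> S \<Longrightarrow> f x = g x" "Ck_on k S f"
  shows "Ck_on k S g"
  using assms(2,3)
proof (induction k arbitrary: f g)
  case 0
  then show ?case by (metis Ck_on.simps(1) continuous_on_cong)
next
  case (Suc k)
  have d: "f differentiable (at x)" "g differentiable (at x)"
    "frechet_derivative f (at x) = frechet_derivative g (at x)" if "x \<in> S" for x
  proof -
    show *: "f differentiable (at x)" using Suc.prems that by (simp add: Ck_on_Suc)
    then have "(f has_derivative frechet_derivative f (at x)) (at x)"
      by (simp add: frechet_derivative_works)
    then have "(g has_derivative frechet_derivative f (at x)) (at x)"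
      by (rule has_derivative_transform_within_open[OF _ assms(1) that Suc.prems(1)])
    then show "g differentiable (at x)" "frechet_derivative f (at x) = frechet_derivative g (at x)"
      by (auto simp: differentiable_def frechet_derivative_at)
  qed
  show ?case
    using Suc.prems(2) d Suc.IH[of "\<lambda>x. frechet_derivative f (at x) h" "\<lambda>x. frechet_derivative g (at x) h" for h]
    by (simp add: Ck_on_Suc)
qed

text \<open>Any derivative in hand may serve: on an open set it agrees with the choice operator
  \<open>frechet_derivative\<close>, in which the definition is phrased.\<close>

lemma Ck_on_SucI:
  assumes "open S" "\<And>x. x \<in> S \<Longrightarrow> (f has_derivative f' x) (at x)" "\<And>h. Ck_on k S (\<lambda>x. f' x h)"
  shows "Ck_on (Suc k) S f"
proof -
  have "Ck_on k S (\<lambda>x. frechet_derivative f (at x) h)" for h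
    by (rule Ck_on_cong[OF assms(1) _ assms(3)[of h]]) (metis assms(2) frechet_derivative_at)
  then show ?thesis using assms(2) by (auto simp: differentiable_def Ck_on_Suc)
qed

lemma Ck_on_SucD: "Ck_on (Suc k) S f \<Longrightarrow> Ck_on k S f"
proof (induction k arbitrary: f)
  case 0
  then show ?case
    by (auto simp: Ck_on_Suc intro!: differentiable_imp_continuous_on differentiable_at_imp_differentiable_on)
next
  case (Suc k)
  then show ?case by (simp add: Ck_on_Suc[of "Suc k"] Ck_on_Suc[of k])
qed

lemma Ck_on_deriv:
  assumes "Ck_on (Suc k) S f" "x \<in> S"
  shows "(f has_derivative frechet_derivative f (at x)) (at x)"
  using assms by (simp add: frechet_derivative_works Ck_on_Suc)

lemma Ck_on_const: "open S \<Longrightarrow> Ck_on k S (\<lambda>x. c)"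
proof (induction k arbitrary: c)
  case (Suc k)
  show ?case by (rule Ck_on_SucI[of _ _ "\<lambda>x h. 0"]) (auto intro!: Suc)
qed auto

lemma Ck_on_linear:
  assumes "open S" "bounded_linear f"
  shows "Ck_on k S f"
proof (cases k)
  case 0
  then show ?thesis using assms by (simp add: linear_continuous_on)
next
  case (Suc m)
  then show ?thesis using assms
    by (auto intro!: Ck_on_SucI[of _ _ "\<lambda>x. f"] Ck_on_const bounded_linear_imp_has_derivative)
qed

lemma Ck_on_add:
  assumes "open S" "Ck_on k S f" "Ck_on k S g"
  shows "Ck_on k S (\<lambda>x. f x + g x)"
  using assms(2,3)
proof (induction k arbitrary: f g)
  case 0
  then show ?case by (auto intro!: continuous_intros)
next
  case (Suc k)
  show ?case
    by (rule Ck_on_SucI[of _ _ "\<lambda>x h. frechet_derivative f (at x) h + frechet_derivative g (at x) h"])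
      (use Suc assms(1) in \<open>auto intro!: has_derivative_add simp: Ck_on_Suc frechet_derivative_works[symmetric]\<close>)
qed

lemma Ck_on_mult:
  fixes f g :: "'a::real_normed_vector \<Rightarrow> real"
  assumes "open S" "Ck_on k S f" "Ck_on k S g"
  shows "Ck_on k S (\<lambda>x. f x * g x)"
  using assms(2,3)
proof (induction k arbitrary: f g)
  case 0
  then show ?case by (auto intro!: continuous_intros)
next
  case (Suc k)
  have "Ck_on k S (\<lambda>x. f x * frechet_derivative g (at x) h + frechet_derivative f (at x) h * g x)" for h
  proof (intro Ck_on_add Suc.IH assms(1))
    show "Ck_on k S f" "Ck_on k S g" using Suc.prems Ck_on_SucD by blast+
    show "Ck_on k S (\<lambda>x. frechet_derivative g (at x) h)" "Ck_on k S (\<lambda>x. frechet_derivative f (at x) h)"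
      using Suc.prems by (simp_all add: Ck_on_Suc)
  qed
  then show ?case
    using Suc.prems
    by (intro Ck_on_SucI[OF assms(1), of _ "\<lambda>x h. f x * frechet_derivative g (at x) h + frechet_derivative f (at x) h * g x"])
       (auto intro!: has_derivative_mult simp: Ck_on_Suc frechet_derivative_works[symmetric])
qed

lemma Ck_on_subset: "Ck_on k S f \<Longrightarrow> T \<subseteq> S \<Longrightarrow> Ck_on k T f"
  by (induction k arbitrary: f) (auto simp: Ck_on_Suc intro: continuous_on_subset)

lemma Ck_on_Un:
  assumes "open S" "open T" "Ck_on k S f" "Ck_on k T f"
  shows "Ck_on k (S \<union> T) f"
  using assms(3,4)
  by (induction k arbitrary: f) (auto simp: Ck_on_Suc intro: continuous_on_open_Un assms(1,2))

lemma frechet_derivative_real: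
  fixes f :: "real \<Rightarrow> real"
  assumes "f differentiable (at x)"
  shows "frechet_derivative f (at x) h = frechet_derivative f (at x) 1 * h"
  using linear_frechet_derivative[OF assms] linear_scale[of "frechet_derivative f (at x)" h 1]
  by (simp add: mult.commute)

text \<open>\<open>B\<close> stays arbitrary in the induction because the hypothesis is applied to
  its derivative; with a scalar inner function the chain rule is a product, which
  \<open>Ck_on_mult\<close> handles.\<close>

lemma Ck_on_compose:
  fixes B :: "real \<Rightarrow> real" and g :: "'a::real_normed_vector \<Rightarrow> real"
  assumes "open S" "open T" "g ` S \<subseteq> T" "Ck_on k T B" "Ck_on k S g"
  shows "Ck_on k S (\<lambda>x. B (g x))"
  using assms(4,5)
proof (induction k arbitrary: B)
  case 0
  then show ?case using assms(3) by (auto intro: continuous_on_compose2)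
next
  case (Suc k)
  have gT: "g x \<in> T" if "x \<in> S" for x using assms(3) that by auto
  have "((\<lambda>x. B (g x)) has_derivative
      (\<lambda>h. frechet_derivative B (at (g x)) 1 * frechet_derivative g (at x) h)) (at x)" if "x \<in> S" for x
  proof -
    have "((\<lambda>x. B (g x)) has_derivative
      (\<lambda>h. frechet_derivative B (at (g x)) (frechet_derivative g (at x) h))) (at x)"
      by (rule has_derivative_compose[OF Ck_on_deriv[OF Suc.prems(2) that] Ck_on_deriv[OF Suc.prems(1) gT[OF that]]])
    moreover have "B differentiable (at (g x))" using Suc.prems(1) gT[OF that] by (simp add: Ck_on_Suc)
    then have "(\<lambda>h. frechet_derivative B (at (g x)) (frechet_derivative g (at x) h)) =
        (\<lambda>h. frechet_derivative B (at (g x)) 1 * frechet_derivative g (at x) h)"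
      using frechet_derivative_real by blast
    ultimately show ?thesis by simp
  qed
  moreover have "Ck_on k S (\<lambda>x. frechet_derivative B (at (g x)) 1 * frechet_derivative g (at x) h)" for h
  proof (intro Ck_on_mult assms(1) Suc.IH[of "\<lambda>t. frechet_derivative B (at t) 1"])
    show "Ck_on k S g" using Suc.prems Ck_on_SucD by blast
    show "Ck_on k T (\<lambda>t. frechet_derivative B (at t) 1)"
      "Ck_on k S (\<lambda>x. frechet_derivative g (at x) h)"
      using Suc.prems by (simp_all add: Ck_on_Suc)
  qed
  ultimately show ?case by (rule Ck_on_SucI[OF assms(1)])
qed

lemma Ck_on_SucI_real:
  fixes f :: "real \<Rightarrow> real"
  assumes "open S" "\<And>x. x \<in> S \<Longrightarrow> (f has_real_derivative f' x) (at x)" "Ck_on k S f'"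
  shows "Ck_on (Suc k) S f"
  by (rule Ck_on_SucI[OF assms(1), of _ "\<lambda>x h. f' x * h"])
    (use assms in \<open>auto simp: has_field_derivative_def intro!: Ck_on_mult Ck_on_const\<close>)

lemma Ck_on_exp: "Ck_on k UNIV (exp :: real \<Rightarrow> real)"
proof (induction k)
  case (Suc k)
  show ?case by (rule Ck_on_SucI_real[OF _ _ Suc]) (auto intro!: derivative_eq_intros)
qed (auto intro!: continuous_intros)

lemma Ck_on_inverse: "Ck_on k {0<..} (inverse :: real \<Rightarrow> real)"
proof (induction k)
  case (Suc k)
  have *: "Ck_on k {0<..} (\<lambda>x::real. (-1) * (inverse x * inverse x))"
    by (intro Ck_on_mult Suc Ck_on_const) auto
  show ?case
    by (rule Ck_on_SucI_real[OF _ _ *]) (auto intro!: derivative_eq_intros simp: power2_eq_square)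
qed (auto intro!: continuous_intros)

lemma Ck_on_ln: "Ck_on k {0<..} (ln :: real \<Rightarrow> real)"
proof (cases k)
  case (Suc m)
  show ?thesis unfolding Suc
    by (rule Ck_on_SucI_real[OF _ _ Ck_on_inverse]) (auto intro!: derivative_eq_intros simp: field_simps)
qed (auto intro!: continuous_intros)

lemma Ck_on_inner_self: "Ck_on k UNIV (\<lambda>x::'a::real_inner. x \<bullet> x)"
proof (cases k)
  case (Suc m)
  show ?thesis unfolding Suc
  proof (rule Ck_on_SucI[where f'="\<lambda>x h. x \<bullet> (2 *\<^sub>R h)"])
    show "Ck_on m UNIV (\<lambda>x. x \<bullet> (2 *\<^sub>R h))" for h :: 'a
      by (rule Ck_on_linear) (auto intro: bounded_linear_intros)
  qed (auto intro!: derivative_eq_intros simp: inner_commute)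
qed (auto intro!: continuous_intros)

lemma smooth_onD: "smooth_on S f \<Longrightarrow> Ck_on k S f"
  by (simp add: smooth_on_def)

lemma smooth_onI: "(\<And>k. Ck_on k S f) \<Longrightarrow> smooth_on S f"
  by (simp add: smooth_on_def)

lemma smooth_on_cong:
  "open S \<Longrightarrow> (\<And>x. x \<in> S \<Longrightarrow> f x = g x) \<Longrightarrow> smooth_on S f \<Longrightarrow> smooth_on S g"
  by (rule smooth_onI, rule Ck_on_cong[OF _ _ smooth_onD])

lemma smooth_on_mult:
  fixes f g :: "'a::real_normed_vector \<Rightarrow> real"
  shows "open S \<Longrightarrow> smooth_on S f \<Longrightarrow> smooth_on S g \<Longrightarrow> smooth_on S (\<lambda>x. f x * g x)"
  by (rule smooth_onI, rule Ck_on_mult[OF _ smooth_onD smooth_onD])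

lemma smooth_on_add:
  "open S \<Longrightarrow> smooth_on S f \<Longrightarrow> smooth_on S g \<Longrightarrow> smooth_on S (\<lambda>x. f x + g x)"
  by (rule smooth_onI, rule Ck_on_add[OF _ smooth_onD smooth_onD])

lemma smooth_on_const: "open S \<Longrightarrow> smooth_on S (\<lambda>x. c)"
  by (simp add: smooth_on_def Ck_on_const)

lemma smooth_on_linear: "open S \<Longrightarrow> bounded_linear f \<Longrightarrow> smooth_on S f"
  by (simp add: smooth_on_def Ck_on_linear)

lemma smooth_on_subset: "smooth_on S f \<Longrightarrow> T \<subseteq> S \<Longrightarrow> smooth_on T f"
  by (rule smooth_onI, rule Ck_on_subset[OF smooth_onD])

lemma smooth_on_Un:
  "open S \<Longrightarrow> open T \<Longrightarrow> smooth_on S f \<Longrightarrow> smooth_on T f \<Longrightarrow> smooth_on (S \<union> T) f"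
  by (rule smooth_onI, rule Ck_on_Un[OF _ _ smooth_onD smooth_onD])

lemma smooth_on_compose:
  fixes B :: "real \<Rightarrow> real" and g :: "'a::real_normed_vector \<Rightarrow> real"
  shows "open S \<Longrightarrow> open T \<Longrightarrow> g ` S \<subseteq> T \<Longrightarrow> smooth_on T B \<Longrightarrow> smooth_on S g \<Longrightarrow>
    smooth_on S (\<lambda>x. B (g x))"
  by (rule smooth_onI, rule Ck_on_compose[OF _ _ _ smooth_onD smooth_onD])

lemma smooth_on_exp: "smooth_on UNIV (exp :: real \<Rightarrow> real)"
  by (simp add: smooth_on_def Ck_on_exp)

lemma smooth_on_exp_mult: "smooth_on UNIV (\<lambda>s. exp (k * s :: real))"
  by (rule smooth_on_compose[OF _ _ _ smooth_on_exp]) (auto intro!: smooth_on_linear bounded_linear_intros)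

lemma smooth_on_antiderivative:
  fixes f :: "real \<Rightarrow> real"
  assumes "open S" "\<And>x. x \<in> S \<Longrightarrow> (f has_real_derivative f' x) (at x)" "smooth_on S f'"
  shows "smooth_on S f"
  unfolding smooth_on_def
proof
  fix k show "Ck_on k S f"
    by (rule Ck_on_SucD, rule Ck_on_SucI_real[OF assms(1,2)]) (use assms(3) in \<open>auto simp: smooth_on_def\<close>)
qed

lemma smooth_on_differentiable: "smooth_on S f \<Longrightarrow> x \<in> S \<Longrightarrow> f differentiable (at x)"
  using smooth_onD[of S f "Suc 0"] unfolding Ck_on_Suc by blast

lemma smooth_on_frechet:
  "smooth_on S f \<Longrightarrow> smooth_on S (\<lambda>x. frechet_derivative f (at x) h)"
proof (rule smooth_onI)
  fix k assume "smooth_on S f"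
  from smooth_onD[OF this, of "Suc k"] show "Ck_on k S (\<lambda>x. frechet_derivative f (at x) h)"
    unfolding Ck_on_Suc by blast
qed

lemma smooth_on_continuous: "smooth_on S f \<Longrightarrow> continuous_on S f"
  using smooth_onD[of S f 0] by simp

lemma smooth_real_deriv:
  fixes f :: "real \<Rightarrow> real"
  assumes "smooth_on UNIV f"
  obtains f' where "\<And>x. (f has_real_derivative f' x) (at x)" "smooth_on UNIV f'"
proof
  show "smooth_on UNIV (\<lambda>x. frechet_derivative f (at x) 1)" by (rule smooth_on_frechet[OF assms])
  fix x
  have d: "f differentiable (at x)" using smooth_on_differentiable[OF assms] by simp
  have "(f has_derivative (\<lambda>h. frechet_derivative f (at x) h)) (at x)"
    using d frechet_derivative_works by blast
  moreover have "(\<lambda>h. frechet_derivative f (at x) h) = (\<lambda>h. frechet_derivative f (at x) 1 * h)"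
    using frechet_derivative_real[OF d] by blast
  ultimately show "(f has_real_derivative frechet_derivative f (at x) 1) (at x)"
    unfolding has_field_derivative_def by (rule has_derivative_eq_rhs)
qed

lemma smooth_on_neg_ln_norm: "smooth_on (-{0}) (\<lambda>x::'a::real_inner. - ln (norm x))"
proof -
  have 1: "smooth_on (-{0}) (\<lambda>x::'a. x \<bullet> x)"
    using smooth_on_subset[of UNIV "\<lambda>x::'a. x \<bullet> x"] Ck_on_inner_self by (auto simp: smooth_on_def)
  have "smooth_on (-{0}) (\<lambda>x::'a. ln (x \<bullet> x))"
    by (rule smooth_on_compose[of _ "{0<..}" _ ln]) (use 1 in \<open>auto simp: smooth_on_def Ck_on_ln\<close>)
  then have "smooth_on (-{0}) (\<lambda>x::'a. (-1/2) * ln (x \<bullet> x))"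
    by (intro smooth_on_mult smooth_on_const) auto
  then show ?thesis
    by (rule smooth_on_cong[rotated 2]) (simp_all add: norm_eq_sqrt_inner ln_sqrt open_Compl)
qed

section \<open>Test functions and weak derivatives on the line\<close>

lemma tendsto_poly_times_exp_minus:
  fixes P :: "real poly"
  shows "((\<lambda>x. poly P x * exp (- x)) \<longlongrightarrow> 0) at_top"
proof -
  \<comment> \<open>The extra factor \<open>x ^ k\<close> absorbs the shift of degree caused by
    \<open>pCons\<close>, so that the induction on the coefficients closes.\<close>
  have "((\<lambda>x. x ^ k * (poly P x * exp (- x))) \<longlongrightarrow> 0) at_top" for k
  proof (induction P arbitrary: k)
    case 0
    then show ?case by simp
  next
    case (pCons a P)
    have "((\<lambda>x. a * (x ^ k / exp x) + x ^ (Suc k) * (poly P x * exp (- x))) \<longlongrightarrow> a * 0 + 0) at_top"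
      by (intro tendsto_intros tendsto_power_div_exp_0 pCons.IH)
    then show ?case
      by (simp add: field_simps exp_minus)
  qed
  from this[of 0] show ?thesis by simp
qed

text \<open>The functions \<open>P(1/t) e^(-1/t)\<close>, extended by \<open>0\<close>, form a
  family closed under differentiation: \<open>P\<close> becomes \<open>X^2 (P - P')\<close> in the
  variable \<open>X = 1/t\<close>. Smoothness of the flat function with \<open>P = 1\<close> then
  follows by induction on the order, with \<open>P\<close> arbitrary.\<close>

definition bump_poly :: "real poly \<Rightarrow> real \<Rightarrow> real" where
  "bump_poly P t = (if t > 0 then poly P (inverse t) * exp (- inverse t) else 0)"

lemma bump_poly_deriv:
  "(bump_poly P has_real_derivative bump_poly ([:0, 0, 1:] * (P - pderiv P)) t) (at t)"
proof -
  consider "t > 0" | "t < 0" | "t = 0" by linarith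
  then show ?thesis
  proof cases
    case 1
    have "((\<lambda>t. poly P (inverse t) * exp (- inverse t)) has_real_derivative
        bump_poly ([:0, 0, 1:] * (P - pderiv P)) t) (at t)"
      using 1 by (auto intro!: derivative_eq_intros DERIV_chain'[OF _ poly_DERIV]
          simp: bump_poly_def power2_eq_square algebra_simps)
    then show ?thesis
      by (rule has_field_derivative_transform_within_open[of _ _ _ "{0<..}"])
        (use 1 in \<open>auto simp: bump_poly_def\<close>)
  next
    case 2
    have "((\<lambda>t. 0) has_real_derivative bump_poly ([:0, 0, 1:] * (P - pderiv P)) t) (at t)"
      using 2 by (auto simp: bump_poly_def)
    then show ?thesis
      by (rule has_field_derivative_transform_within_open[of _ _ _ "{..<0}"])
        (use 2 in \<open>auto simp: bump_poly_def\<close>)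
  next
    case 3
    \<comment> \<open>The difference quotient at \<open>0\<close> belongs to the same family:
      dividing by \<open>h\<close> multiplies the polynomial in \<open>1/h\<close> by its
      variable.\<close>
    have "((\<lambda>h. poly ([:0,1:] * P) (inverse h) * exp (- inverse h)) \<longlongrightarrow> 0) (at_right 0)"
      by (rule filterlim_compose[OF tendsto_poly_times_exp_minus filterlim_inverse_at_top_right])
    then have "((\<lambda>h. bump_poly P h / h) \<longlongrightarrow> 0) (at_right 0)"
      by (rule Lim_transform_eventually)
        (auto simp: eventually_at_filter bump_poly_def divide_inverse mult_ac)
    moreover have "((\<lambda>h. bump_poly P h / h) \<longlongrightarrow> 0) (at_left 0)"
      by (rule Lim_transform_eventually[OF tendsto_const])
        (auto simp: eventually_at_filter bump_poly_def)
    ultimately have "((\<lambda>h. bump_poly P h / h) \<longlongrightarrow> 0) (at 0)"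
      by (simp add: filterlim_split_at)
    then show ?thesis using 3 by (simp add: DERIV_def bump_poly_def)
  qed
qed

lemma smooth_bump_poly: "smooth_on UNIV (bump_poly P)"
proof (rule smooth_onI)
  fix k show "Ck_on k UNIV (bump_poly P)"
  proof (induction k arbitrary: P)
    case 0
    show ?case
      by (auto intro!: continuous_at_imp_continuous_on DERIV_isCont[OF bump_poly_deriv])
  next
    case (Suc k)
    show ?case by (rule Ck_on_SucI_real[OF _ bump_poly_deriv Suc]) auto
  qed
qed

abbreviation bump :: "real \<Rightarrow> real" where "bump \<equiv> bump_poly 1"

lemma bump_eq: "bump t = (if t > 0 then exp (- inverse t) else 0)"
  by (simp add: bump_poly_def)

lemma bump_nonneg: "0 \<le> bump t" and bump_le_1: "bump t \<le> 1"
  and bump_pos_iff: "0 < bump t \<longleftrightarrow> 0 < t" and bump_eq_0: "t \<le> 0 \<Longrightarrow> bump t = 0"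
  by (auto simp: bump_eq)

text \<open>Steepening yields the indicator of the half-line; products of two such factors, all
  bounded by \<open>1\<close>, approximate indicators of intervals.\<close>

lemma bump_scaled_tendsto: "(\<lambda>n. bump (real n * t)) \<longlonglongrightarrow> (if t > 0 then 1 else 0)"
proof (cases "t > 0")
  case True
  have "(\<lambda>n. exp (- (inverse (real n) * inverse t))) \<longlonglongrightarrow> exp (- (0 * inverse t))"
    by (intro tendsto_intros lim_inverse_n)
  moreover have "\<forall>\<^sub>F n in sequentially. exp (- (inverse (real n) * inverse t)) = bump (real n * t)"
    using eventually_gt_at_top[of "0::nat"] by eventually_elim (simp add: bump_eq True)
  ultimately show ?thesis using True by (simp add: tendsto_cong)
next
  case False
  then have "bump (real n * t) = 0" for n
    by (intro bump_eq_0) (simp add: mult_nonneg_nonpos)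
  then show ?thesis using False by simp
qed

text \<open>For a nonempty open interval \<open>J\<close> these are the smooth functions with
  compact support in \<open>J\<close>. Vanishing off the open interval \<open>{c<..<d}\<close> makes
  the endpoint values zero, so boundary terms drop out of integrations by parts.\<close>

definition tests :: "real set \<Rightarrow> (real \<Rightarrow> real) set" where
  "tests J = {a. smooth_on UNIV a \<and> (\<exists>c d. c < d \<and> {c..d} \<subseteq> J \<and> (\<forall>s. s \<notin> {c<..<d} \<longrightarrow> a s = 0))}"

lemma testsI:
  "smooth_on UNIV a \<Longrightarrow> c < d \<Longrightarrow> {c..d} \<subseteq> J \<Longrightarrow> (\<And>s. s \<notin> {c<..<d} \<Longrightarrow> a s = 0) \<Longrightarrow> a \<in> tests J"
  unfolding tests_def by blast

lemma testsE:
  assumes "a \<in> tests J"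
  obtains c d where "c < d" "{c..d} \<subseteq> J" "\<And>s. s \<notin> {c<..<d} \<Longrightarrow> a s = 0"
  using assms unfolding tests_def by blast

lemma tests_smooth: "a \<in> tests J \<Longrightarrow> smooth_on UNIV a"
  unfolding tests_def by blast

lemma tests_continuous: "a \<in> tests J \<Longrightarrow> continuous_on UNIV a"
  by (simp add: smooth_on_continuous tests_smooth)

lemma tests_mono: "J \<subseteq> J' \<Longrightarrow> tests J \<subseteq> tests J'"
  unfolding tests_def by blast

lemma DERIV_eq_0_outside:
  fixes a :: "real \<Rightarrow> real"
  assumes "(a has_real_derivative l) (at s)" "\<And>t. t \<notin> {c<..<d} \<Longrightarrow> a t = 0" "s \<notin> {c..d}"
  shows "l = 0"
proof -
  have "((\<lambda>t. 0) has_real_derivative l) (at s)"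
    by (rule has_field_derivative_transform_within_open[OF assms(1), of "-{c..d}"]) (use assms in auto)
  then show ?thesis using DERIV_unique[OF _ DERIV_const] by blast
qed

lemma tests_deriv:
  assumes "a \<in> tests J"
  obtains a' where "a' \<in> tests J" "\<And>s. (a has_real_derivative a' s) (at s)"
proof -
  obtain c d where cd: "c < d" "{c..d} \<subseteq> J" "\<And>s. s \<notin> {c<..<d} \<Longrightarrow> a s = 0"
    using testsE[OF assms] by blast
  obtain a' where a': "\<And>s. (a has_real_derivative a' s) (at s)" "smooth_on UNIV a'"
    using smooth_real_deriv[OF tests_smooth[OF assms]] by blast
  have out: "a' s = 0" if s: "s \<notin> {c..d}" for s
    by (rule DERIV_eq_0_outside[OF a'(1) cd(3) s])
  have cont: "isCont a' s" for s
    using smooth_on_continuous[OF a'(2)] by (simp add: continuous_on_eq_continuous_at)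
  \<comment> \<open>At the endpoints the derivative vanishes by continuity from the outer side, so
    \<open>a'\<close> vanishes off the same open interval as \<open>a\<close>.\<close>
  have "a' c = 0"
  proof (rule tendsto_unique)
    show "(a' \<longlongrightarrow> a' c) (at_left c)" using cont[of c] by (auto simp: isCont_def filterlim_at_split)
    show "(a' \<longlongrightarrow> 0) (at_left c)"
      by (rule Lim_transform_eventually[OF tendsto_const]) (auto simp: eventually_at_filter out)
  qed simp
  moreover have "a' d = 0"
  proof (rule tendsto_unique)
    show "(a' \<longlongrightarrow> a' d) (at_right d)" using cont[of d] by (auto simp: isCont_def filterlim_at_split)
    show "(a' \<longlongrightarrow> 0) (at_right d)"
      by (rule Lim_transform_eventually[OF tendsto_const]) (auto simp: eventually_at_filter out)
  qed simp
  ultimately have "a' s = 0" if "s \<notin> {c<..<d}" for s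
    using out[of s] that by force
  then have "a' \<in> tests J" by (rule testsI[OF a'(2) cd(1,2)])
  with a'(1) show ?thesis using that by blast
qed

lemma tests_mult:
  assumes "a \<in> tests J" "smooth_on UNIV f"
  shows "(\<lambda>s. f s * a s) \<in> tests J"
proof -
  obtain c d where "c < d" "{c..d} \<subseteq> J" "\<And>s. s \<notin> {c<..<d} \<Longrightarrow> a s = 0"
    using testsE[OF assms(1)] by blast
  then show ?thesis
    by (intro testsI[of _ c d] smooth_on_mult[OF open_UNIV assms(2) tests_smooth[OF assms(1)]]) auto
qed

text \<open>The two supports may be far apart; the interval property puts the hull of both inside
  \<open>J\<close>.\<close>

lemma tests_add:
  assumes "a \<in> tests J" "b \<in> tests J" "is_interval J"
  shows "(\<lambda>s. a s + b s) \<in> tests J"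
proof -
  obtain c d where 1: "c < d" "{c..d} \<subseteq> J" "\<And>s. s \<notin> {c<..<d} \<Longrightarrow> a s = 0"
    using testsE[OF assms(1)] by blast
  obtain c' d' where 2: "c' < d'" "{c'..d'} \<subseteq> J" "\<And>s. s \<notin> {c'<..<d'} \<Longrightarrow> b s = 0"
    using testsE[OF assms(2)] by blast
  have "min c c' \<in> J" "max d d' \<in> J" using 1(1,2) 2(1,2) by (auto simp: min_def max_def)
  then have "{min c c'..max d d'} \<subseteq> J"
    using assms(3) unfolding is_interval_1 by (meson atLeastAtMost_iff subsetI)
  moreover have "min c c' < max d d'" using 1(1) 2(1) by linarith
  moreover have "a s + b s = 0" if "s \<notin> {min c c'<..<max d d'}" for s
  proof -
    have "s \<notin> {c<..<d}" "s \<notin> {c'<..<d'}" using that by auto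
    then show ?thesis using 1(3) 2(3) by simp
  qed
  ultimately show ?thesis
    using smooth_on_add[OF open_UNIV tests_smooth[OF assms(1)] tests_smooth[OF assms(2)]]
    by (intro testsI) blast+
qed

lemma tests_bump:
  assumes "a < b" "{a..b} \<subseteq> J" "k > 0"
  shows "(\<lambda>s. bump (k * (s - a)) * bump (k * (b - s))) \<in> tests J"
proof (rule testsI[OF _ assms(1,2)])
  have 1: "smooth_on UNIV (\<lambda>s. k * s + l)" for k l :: real
    by (intro smooth_on_add smooth_on_const smooth_on_linear) (auto intro: bounded_linear_intros)
  have 2: "smooth_on UNIV (\<lambda>s. bump (k * s + l))" for k l
    by (rule smooth_on_compose[OF _ _ _ smooth_bump_poly 1]) auto
  show "smooth_on UNIV (\<lambda>s. bump (k * (s - a)) * bump (k * (b - s)))"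
    using smooth_on_mult[OF _ 2[of k "- k * a"] 2[of "- k" "k * b"]] by (simp add: algebra_simps)
  show "bump (k * (s - a)) * bump (k * (b - s)) = 0" if "s \<notin> {a<..<b}" for s
    using that assms(3) by (auto simp: bump_eq_0 mult_nonneg_nonpos)
qed

definition loc_integrable :: "real set \<Rightarrow> (real \<Rightarrow> real) \<Rightarrow> bool" where
  "loc_integrable J F \<longleftrightarrow> (\<forall>c d. {c..d} \<subseteq> J \<longrightarrow> set_integrable lborel {c..d} F)"

lemma loc_integrable_continuous:
  "continuous_on J F \<Longrightarrow> loc_integrable J F"
  unfolding loc_integrable_def by (blast intro: borel_integrable_atLeastAtMost' continuous_on_subset)

lemma loc_integrable_diff:
  "loc_integrable J F \<Longrightarrow> loc_integrable J G \<Longrightarrow> loc_integrable J (\<lambda>s. F s - G s)"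
  unfolding loc_integrable_def by (auto intro: set_integral_diff(1))

lemma integrable_mult_bounded:
  fixes F \<psi> :: "'a \<Rightarrow> real"
  assumes "integrable M F" "\<psi> \<in> borel_measurable M" "\<And>x. x \<in> space M \<Longrightarrow> \<bar>\<psi> x\<bar> \<le> B"
  shows "integrable M (\<lambda>x. F x * \<psi> x)"
proof (rule Bochner_Integration.integrable_bound[where f="\<lambda>x. B * F x"])
  show "integrable M (\<lambda>x. B * F x)" using assms(1) by simp
  show "(\<lambda>x. F x * \<psi> x) \<in> borel_measurable M" using assms by auto
  show "AE x in M. norm (F x * \<psi> x) \<le> norm (B * F x)"
    by (rule AE_I2) (auto simp: abs_mult mult.commute[of B] intro!: mult_left_mono order_trans[OF assms(3)])
qed

lemma loc_integrable_mult:
  assumes "loc_integrable J F" "continuous_on UNIV \<psi>" "{c..d} \<subseteq> J"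
    "\<And>s. s \<notin> {c..d} \<Longrightarrow> \<psi> s = 0"
  shows "integrable lborel (\<lambda>s. F s * \<psi> s)"
proof -
  have "bounded (\<psi> ` {c..d})"
    by (intro compact_imp_bounded compact_continuous_image continuous_on_subset[OF assms(2)]) auto
  then obtain B where "\<And>s. s \<in> {c..d} \<Longrightarrow> \<bar>\<psi> s\<bar> \<le> B" unfolding bounded_iff by force
  then have B: "\<bar>\<psi> s\<bar> \<le> \<bar>B\<bar>" for s
    using assms(4)[of s] by (cases "s \<in> {c..d}") (fastforce intro: order_trans)+
  have "integrable lborel (\<lambda>s. (indicator {c..d} s * F s) * \<psi> s)"
  proof (rule integrable_mult_bounded[OF _ _ B])
    show "integrable lborel (\<lambda>s. indicator {c..d} s * F s)"
      using assms(1,3) by (simp add: loc_integrable_def set_integrable_def)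
    show "\<psi> \<in> borel_measurable lborel"
      using borel_measurable_continuous_onI[OF assms(2)] by simp
  qed
  moreover have "(indicator {c..d} s * F s) * \<psi> s = F s * \<psi> s" for s
    using assms(4)[of s] by (cases "s \<in> {c..d}") auto
  ultimately show ?thesis by simp
qed

lemma loc_integrable_tests:
  assumes "loc_integrable J F" "a \<in> tests J"
  shows "integrable lborel (\<lambda>s. F s * a s)"
proof -
  obtain c d where "c < d" "{c..d} \<subseteq> J" "\<And>s. s \<notin> {c<..<d} \<Longrightarrow> a s = 0"
    using testsE[OF assms(2)] by blast
  then show ?thesis
    by (intro loc_integrable_mult[OF assms(1) tests_continuous[OF assms(2)], of c d])
      (simp_all, meson atLeastAtMost_iff greaterThanLessThan_iff less_imp_le)
qed

lemma tests_integration_by_parts: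
  assumes J: "open J" and f: "\<And>s. s \<in> J \<Longrightarrow> (f has_real_derivative f' s) (at s)" "continuous_on J f'"
    and a: "a \<in> tests J" "\<And>s. (a has_real_derivative a' s) (at s)" "continuous_on UNIV a'"
  shows "(LBINT s. f s * a' s) = - (LBINT s. f' s * a s)"
proof -
  obtain c d where cd: "c < d" "{c..d} \<subseteq> J" "\<And>s. s \<notin> {c<..<d} \<Longrightarrow> a s = 0"
    using testsE[OF a(1)] by blast
  have a'0: "a' s = 0" if "s \<notin> {c..d}" for s
    by (rule DERIV_eq_0_outside[OF a(2) cd(3) that])
  have fc: "continuous_on J f"
    using f(1) DERIV_isCont by (blast intro: continuous_at_imp_continuous_on)
  have i1: "integrable lborel (\<lambda>s. f s * a' s)"
    by (rule loc_integrable_mult[OF loc_integrable_continuous[OF fc] a(3) cd(2)]) (use a'0 in auto)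
  have i2: "integrable lborel (\<lambda>s. f' s * a s)"
    by (rule loc_integrable_tests[OF loc_integrable_continuous[OF f(2)] a(1)])
  have "(LBINT s. (f s * a' s + f' s * a s) * indicator {c..d} s) = f d * a d - f c * a c"
  proof (rule integral_FTC_Icc_real)
    show "DERIV (\<lambda>s. f s * a s) x :> f x * a' x + f' x * a x" if "c \<le> x" "x \<le> d" for x
      using that cd(2) by (auto intro!: derivative_eq_intros f(1) a(2) simp: algebra_simps subset_eq)
    show "isCont (\<lambda>s. f s * a' s + f' s * a s) x" if "c \<le> x" "x \<le> d" for x
    proof -
      have "x \<in> J" using that cd by auto
      then have "isCont f x" "isCont f' x"
        using fc f(2) J by (auto simp: continuous_on_eq_continuous_at)
      moreover have "isCont a x" "isCont a' x"
        using DERIV_isCont[OF a(2)] a(3) by (auto simp: continuous_on_eq_continuous_at)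
      ultimately show ?thesis by (intro continuous_intros)
    qed
  qed (use cd in auto)
  also have "\<dots> = 0" using cd by simp
  also have "(\<lambda>s. (f s * a' s + f' s * a s) * indicator {c..d} s) = (\<lambda>s. f s * a' s + f' s * a s)"
  proof
    show "(f s * a' s + f' s * a s) * indicator {c..d} s = f s * a' s + f' s * a s" for s
      using a'0[of s] cd(3)[of s] by (cases "s \<in> {c..d}") (auto simp: indicator_def)
  qed
  finally show ?thesis using i1 i2 by simp
qed

text \<open>Zero mean is exactly the condition for the primitive to return to \<open>0\<close> on
  the right of the support, hence to be a test function itself.\<close>

lemma tests_primitive:
  assumes "\<psi> \<in> tests J" "(LBINT s. \<psi> s) = 0"
  obtains a where "a \<in> tests J" "\<And>s. (a has_real_derivative \<psi> s) (at s)"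
proof -
  obtain c d where cd: "c < d" "{c..d} \<subseteq> J" "\<And>s. s \<notin> {c<..<d} \<Longrightarrow> \<psi> s = 0"
    using testsE[OF assms(1)] by blast
  \<comment> \<open>Starting at \<open>c - 1\<close> keeps \<open>c\<close> interior to the interval
    of integration, so the derivative there is two-sided.\<close>
  define a where "a s = integral {c - 1..s} \<psi>" for s
  have cont: "continuous_on UNIV \<psi>" by (rule tests_continuous[OF assms(1)])
  have z: "a s = 0" if "s \<le> c" for s
  proof -
    have "integral {c - 1..s} \<psi> = integral {c - 1..s} (\<lambda>s. 0)"
      by (rule integral_cong) (use that cd(3) in auto)
    then show ?thesis by (simp add: a_def)
  qed
  have d1: "(a has_real_derivative \<psi> s) (at s)" for s
  proof (cases "s < c")
    case True
    have "((\<lambda>t. 0) has_real_derivative \<psi> s) (at s)" using cd(3)[of s] True by simp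
    then show ?thesis
      by (rule has_field_derivative_transform_within_open[of _ _ _ "{..<c}"]) (use True z in auto)
  next
    case False
    have "(a has_real_derivative \<psi> s) (at s within {c-1..s+1})"
      unfolding a_def by (rule integral_has_real_derivative) (use False cont in \<open>auto intro: continuous_on_subset\<close>)
    moreover have "s \<in> interior {c-1..s+1}" using False by simp
    ultimately show ?thesis using at_within_interior by metis
  qed
  have ad: "a d = 0"
  proof -
    have "set_integrable lborel {c - 1..d} \<psi>"
      by (rule borel_integrable_atLeastAtMost') (use cont in \<open>auto intro: continuous_on_subset\<close>)
    then have "a d = (LINT s:{c - 1..d}|lborel. \<psi> s)"
      unfolding a_def by (simp add: set_borel_integral_eq_integral)
    also have "\<dots> = (LBINT s. \<psi> s)"
      unfolding set_lebesgue_integral_def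
    proof (rule Bochner_Integration.integral_cong)
      show "indicator {c - 1..d} s *\<^sub>R \<psi> s = \<psi> s" for s
        using cd(3)[of s] by (cases "s \<in> {c<..<d}") (auto simp: indicator_def)
    qed simp
    finally show ?thesis using assms(2) by simp
  qed
  have aend: "a s = a d" if "d \<le> s" for s
  proof (cases "s = d")
    case False
    then have ds: "d < s" using that by simp
    show ?thesis
    proof (rule DERIV_isconst_end[OF ds])
      show "continuous_on {d..s} a"
        using DERIV_isCont[OF d1] by (blast intro: continuous_at_imp_continuous_on)
      show "DERIV a x :> 0" if "d < x" "x < s" for x
        using d1[of x] cd(3)[of x] that by simp
    qed
  qed simp
  have out: "a s = 0" if "s \<notin> {c<..<d}" for s
    using that z[of s] aend[of s] ad by (cases "s \<le> c") simp_all
  have "smooth_on UNIV a"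
    by (rule smooth_on_antiderivative[OF open_UNIV d1 tests_smooth[OF assms(1)]])
  then have "a \<in> tests J" by (rule testsI[OF _ cd(1,2)]) (rule out)
  then show ?thesis using that d1 by blast
qed

section \<open>Functions annihilated by test functions\<close>

lemma AE_eq_0_if_interval_integrals_0:
  fixes G :: "real \<Rightarrow> real"
  assumes G: "integrable lborel G" and 0: "\<And>x. (LINT s:{x<..}|lborel. G s) = 0"
  shows "AE s in lborel. G s = 0"
proof -
  \<comment> \<open>The positive and negative parts of \<open>G\<close> are densities of two finite
    measures that agree on all half-lines \<open>{x<..}\<close>; hence the measures coincide, and so
    do their densities almost everywhere.\<close>
  define P where "P s = max (G s) 0" for s
  define Q where "Q s = max (- G s) 0" for s
  have iP: "integrable lborel P" and iQ: "integrable lborel Q"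
    unfolding P_def Q_def using G by (auto intro: integrable_max)
  have GPQ: "G s = P s - Q s" for s by (simp add: P_def Q_def)
  have em: "emeasure (density lborel (\<lambda>s. ennreal (R s))) {x<..} = ennreal (LINT s:{x<..}|lborel. R s)"
    if "integrable lborel R" "\<And>s. 0 \<le> R s" for R :: "real \<Rightarrow> real" and x
  proof -
    have "emeasure (density lborel (\<lambda>s. ennreal (R s))) {x<..} = (\<integral>\<^sup>+ s. ennreal (R s) * indicator {x<..} s \<partial>lborel)"
    proof (rule emeasure_density)
      show "(\<lambda>s. ennreal (R s)) \<in> borel_measurable lborel"
        using borel_measurable_integrable[OF that(1)] by measurable
      show "{x<..} \<in> sets lborel" by simp
    qed
    also have "\<dots> = (\<integral>\<^sup>+ s. ennreal (indicator {x<..} s * R s) \<partial>lborel)"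
      by (rule nn_integral_cong) (auto simp: indicator_def)
    also have "\<dots> = ennreal (LBINT s. indicator {x<..} s * R s)"
      by (rule nn_integral_eq_integral) (use that in \<open>auto intro!: integrable_real_mult_indicator simp: mult.commute\<close>)
    finally show ?thesis by (simp add: set_lebesgue_integral_def)
  qed
  have "density lborel (\<lambda>s. ennreal (P s)) = density lborel (\<lambda>s. ennreal (Q s))"
  proof (rule measure_eqI_lessThan)
    fix x
    have "set_integrable lborel {x<..} P" "set_integrable lborel {x<..} Q"
      using iP iQ by (auto simp: set_integrable_def intro!: integrable_real_mult_indicator simp: mult.commute)
    then have "(LINT s:{x<..}|lborel. P s) = (LINT s:{x<..}|lborel. Q s)"
      using 0[of x] unfolding GPQ by (simp add: set_integral_diff)
    then show "emeasure (density lborel (\<lambda>s. ennreal (P s))) {x<..} = emeasure (density lborel (\<lambda>s. ennreal (Q s))) {x<..}"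
      using em[OF iP] em[OF iQ] by (simp add: P_def Q_def)
    show "emeasure (density lborel (\<lambda>s. ennreal (P s))) {x<..} < \<infinity>"
      using em[OF iP] by (simp add: P_def)
  qed auto
  then have "AE s in lborel. ennreal (P s) = ennreal (Q s)"
    using borel_measurable_integrable[OF iP] borel_measurable_integrable[OF iQ]
    by (intro sigma_finite_measure.density_unique[OF sigma_finite_lborel]) auto
  moreover have "0 \<le> P s" "0 \<le> Q s" for s by (auto simp: P_def Q_def)
  ultimately have "AE s in lborel. P s = Q s" by (simp only: ennreal_inj)
  then show ?thesis
    by eventually_elim (simp only: GPQ diff_self)
qed

text \<open>Countably many intervals with rational endpoints already cover \<open>J\<close>, so the
  union of the exceptional sets is still null.\<close>

lemma AE_open_real_if_intervals:
  fixes J :: "real set"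
  assumes "open J" "\<And>c d. c < d \<Longrightarrow> {c..d} \<subseteq> J \<Longrightarrow> AE s in lborel. s \<in> {c<..<d} \<longrightarrow> P s"
  shows "AE s in lborel. s \<in> J \<longrightarrow> P s"
proof -
  have "AE s in lborel. \<forall>c\<in>\<rat>. \<forall>d\<in>\<rat>. c < d \<and> {c..d} \<subseteq> J \<longrightarrow> s \<in> {c<..<d} \<longrightarrow> P s"
    using assms(2) by (intro AE_ball_countable[THEN iffD2] ballI countable_rat) auto
  then show ?thesis
  proof eventually_elim
    case (elim s)
    show ?case
    proof
      assume "s \<in> J"
      then obtain e where e: "e > 0" "ball s e \<subseteq> J" using assms(1) open_contains_ball by blast
      obtain c where c: "c \<in> \<rat>" "s - e < c" "c < s" using Rats_dense_in_real[of "s - e" s] e by auto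
      obtain d where d: "d \<in> \<rat>" "s < d" "d < s + e" using Rats_dense_in_real[of s "s + e"] e by auto
      have "{c..d} \<subseteq> ball s e" using c d by (auto simp: dist_real_def)
      then show "P s" using elim c d e(2) by (meson greaterThanLessThan_iff order_trans less_trans)
    qed
  qed
qed

lemma fundamental_lemma_tests:
  assumes J: "open J" and G: "loc_integrable J G"
    and 0: "\<And>\<psi>. \<psi> \<in> tests J \<Longrightarrow> (LBINT s. G s * \<psi> s) = 0"
  shows "AE s in lborel. s \<in> J \<longrightarrow> G s = 0"
proof (rule AE_open_real_if_intervals[OF J])
  fix c d :: real
  assume cd: "c < d" "{c..d} \<subseteq> J"
  \<comment> \<open>Products of two steep bumps tend to the indicator of \<open>{a<..<b}\<close> and
    stay below \<open>1\<close>, so dominated convergence passes the hypothesis on test functions to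
    intervals.\<close>
  have sub: "(LBINT s. indicator {a<..<b} s * G s) = 0" if ab: "a < b" "{a..b} \<subseteq> J" for a b
  proof (rule LIMSEQ_unique)
    let ?\<psi> = "\<lambda>n s. bump (real (Suc n) * (s - a)) * bump (real (Suc n) * (b - s))"
    have \<psi>: "?\<psi> n \<in> tests J" for n by (rule tests_bump[OF ab]) simp
    have out: "?\<psi> n s = 0" if "s \<notin> {a<..<b}" for n s
      using that by (auto simp: bump_eq_0 mult_nonneg_nonpos simp del: of_nat_Suc)
    have iG: "integrable lborel (\<lambda>s. indicator {a..b} s * G s)"
      using G ab by (auto simp: loc_integrable_def set_integrable_def)
    have iG': "integrable lborel (\<lambda>s. indicator {a<..<b} s * G s)"
      using set_integrable_subset[of lborel "{a..b}" G "{a<..<b}"] iG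
      by (simp add: set_integrable_def greaterThanLessThan_subseteq_atLeastAtMost_iff)
    show "(\<lambda>n. LBINT s. G s * ?\<psi> n s) \<longlonglongrightarrow> (LBINT s. indicator {a<..<b} s * G s)"
    proof (rule integral_dominated_convergence[where w="\<lambda>s. norm (indicator {a..b} s * G s)"])
      show "integrable lborel (\<lambda>s. norm (indicator {a..b} s * G s))" using iG by (rule integrable_norm)
      show "(\<lambda>s. G s * ?\<psi> n s) \<in> borel_measurable lborel" for n
        using loc_integrable_tests[OF G \<psi>[of n]] by (rule borel_measurable_integrable)
      show "(\<lambda>s. indicator {a<..<b} s * G s) \<in> borel_measurable lborel"
        using iG' by (rule borel_measurable_integrable)
      show "AE s in lborel. (\<lambda>n. G s * ?\<psi> n s) \<longlonglongrightarrow> indicator {a<..<b} s * G s"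
      proof (rule AE_I2)
        fix s
        have "(\<lambda>n. G s * ?\<psi> n s) \<longlonglongrightarrow> G s * ((if s - a > 0 then 1 else 0) * (if b - s > 0 then 1 else 0))"
          by (intro tendsto_intros LIMSEQ_Suc[OF bump_scaled_tendsto])
        then show "(\<lambda>n. G s * ?\<psi> n s) \<longlonglongrightarrow> indicator {a<..<b} s * G s"
          by (auto simp: indicator_def split: if_splits)
      qed
      show "AE s in lborel. norm (G s * ?\<psi> n s) \<le> norm (indicator {a..b} s * G s)" for n
      proof (rule AE_I2)
        fix s
        have "\<bar>?\<psi> n s\<bar> \<le> 1"
          unfolding abs_mult by (intro mult_le_one) (auto simp: bump_nonneg bump_le_1 abs_of_nonneg[OF bump_nonneg] simp del: of_nat_Suc)
        then show "norm (G s * ?\<psi> n s) \<le> norm (indicator {a..b} s * G s)"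
        proof (cases "s \<in> {a<..<b}")
          case True
          then show ?thesis using mult_left_mono[OF \<open>\<bar>?\<psi> n s\<bar> \<le> 1\<close>, of "\<bar>G s\<bar>"] by (simp add: abs_mult del: of_nat_Suc)
        qed (simp add: out del: of_nat_Suc)
      qed
    qed
    show "(\<lambda>n. LBINT s. G s * ?\<psi> n s) \<longlonglongrightarrow> 0" using 0[OF \<psi>] by simp
  qed
  have "AE s in lborel. indicator {c<..<d} s * G s = 0"
  proof (rule AE_eq_0_if_interval_integrals_0)
    show "integrable lborel (\<lambda>s. indicator {c<..<d} s * G s)"
      using set_integrable_subset[of lborel "{c..d}" G "{c<..<d}"] G cd
      by (simp add: set_integrable_def loc_integrable_def greaterThanLessThan_subseteq_atLeastAtMost_iff)
    fix x
    show "(LINT s:{x<..}|lborel. indicator {c<..<d} s * G s) = 0"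
    proof (cases "max c x < d")
      case True
      have "(LBINT s. indicator {max c x<..<d} s * G s) = 0"
        by (rule sub[OF True]) (use cd in auto)
      moreover have "indicator {max c x<..<d} s * G s = indicator {x<..} s * (indicator {c<..<d} s * G s)" for s
        by (auto simp: indicator_def)
      ultimately show ?thesis by (simp add: set_lebesgue_integral_def)
    next
      case False
      then have "(\<lambda>s. indicator {x<..} s *\<^sub>R (indicator {c<..<d} s * G s)) = (\<lambda>s. 0)"
        by (auto simp: indicator_def)
      then show ?thesis unfolding set_lebesgue_integral_def by (simp only: integral_zero)
    qed
  qed
  then show "AE s in lborel. s \<in> {c<..<d} \<longrightarrow> G s = 0"
    by eventually_elim (auto simp: indicator_def)
qed

lemma AE_open_ex:
  fixes U :: "'a::euclidean_space set"
  assumes "open U" "U \<noteq> {}" "AE x in lborel. P x"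
  shows "\<exists>x\<in>U. P x"
proof (rule ccontr)
  assume "\<not> ?thesis"
  then have "AE x in lborel. x \<notin> U" using assms(3) by (auto elim: eventually_mono)
  then have "emeasure lborel U = 0"
    using assms(1) by (subst (asm) AE_iff_measurable[of U]) auto
  then have "U \<in> null_sets lborel" using assms(1) by (auto intro: null_setsI)
  then show False using assms(1,2) open_not_negligible[of U]
    by (metis negligible_iff_null_sets null_sets_completionI)
qed

lemma tests_integral_1:
  assumes "open J" "J \<noteq> {}"
  obtains \<psi> where "\<psi> \<in> tests J" "(LBINT s. \<psi> s) = 1"
proof -
  obtain x where "x \<in> J" using assms(2) by blast
  then obtain e where e: "e > 0" "cball x e \<subseteq> J"
    using assms(1) open_contains_cball by blast
  define a b where "a = x - e" and "b = x + e"
  have ab: "a < b" "{a..b} \<subseteq> J" using e by (simp_all add: a_def b_def cball_eq_atLeastAtMost)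
  define \<psi> where "\<psi> s = bump (1 * (s - a)) * bump (1 * (b - s))" for s
  have \<psi>: "\<psi> \<in> tests J" unfolding \<psi>_def by (rule tests_bump[OF ab]) simp
  have int: "integrable lborel \<psi>"
    using loc_integrable_tests[OF loc_integrable_continuous[OF continuous_on_const] \<psi>, of 1] by simp
  have pos: "0 < \<psi> s" if "s \<in> {a<..<b}" for s
    using that by (simp add: \<psi>_def bump_pos_iff)
  have nn: "0 \<le> \<psi> s" for s by (simp add: \<psi>_def bump_nonneg)
  have "(LBINT s. \<psi> s) \<noteq> 0"
  proof
    assume "(LBINT s. \<psi> s) = 0"
    then have "AE s in lborel. \<psi> s = 0"
      using integral_nonneg_eq_0_iff_AE[OF int] nn by simp
    then have "\<exists>s\<in>{a<..<b}. \<psi> s = 0" by (rule AE_open_ex[rotated 2]) (use ab in auto)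
    then show False using pos by force
  qed
  then show ?thesis
    using that[OF tests_mult[OF \<psi> smooth_on_const[OF open_UNIV, of "1 / (LBINT s. \<psi> s)"]]]
    by simp
qed

text \<open>Subtracting the multiple \<open>m\<close> of a fixed test function of mass
  \<open>1\<close> gives any test function mean zero, hence a primitive among the test functions;
  the correction accounts for the constant \<open>K\<close>.\<close>

lemma du_Bois_Reymond:
  assumes J: "open J" "is_interval J" "J \<noteq> {}" and F: "loc_integrable J F"
    and 0: "\<And>a a'. a \<in> tests J \<Longrightarrow> a' \<in> tests J \<Longrightarrow> (\<And>s. (a has_real_derivative a' s) (at s)) \<Longrightarrow>
      (LBINT s. F s * a' s) = 0"
  shows "\<exists>K. AE s in lborel. s \<in> J \<longrightarrow> F s = K"
proof -
  obtain \<psi>0 where \<psi>0: "\<psi>0 \<in> tests J" "(LBINT s. \<psi>0 s) = 1" using tests_integral_1 J by blast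
  define K where "K = (LBINT s. F s * \<psi>0 s)"
  have one: "integrable lborel \<psi>" if "\<psi> \<in> tests J" for \<psi>
    using loc_integrable_tests[OF loc_integrable_continuous[OF continuous_on_const] that, of 1] by simp
  have "AE s in lborel. s \<in> J \<longrightarrow> F s - K = 0"
  proof (rule fundamental_lemma_tests[OF J(1)])
    show "loc_integrable J (\<lambda>s. F s - K)"
      by (intro loc_integrable_diff F loc_integrable_continuous) auto
    fix \<psi> assume \<psi>: "\<psi> \<in> tests J"
    define m where "m = (LBINT s. \<psi> s)"
    have t: "(\<lambda>s. \<psi> s + (- m) * \<psi>0 s) \<in> tests J"
      by (intro tests_add tests_mult \<psi> \<psi>0 J smooth_on_const) auto
    have "(LBINT s. \<psi> s + (- m) * \<psi>0 s) = 0"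
      using one[OF \<psi>] one[OF \<psi>0(1)] \<psi>0(2) by (simp add: m_def)
    then obtain a where "a \<in> tests J" "\<And>s. (a has_real_derivative \<psi> s + (- m) * \<psi>0 s) (at s)"
      using tests_primitive[OF t] by blast
    then have "(LBINT s. F s * (\<psi> s + (- m) * \<psi>0 s)) = 0"
      using 0 t by blast
    moreover have "F s * (\<psi> s + (- m) * \<psi>0 s) = F s * \<psi> s - m * (F s * \<psi>0 s)" for s
      by (simp add: algebra_simps)
    ultimately have "(LBINT s. F s * \<psi> s) = m * K"
      using loc_integrable_tests[OF F \<psi>] loc_integrable_tests[OF F \<psi>0(1)] by (simp add: K_def)
    then show "(LBINT s. (F s - K) * \<psi> s) = 0"
      using loc_integrable_tests[OF F \<psi>] one[OF \<psi>] by (simp add: left_diff_distrib m_def)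
  qed
  then show ?thesis by auto
qed

lemma AE_eq_imp_eq_continuous:
  fixes f g :: "'a::euclidean_space \<Rightarrow> real"
  assumes "open S" "continuous_on S f" "continuous_on S g" "AE x in lborel. x \<in> S \<longrightarrow> f x = g x" "x \<in> S"
  shows "f x = g x"
proof (rule ccontr)
  assume ne: "f x \<noteq> g x"
  let ?U = "{x \<in> S. f x - g x \<in> -{0}}"
  have op: "open ?U"
    using continuous_open_preimage[of S "\<lambda>x. f x - g x" "-{0}"] assms(1-3)
    by (auto intro!: continuous_intros simp: vimage_def Int_def)
  have "?U \<noteq> {}" using assms(5) ne by auto
  from AE_open_ex[OF op this assms(4)] show False by auto
qed

text \<open>With \<open>c = e^(-\<kappa> s) a'\<close> the tested expression is \<open>P c'\<close>,
  because \<open>e^(-\<kappa> s) (a'' - \<kappa> a') = c'\<close>. Two integrations by parts turn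
  the right side into the integral of \<open>- L c'\<close>, where \<open>M' = F\<close> and
  \<open>L' = e^(\<kappa> s) M\<close>. So \<open>c'\<close> annihilates \<open>P + L\<close>, but
  only if \<open>e^(\<kappa> s) c\<close> has mean zero, since \<open>a\<close> must have compact
  support. This constraint costs one more constant \<open>k\<close>, multiplying a primitive
  \<open>R\<close> of \<open>e^(\<kappa> s)\<close>: the result is \<open>P = K - L - k R\<close>,
  which can be differentiated twice.\<close>

lemma weak_second_order_C2:
  fixes \<kappa> :: real
  assumes J: "open J" "is_interval J" "J \<noteq> {}" and P: "continuous_on J P" and F: "continuous_on J F"
    and weak: "\<And>a a' a''. a \<in> tests J \<Longrightarrow> a' \<in> tests J \<Longrightarrow> a'' \<in> tests J \<Longrightarrow>
      (\<And>s. (a has_real_derivative a' s) (at s)) \<Longrightarrow> (\<And>s. (a' has_real_derivative a'' s) (at s)) \<Longrightarrow>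
      (LBINT s. P s * (exp (- \<kappa> * s) * (a'' s - \<kappa> * a' s))) = - (LBINT s. F s * a s)"
  shows "\<exists>D. (\<forall>s\<in>J. (P has_real_derivative D s) (at s)) \<and>
      (\<forall>s\<in>J. ((\<lambda>s. exp (- \<kappa> * s) * D s) has_real_derivative - F s) (at s))"
proof -
  obtain s0 where s0: "s0 \<in> J" using J by blast
  have prim: "\<exists>M. \<forall>s\<in>J. (M has_real_derivative G s) (at s)" if G: "continuous_on J G" for G
  proof -
    have "((\<lambda>u. LBINT y=s0..u. G y) has_vector_derivative G s) (at s)" if s: "s \<in> J" for s
    proof -
      obtain e where e: "e > 0" "cball s e \<subseteq> J" using J(1) s open_contains_cball by blast
      define a b where "a = min s0 (s - e)" and "b = max s0 (s + e)"
      have "s - e \<in> J" "s + e \<in> J" using e by (auto simp: subset_eq dist_real_def)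
      then have "{a..b} \<subseteq> J"
        using J(2) s0 unfolding is_interval_1 a_def b_def
        by (metis (no_types, lifting) atLeastAtMost_iff max_def min_def subsetI)
      then have "((\<lambda>u. LBINT y=s0..u. G y) has_vector_derivative G s) (at s within {a..b})"
        by (intro interval_integral_FTC2) (use e G in \<open>auto simp: a_def b_def intro: continuous_on_subset\<close>)
      moreover have "s \<in> interior {a..b}" using e by (auto simp: a_def b_def)
      ultimately show ?thesis using at_within_interior by metis
    qed
    then show ?thesis by (auto simp: has_real_derivative_iff_has_vector_derivative)
  qed
  obtain M where M: "\<And>s. s \<in> J \<Longrightarrow> (M has_real_derivative F s) (at s)" using prim[OF F] by blast
  have Mc: "continuous_on J M" using M DERIV_isCont by (blast intro: continuous_at_imp_continuous_on)
  obtain L where L: "\<And>s. s \<in> J \<Longrightarrow> (L has_real_derivative exp (\<kappa> * s) * M s) (at s)"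
    using prim[of "\<lambda>s. exp (\<kappa> * s) * M s"] Mc continuous_on_mult[OF _ Mc, of "\<lambda>s. exp (\<kappa> * s)"]
    by (force intro!: continuous_intros)
  have Lc: "continuous_on J L" using L DERIV_isCont by (blast intro: continuous_at_imp_continuous_on)
  obtain R where R: "\<And>s. s \<in> J \<Longrightarrow> (R has_real_derivative exp (\<kappa> * s)) (at s)"
    using prim[of "\<lambda>s. exp (\<kappa> * s)"] by (force intro!: continuous_intros)
  have Rc: "continuous_on J R" using R DERIV_isCont by (blast intro: continuous_at_imp_continuous_on)
  have cint: "integrable lborel (\<lambda>s. G s * a s)" if "continuous_on J G" "a \<in> tests J" for G a
    using loc_integrable_tests[OF loc_integrable_continuous] that by blast
  have key: "(LBINT s. (P s + L s) * c' s) = 0"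
    if c: "c \<in> tests J" "c' \<in> tests J" "\<And>s. (c has_real_derivative c' s) (at s)"
      and c0: "(LBINT s. exp (\<kappa> * s) * c s) = 0" for c c'
  proof -
    obtain a where a: "a \<in> tests J" "\<And>s. (a has_real_derivative exp (\<kappa> * s) * c s) (at s)"
      using tests_primitive[OF tests_mult[OF c(1) smooth_on_exp_mult] c0] by blast
    define a' where "a' s = exp (\<kappa> * s) * c s" for s
    define a'' where "a'' s = exp (\<kappa> * s) * (c' s + \<kappa> * c s)" for s
    have a': "a' \<in> tests J" unfolding a'_def by (rule tests_mult[OF c(1) smooth_on_exp_mult])
    have a'': "a'' \<in> tests J" unfolding a''_def
      by (intro tests_mult tests_add c J smooth_on_exp_mult smooth_on_const) auto
    have d: "(a' has_real_derivative a'' s) (at s)" for s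
      unfolding a'_def a''_def by (auto intro!: derivative_eq_intros c(3) simp: algebra_simps)
    have "(LBINT s. P s * (exp (- \<kappa> * s) * (a'' s - \<kappa> * a' s))) = - (LBINT s. F s * a s)"
      by (rule weak[OF a(1) a' a'' _ d]) (use a(2) in \<open>simp add: a'_def\<close>)
    also have "(\<lambda>s. P s * (exp (- \<kappa> * s) * (a'' s - \<kappa> * a' s))) = (\<lambda>s. P s * c' s)"
      by (auto simp: a''_def a'_def algebra_simps simp flip: exp_add)
    also have "- (LBINT s. F s * a s) = (LBINT s. M s * a' s)"
      using tests_integration_by_parts[OF J(1) M F a(1), of a'] a(2) tests_continuous[OF a']
      by (simp add: a'_def)
    also have "(\<lambda>s. M s * a' s) = (\<lambda>s. (exp (\<kappa> * s) * M s) * c s)"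
      by (auto simp: a'_def)
    also have "(LBINT s. (exp (\<kappa> * s) * M s) * c s) = - (LBINT s. L s * c' s)"
    proof -
      have "continuous_on J (\<lambda>s. exp (\<kappa> * s) * M s)" by (intro continuous_intros Mc)
      from tests_integration_by_parts[OF J(1) L this c(1) c(3) tests_continuous[OF c(2)]]
      show ?thesis by linarith
    qed
    finally show ?thesis
      using cint[OF P c(2)] cint[OF Lc c(2)] by (simp add: distrib_right)
  qed
  obtain \<psi> where \<psi>: "\<psi> \<in> tests J" "(LBINT s. \<psi> s) = 1" using tests_integral_1 J by blast
  \<comment> \<open>Subtracting \<open>m * c0\<close> puts an arbitrary test function under the
    constraint of \<open>key\<close>. The defect is \<open>m * k\<close>, and the term
    \<open>k * R\<close> is there to cancel it.\<close>
  define c0 where "c0 s = exp (- \<kappa> * s) * \<psi> s" for s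
  have c0: "c0 \<in> tests J" unfolding c0_def by (rule tests_mult[OF \<psi>(1) smooth_on_exp_mult])
  obtain c0' where c0': "c0' \<in> tests J" "\<And>s. (c0 has_real_derivative c0' s) (at s)"
    using tests_deriv[OF c0] by blast
  have c01: "(LBINT s. exp (\<kappa> * s) * c0 s) = 1"
    using \<psi>(2) by (simp add: c0_def flip: exp_add mult.assoc)
  define k where "k = (LBINT s. (P s + L s) * c0' s)"
  have PLc: "continuous_on J (\<lambda>s. P s + L s)" by (intro continuous_intros P Lc)
  have "\<exists>K. AE s in lborel. s \<in> J \<longrightarrow> P s + L s + k * R s = K"
  proof (rule du_Bois_Reymond[OF J])
    show "loc_integrable J (\<lambda>s. P s + L s + k * R s)"
      by (intro loc_integrable_continuous continuous_intros P Lc Rc)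
    fix a a' assume a: "a \<in> tests J" "a' \<in> tests J" "\<And>s. (a has_real_derivative a' s) (at s)"
    define m where "m = (LBINT s. exp (\<kappa> * s) * a s)"
    have ec: "continuous_on J (\<lambda>s. exp (\<kappa> * s))" by (intro continuous_intros)
    have "(LBINT s. (P s + L s) * (a' s + (- m) * c0' s)) = 0"
    proof (rule key[of "\<lambda>s. a s + (- m) * c0 s"])
      show "(\<lambda>s. a s + (- m) * c0 s) \<in> tests J" "(\<lambda>s. a' s + (- m) * c0' s) \<in> tests J"
        by (intro tests_add tests_mult a c0 c0' J smooth_on_const; simp)+
      show "((\<lambda>s. a s + (- m) * c0 s) has_real_derivative a' s + (- m) * c0' s) (at s)" for s
        by (auto intro!: derivative_eq_intros a(3) c0'(2))
      have "(LBINT s. exp (\<kappa> * s) * (a s + (- m) * c0 s)) =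
          (LBINT s. exp (\<kappa> * s) * a s - m * (exp (\<kappa> * s) * c0 s))"
        by (simp add: algebra_simps)
      also have "\<dots> = 0" using cint[OF ec a(1)] cint[OF ec c0] c01 by (simp add: m_def)
      finally show "(LBINT s. exp (\<kappa> * s) * (a s + (- m) * c0 s)) = 0" .
    qed
    moreover have "(P s + L s) * (a' s + (- m) * c0' s) = (P s + L s) * a' s - m * ((P s + L s) * c0' s)" for s
      by (simp add: algebra_simps)
    ultimately have 1: "(LBINT s. (P s + L s) * a' s) = m * k"
      using cint[OF PLc a(2)] cint[OF PLc c0'(1)] by (simp add: k_def)
    have 2: "(LBINT s. R s * a' s) = - m"
      using tests_integration_by_parts[OF J(1) R ec a(1) a(3) tests_continuous[OF a(2)]] by (simp add: m_def)
    have "(LBINT s. (P s + L s + k * R s) * a' s) = (LBINT s. (P s + L s) * a' s + k * (R s * a' s))"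
      by (simp add: algebra_simps)
    also have "\<dots> = 0" using cint[OF PLc a(2)] cint[OF Rc a(2)] 1 2 by simp
    finally show "(LBINT s. (P s + L s + k * R s) * a' s) = 0" .
  qed
  then obtain K where K: "AE s in lborel. s \<in> J \<longrightarrow> P s + L s + k * R s = K" by blast
  have PE: "P s = K - L s - k * R s" if "s \<in> J" for s
    using AE_eq_imp_eq_continuous[OF J(1) _ _ K that] P Lc Rc by (force intro!: continuous_intros)
  have "(P has_real_derivative - (exp (\<kappa> * s) * (M s + k))) (at s)" if "s \<in> J" for s
    by (rule has_field_derivative_transform_within_open[of "\<lambda>s. K - L s - k * R s" _ _ J])
      (use PE that J in \<open>auto intro!: derivative_eq_intros L R simp: algebra_simps\<close>)
  moreover have "((\<lambda>s. exp (- \<kappa> * s) * - (exp (\<kappa> * s) * (M s + k))) has_real_derivative - F s) (at s)" if "s \<in> J" for s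
  proof -
    have "((\<lambda>s. - (M s + k)) has_real_derivative - F s) (at s)"
      by (auto intro!: derivative_eq_intros M that)
    then show ?thesis by (simp add: mult.assoc[symmetric] exp_add[symmetric])
  qed
  ultimately show ?thesis by (intro exI[of _ "\<lambda>s. - (exp (\<kappa> * s) * (M s + k))"]) blast
qed

section \<open>Logarithmic polar coordinates\<close>

text \<open>At the origin \<open>nlog\<close> takes the junk value \<open>0\<close>.\<close>

definition nlog :: "'a::real_normed_vector \<Rightarrow> real" where
  "nlog x = - ln (norm x)"

lemma nlog_measurable [measurable]: "nlog \<in> borel_measurable borel"
  unfolding nlog_def[abs_def] by measurable

lemma exp_neg_nlog: "x \<noteq> 0 \<Longrightarrow> exp (- nlog x) = norm x"
  by (simp add: nlog_def)

lemma exp_double_nlog: "x \<noteq> 0 \<Longrightarrow> exp (2 * nlog x) = (inverse (norm x))\<^sup>2"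
  by (simp add: nlog_def exp_double exp_minus power_inverse)

lemma nlog_scaleR: "c > 0 \<Longrightarrow> x \<noteq> 0 \<Longrightarrow> nlog (c *\<^sub>R x) = nlog x - ln c"
  by (simp add: nlog_def ln_mult)

lemma less_nlog_iff: "x \<noteq> 0 \<Longrightarrow> a < nlog x \<longleftrightarrow> norm x < exp (- a)"
  using exp_less_cancel_iff[of "- nlog x" "- a"] by (simp add: exp_neg_nlog)

lemma nlog_less_iff: "x \<noteq> 0 \<Longrightarrow> nlog x < a \<longleftrightarrow> exp (- a) < norm x"
  using exp_less_cancel_iff[of "- a" "- nlog x"] by (simp add: exp_neg_nlog)

lemma AE_lborel_nonzero: "AE x in lborel. x \<noteq> (0::'a::euclidean_space)"
  using AE_lborel_singleton[of 0] by simp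

lemma nn_integral_ball_finite:
  fixes b :: "'a::euclidean_space \<Rightarrow> real"
  assumes "\<And>x. b x \<le> B"
  shows "(\<integral>\<^sup>+x. ennreal (b x) * indicator (ball 0 1) x \<partial>lborel) < \<infinity>"
proof -
  have "(\<integral>\<^sup>+x. ennreal (b x) * indicator (ball 0 1) x \<partial>lborel) \<le>
      (\<integral>\<^sup>+x. ennreal B * indicator (ball 0 1) x \<partial>(lborel :: 'a measure))"
    by (intro nn_integral_mono mult_right_mono ennreal_leI assms) auto
  also have "\<dots> = ennreal B * emeasure lborel (ball (0::'a) 1)"
    by (rule nn_integral_cmult_indicator) simp
  also have "\<dots> < \<infinity>"
    using emeasure_lborel_ball_finite[of "0::'a" 1] by (simp add: ennreal_mult_less_top)
  finally show ?thesis .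
qed

text \<open>For \<open>b\<close> homogeneous of degree \<open>0\<close> this is the integral of
  \<open>b\<close> over the unit sphere, expressed through the unit ball.\<close>

definition cone_const :: "('a::euclidean_space \<Rightarrow> real) \<Rightarrow> real" where
  "cone_const b = real DIM('a) * enn2real (\<integral>\<^sup>+x. ennreal (b x) * indicator (ball 0 1) x \<partial>lborel)"

text \<open>Polar coordinates as an identity of measures, with the weight \<open>b\<close> selecting
  directions. Scaling by \<open>e^a\<close> carries the set where \<open>nlog\<close> exceeds
  \<open>a\<close> to the unit ball, up to the origin; so both measures give the mass
  \<open>C1 e^(-N a)\<close> to \<open>{a<..}\<close>, and finite masses of half-lines determine a
  measure.\<close>

lemma distr_nlog_density:
  fixes b :: "'a::euclidean_space \<Rightarrow> real"
  assumes b[measurable]: "b \<in> borel_measurable borel" and nn: "\<And>x. 0 \<le> b x" and bd: "\<And>x. b x \<le> B"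
    and hom: "\<And>c x. c > 0 \<Longrightarrow> b (c *\<^sub>R x) = b x"
  shows "distr (density lborel (\<lambda>x. ennreal (b x))) borel nlog =
    density lborel (\<lambda>s. ennreal (cone_const b * exp (- (real DIM('a) * s))))"
proof -
  define N where "N = real DIM('a)"
  have N: "N > 0" by (simp add: N_def)
  define C0 where "C0 = (\<integral>\<^sup>+x. ennreal (b x) * indicator (ball 0 1) x \<partial>(lborel :: 'a measure))"
  have "C0 < \<infinity>" unfolding C0_def by (rule nn_integral_ball_finite[OF bd])
  then have C0: "C0 = ennreal (enn2real C0)" by (simp add: less_top)
  define C1 where "C1 = enn2real C0"
  have C1: "C1 \<ge> 0" "C0 = ennreal C1" using C0 by (auto simp: C1_def)
  have CC: "cone_const b = N * C1" by (simp add: cone_const_def C1_def C0_def N_def)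
  have L: "emeasure (distr (density lborel (\<lambda>x. ennreal (b x))) borel nlog) {a<..} = ennreal (exp (- (N * a)) * C1)" for a
  proof -
    define f where "f = (\<lambda>x::'a. ennreal (b x) * indicator (ball 0 1) x)"
    have fm[measurable]: "f \<in> borel_measurable borel"
      unfolding f_def by (intro borel_measurable_times_ennreal borel_measurable_indicator) auto
    have "C0 = (\<integral>\<^sup>+x. f x \<partial>density (distr lborel borel (\<lambda>x. 0 + exp a *\<^sub>R x)) (\<lambda>_. ennreal (\<bar>exp a\<bar> ^ DIM('a))))"
      unfolding C0_def f_def[symmetric] by (subst lborel_affine[symmetric, of "exp a" 0]) auto
    also have "\<dots> = ennreal (exp a ^ DIM('a)) * (\<integral>\<^sup>+x. f (exp a *\<^sub>R x) \<partial>lborel)"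
      by (simp add: nn_integral_density nn_integral_distr nn_integral_cmult)
    finally have 1: "ennreal C1 = ennreal (exp (N * a)) * (\<integral>\<^sup>+x. f (exp a *\<^sub>R x) \<partial>lborel)"
      using C1(2) by (simp add: N_def exp_of_nat_mult)
    have "ennreal (exp (- (N * a)) * C1) = ennreal (exp (- (N * a))) * (ennreal (exp (N * a)) * (\<integral>\<^sup>+x. f (exp a *\<^sub>R x) \<partial>lborel))"
      using C1(1) by (simp add: ennreal_mult 1[symmetric])
    also have "\<dots> = (\<integral>\<^sup>+x. f (exp a *\<^sub>R x) \<partial>lborel)"
      by (simp add: mult.assoc[symmetric] ennreal_mult[symmetric] exp_add[symmetric])
    finally have 2: "ennreal (exp (- (N * a)) * C1) = (\<integral>\<^sup>+x. f (exp a *\<^sub>R x) \<partial>lborel)" .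
    have "emeasure (distr (density lborel (\<lambda>x. ennreal (b x))) borel nlog) {a<..} =
        emeasure (density lborel (\<lambda>x. ennreal (b x))) (nlog -` {a<..})"
      by (subst emeasure_distr) auto
    also have "\<dots> = (\<integral>\<^sup>+x. ennreal (b x) * indicator (nlog -` {a<..}) x \<partial>lborel)"
    proof (rule emeasure_density)
      show "nlog -` {a<..} \<in> sets (lborel :: 'a measure)"
        using measurable_sets[OF nlog_measurable, of "{a<..}"] by simp
    qed simp
    also have "\<dots> = (\<integral>\<^sup>+x. f (exp a *\<^sub>R x) \<partial>lborel)"
    proof (rule nn_integral_cong_AE)
      show "AE x in lborel. ennreal (b x) * indicator (nlog -` {a<..}) x = f (exp a *\<^sub>R x)"
        using AE_lborel_nonzero
      proof eventually_elim
        case (elim x)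
        have "norm x < exp (- a) \<longleftrightarrow> exp a * norm x < 1"
          by (simp add: exp_minus field_simps)
        then show ?case
          using less_nlog_iff[OF elim, of a] hom[of "exp a" x] by (simp add: f_def indicator_def)
      qed
    qed
    finally show ?thesis using 2 by simp
  qed
  have R: "emeasure (density lborel (\<lambda>s. ennreal (cone_const b * exp (- (N * s))))) {a<..} = ennreal (exp (- (N * a)) * C1)" for a
  proof -
    have "emeasure (density lborel (\<lambda>s. ennreal (cone_const b * exp (- (N * s))))) {a<..} =
       (\<integral>\<^sup>+s. ennreal (cone_const b * exp (- (N * s))) * indicator {a<..} s \<partial>lborel)"
      by (rule emeasure_density) auto
    also have "\<dots> = (\<integral>\<^sup>+s. ennreal (cone_const b * exp (- (N * s))) * indicator {a..} s \<partial>lborel)"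
    proof (rule nn_integral_cong_AE)
      show "AE s in lborel. ennreal (cone_const b * exp (- (N * s))) * indicator {a<..} s = ennreal (cone_const b * exp (- (N * s))) * indicator {a..} s"
        using AE_lborel_singleton[of a] by eventually_elim (auto simp: indicator_def)
    qed
    also have "\<dots> = 0 - (- (C1 * exp (- (N * a))))"
    proof (rule nn_integral_FTC_atLeast)
      show "DERIV (\<lambda>s. - (C1 * exp (- (N * s)))) x :> cone_const b * exp (- (N * x))" for x
        by (auto intro!: derivative_eq_intros simp: CC)
      show "0 \<le> cone_const b * exp (- (N * x))" for x
        using C1(1) N by (simp add: CC)
      have "((\<lambda>s. exp (- (N * s))) \<longlongrightarrow> 0) at_top"
      proof (rule filterlim_compose[OF exp_at_bot])
        show "LIM s at_top. - (N * s) :> at_bot"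
          unfolding filterlim_uminus_at_bot
          using filterlim_tendsto_pos_mult_at_top[OF tendsto_const N filterlim_ident] by simp
      qed
      then show "((\<lambda>s. - (C1 * exp (- (N * s)))) \<longlongrightarrow> 0) at_top"
        using tendsto_minus[OF tendsto_mult[OF tendsto_const[of C1]]] by force
    qed simp
    finally show ?thesis by (simp add: mult.commute)
  qed
  show ?thesis
    unfolding N_def[symmetric]
    by (rule measure_eqI_lessThan) (use L R in auto)
qed

lemma cone_const_pos:
  fixes b :: "'a::euclidean_space \<Rightarrow> real"
  assumes b[measurable]: "b \<in> borel_measurable borel" and nn: "\<And>x. 0 \<le> b x" and bd: "\<And>x. b x \<le> B"
    and U: "open U" "U \<noteq> {}" "U \<subseteq> ball 0 1" "\<And>x. x \<in> U \<Longrightarrow> 0 < b x"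
  shows "cone_const b > 0"
proof -
  define C0 where "C0 = (\<integral>\<^sup>+x. ennreal (b x) * indicator (ball 0 1) x \<partial>(lborel :: 'a measure))"
  have fin: "C0 < \<infinity>" unfolding C0_def by (rule nn_integral_ball_finite[OF bd])
  have "C0 \<noteq> 0"
  proof
    assume "C0 = 0"
    then have "AE x in lborel. ennreal (b x) * indicator (ball 0 1) x = 0"
      unfolding C0_def
      by (subst (asm) nn_integral_0_iff_AE) (auto intro!: borel_measurable_times_ennreal borel_measurable_indicator)
    from AE_open_ex[OF U(1,2) this] show False using U(3,4) by (fastforce simp: indicator_def)
  qed
  then have "enn2real C0 > 0" using fin by (simp add: enn2real_positive_iff zero_less_iff_neq_zero)
  then show ?thesis by (simp add: cone_const_def C0_def)
qed

section \<open>Null sets along rays, Borel versions and cumulative integrals\<close>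

lemma AE_nlog:
  assumes "AE s in lborel. P s"
  shows "AE x in (lborel :: 'a::euclidean_space measure). P (nlog x)"
proof -
  obtain E where E: "{s. \<not> P s} \<subseteq> E" "E \<in> sets lborel" "emeasure lborel E = 0"
    using assms by (auto elim!: AE_E)
  have "E \<in> null_sets lborel" using E by blast
  then have "AE s in density lborel (\<lambda>s. ennreal (cone_const (\<lambda>x::'a. 1) * exp (- (real DIM('a) * s)))). s \<notin> E"
    by (intro AE_density[THEN iffD2]) (auto dest: AE_not_in)
  then have "AE s in distr (density lborel (\<lambda>x::'a. ennreal 1)) borel nlog. s \<notin> E"
    by (subst distr_nlog_density[of "\<lambda>_. 1" 1]) auto
  then have "AE x in density lborel (\<lambda>x::'a. ennreal 1). nlog x \<notin> E"
    by (subst (asm) AE_distr_iff) (use E in auto)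
  then have "AE x in (lborel :: 'a measure). nlog x \<notin> E"
    by (simp only: density_1 ennreal_1)
  then show ?thesis by eventually_elim (use E in auto)
qed

text \<open>For each fixed \<open>s\<close> scaling preserves null sets; Fubini exchanges the two
  quantifiers, so almost every ray meets \<open>Z\<close> in a null set of parameters.\<close>

lemma AE_ray:
  fixes Z :: "'a::euclidean_space set"
  assumes Z: "Z \<in> null_sets lborel"
  shows "AE x in lborel. AE s in lborel. exp (- s) *\<^sub>R x \<notin> Z"
proof -
  have Zb[measurable]: "Z \<in> sets borel" using Z by auto
  have "AE s in (lborel::real measure). AE x in lborel. exp (- s) *\<^sub>R x \<notin> Z"
  proof (rule AE_I2)
    fix s :: real
    have "AE x in density (distr lborel borel (\<lambda>x. 0 + exp (- s) *\<^sub>R x)) (\<lambda>_. ennreal (\<bar>exp (- s)\<bar> ^ DIM('a))). x \<notin> Z"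
      using AE_not_in[OF Z] by (subst lborel_affine[symmetric]) auto
    then have "AE x in distr lborel borel (\<lambda>x::'a. 0 + exp (- s) *\<^sub>R x). x \<notin> Z"
      by (subst (asm) AE_density) auto
    then show "AE x in lborel. exp (- s) *\<^sub>R x \<notin> Z"
      by (subst (asm) AE_distr_iff) auto
  qed
  then show ?thesis
  proof (subst lborel_pair.AE_commute)
    have "(\<lambda>p::'a \<times> real. exp (- snd p) *\<^sub>R fst p) \<in> borel \<Otimes>\<^sub>M borel \<rightarrow>\<^sub>M borel"
      by measurable
    from measurable_sets[OF this, of "- Z"]
    show "{p \<in> space (lborel \<Otimes>\<^sub>M lborel). exp (- snd p) *\<^sub>R fst p \<notin> Z} \<in> sets (lborel \<Otimes>\<^sub>M lborel)"
      by (simp add: vimage_def space_pair_measure Collect_conj_eq Int_commute)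
  qed
qed

lemma lebesgue_ex_borel:
  fixes h :: "'a::euclidean_space \<Rightarrow> real"
  assumes "integrable lebesgue h"
  obtains h' where "h' \<in> borel_measurable borel" "integrable lborel h'" "AE x in lborel. h x = h' x"
proof -
  obtain h' where h': "h' \<in> borel_measurable lborel" "AE x in lborel. h x = h' x"
    using completion_ex_borel_measurable_real[of h lborel] assms by auto
  have "integrable lebesgue h'"
    using integrable_cong_AE_imp[OF assms, of h'] h' measurable_completion[OF h'(1)]
    by (auto simp: AE_completion_iff eq_commute)
  then have "integrable lborel h'" using integrable_completion[OF h'(1)] by simp
  then show ?thesis using that[of h'] h' by simp
qed

text \<open>\<open>h\<close> inherits measurability from \<open>h'\<close> by completeness of
  Lebesgue measure.\<close>

lemma integral_lebesgue_cong_AE: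
  fixes h h' :: "'a::euclidean_space \<Rightarrow> real"
  assumes "h' \<in> borel_measurable borel" "AE x in lborel. h x = h' x"
  shows "integral\<^sup>L lebesgue h = integral\<^sup>L lborel h'"
    and "integrable lebesgue h \<longleftrightarrow> integrable lborel h'"
proof -
  have m': "h' \<in> borel_measurable lebesgue" using assms(1) by (simp add: measurable_completion)
  have ae: "AE x in lebesgue. h' x = h x" using assms(2) by (simp add: AE_completion_iff eq_commute)
  have m: "h \<in> borel_measurable lebesgue"
    by (rule borel_measurable_AE[OF m' ae])
  show "integral\<^sup>L lebesgue h = integral\<^sup>L lborel h'"
    using integral_cong_AE[OF m m'] integral_completion[of h' lborel] assms by (simp add: AE_completion_iff)
  show "integrable lebesgue h \<longleftrightarrow> integrable lborel h'"
    using integrable_cong_AE[OF m m'] integrable_completion[of h' lborel] assms by (simp add: AE_completion_iff)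
qed

text \<open>Write \<open>c (\<tau> x)\<close> as minus the integral of \<open>c'\<close> over
  \<open>{\<tau> x<..}\<close> and exchange the integrals. Thus integrating \<open>h\<close> against
  functions of \<open>\<tau>\<close> acts as the weak derivative of the cumulative integral of
  \<open>h\<close>.\<close>

lemma integral_compose_eq_cdf:
  fixes h :: "'a::euclidean_space \<Rightarrow> real"
  assumes h[measurable]: "h \<in> borel_measurable borel" and hi: "integrable lborel h"
    and \<tau>[measurable]: "\<tau> \<in> borel_measurable borel"
    and c: "c \<in> tests J" "c' \<in> tests J" "\<And>s. (c has_real_derivative c' s) (at s)"
  shows "(LBINT x. h x * c (\<tau> x)) = - (LBINT s. (LBINT x. h x * indicator {..<s} (\<tau> x)) * c' s)"
proof -
  have c'm[measurable]: "c' \<in> borel_measurable borel"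
    by (rule borel_measurable_continuous_onI[OF tests_continuous[OF c(2)]])
  have c'i: "integrable lborel c'"
    using loc_integrable_tests[OF loc_integrable_continuous[OF continuous_on_const] c(2), of 1] by simp
  have cm: "c t = - (LBINT s. indicator {t<..} s * c' s)" for t
  proof -
    obtain l r where lr: "l < r" "{l..r} \<subseteq> J" "\<And>s. s \<notin> {l<..<r} \<Longrightarrow> c s = 0"
      using testsE[OF c(1)] by blast
    obtain l' r' where lr': "l' < r'" "{l'..r'} \<subseteq> J" "\<And>s. s \<notin> {l'<..<r'} \<Longrightarrow> c' s = 0"
      using testsE[OF c(2)] by blast
    \<comment> \<open>Beyond both supports and to the right of \<open>t\<close>: the tail integral
      over \<open>{t<..}\<close> stops at \<open>R\<close>, and \<open>c R = 0\<close>.\<close>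
    define R where "R = max (max r r') (t + 1)"
    have "(LBINT s. c' s * indicator {t..R} s) = c R - c t"
    proof (rule integral_FTC_Icc_real)
      show "isCont c' x" for x using tests_continuous[OF c(2)] by (simp add: continuous_on_eq_continuous_at)
    qed (use c(3) in \<open>auto simp: R_def\<close>)
    moreover have "c R = 0" by (rule lr(3)) (auto simp: R_def)
    moreover have "(LBINT s. c' s * indicator {t..R} s) = (LBINT s. indicator {t<..} s * c' s)"
    proof (rule integral_cong_AE)
      show "AE s in lborel. c' s * indicator {t..R} s = indicator {t<..} s * c' s"
        using AE_lborel_singleton[of t]
      proof eventually_elim
        case (elim s)
        show ?case
        proof (cases "s \<le> R")
          case False
          then have "c' s = 0" by (intro lr'(3)) (auto simp: R_def)
          then show ?thesis by simp
        qed (use elim in \<open>auto simp: indicator_def\<close>)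
      qed
    qed auto
    ultimately show ?thesis by simp
  qed
  have prodi: "integrable (lborel \<Otimes>\<^sub>M lborel) (\<lambda>(x, s). h x * (indicator {\<tau> x<..} s * c' s))"
  proof (rule Bochner_Integration.integrable_bound)
    show "integrable (lborel \<Otimes>\<^sub>M lborel) (\<lambda>(x, s). h x * c' s)"
      by (rule lborel_pair.Fubini_integrable) (use hi c'i in \<open>auto simp: abs_mult\<close>)
    have [measurable]: "(\<lambda>(x, s). indicator {\<tau> x<..} s :: real) \<in> borel_measurable (lborel \<Otimes>\<^sub>M lborel)"
    proof -
      have "(\<lambda>(x, s). indicator {\<tau> x<..} s :: real) = (\<lambda>p. indicator {p \<in> space (lborel \<Otimes>\<^sub>M lborel). \<tau> (fst p) < snd p} p)"
        by (auto simp: indicator_def space_pair_measure fun_eq_iff)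
      also have "\<dots> \<in> borel_measurable (lborel \<Otimes>\<^sub>M lborel)" by measurable
      finally show ?thesis .
    qed
    show "(\<lambda>(x, s). h x * (indicator {\<tau> x<..} s * c' s)) \<in> borel_measurable (lborel \<Otimes>\<^sub>M lborel)"
      unfolding case_prod_beta by (intro borel_measurable_times) (auto simp: case_prod_beta[symmetric])
    show "AE p in lborel \<Otimes>\<^sub>M lborel. norm (case p of (x, s) \<Rightarrow> h x * (indicator {\<tau> x<..} s * c' s)) \<le> norm (case p of (x, s) \<Rightarrow> h x * c' s)"
      by (rule AE_I2) (auto simp: indicator_def)
  qed
  have "(LBINT x. h x * c (\<tau> x)) = - (LBINT x. (LBINT s. h x * (indicator {\<tau> x<..} s * c' s)))"
    by (subst cm) simp
  also have "(LBINT x. (LBINT s. h x * (indicator {\<tau> x<..} s * c' s))) =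
      (LBINT s. (LBINT x. h x * (indicator {\<tau> x<..} s * c' s)))"
    by (rule lborel_pair.Fubini_integral[OF prodi, symmetric])
  also have "\<dots> = (LBINT s. (LBINT x. h x * indicator {..<s} (\<tau> x)) * c' s)"
  proof (rule Bochner_Integration.integral_cong)
    fix s
    have "(\<lambda>x. h x * (indicator {\<tau> x<..} s * c' s)) = (\<lambda>x. (h x * indicator {..<s} (\<tau> x)) * c' s)"
      by (auto simp: indicator_def)
    then show "(LBINT x. h x * (indicator {\<tau> x<..} s * c' s)) = (LBINT x. h x * indicator {..<s} (\<tau> x)) * c' s"
      by simp
  qed simp
  finally show ?thesis .
qed

text \<open>A jump could come only from a level set of \<open>\<tau>\<close> of positive
  measure.\<close>

lemma continuous_cdf:
  fixes h \<tau> :: "'a::euclidean_space \<Rightarrow> real"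
  assumes hi: "integrable lborel h" and \<tau>[measurable]: "\<tau> \<in> borel_measurable borel"
    and null: "\<And>s. AE x in lborel. \<tau> x \<noteq> s"
  shows "continuous_on UNIV (\<lambda>s. LBINT x. h x * indicator {..<s} (\<tau> x))"
proof (rule continuous_on_sequentiallyI)
  fix \<sigma> :: "nat \<Rightarrow> real" and s assume \<sigma>: "\<sigma> \<longlonglongrightarrow> s"
  have hm[measurable]: "h \<in> borel_measurable lborel" using hi by auto
  have im: "(\<lambda>x. h x * indicator {..<t} (\<tau> x)) \<in> borel_measurable lborel" for t
    by measurable
  show "(\<lambda>n. LBINT x. h x * indicator {..<\<sigma> n} (\<tau> x)) \<longlonglongrightarrow> (LBINT x. h x * indicator {..<s} (\<tau> x))"
  proof (rule integral_dominated_convergence[where w="\<lambda>x. norm (h x)"])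
    show "integrable lborel (\<lambda>x. norm (h x))" using hi by (rule integrable_norm)
    show "AE x in lborel. (\<lambda>n. h x * indicator {..<\<sigma> n} (\<tau> x)) \<longlonglongrightarrow> h x * indicator {..<s} (\<tau> x)"
      using null[of s]
    proof eventually_elim
      case (elim x)
      have "\<forall>\<^sub>F n in sequentially. indicator {..<s} (\<tau> x) = (indicator {..<\<sigma> n} (\<tau> x) :: real)"
      proof (cases "\<tau> x < s")
        case True
        then have "\<forall>\<^sub>F n in sequentially. \<tau> x < \<sigma> n" using \<sigma> order_tendstoD(1) by blast
        then show ?thesis by eventually_elim (use True in \<open>simp add: indicator_def\<close>)
      next
        case False
        then have "s < \<tau> x" using elim by simp
        then have "\<forall>\<^sub>F n in sequentially. \<sigma> n < \<tau> x" using \<sigma> order_tendstoD(2) by blast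
        then show ?thesis by eventually_elim (use False in \<open>simp add: indicator_def\<close>)
      qed
      then have "(\<lambda>n. indicator {..<\<sigma> n} (\<tau> x)) \<longlonglongrightarrow> (indicator {..<s} (\<tau> x) :: real)"
        by (rule Lim_transform_eventually[OF tendsto_const])
      then show ?case by (intro tendsto_intros)
    qed
    show "AE x in lborel. norm (h x * indicator {..<\<sigma> n} (\<tau> x)) \<le> norm (h x)" for n
      by (rule AE_I2) (auto simp: indicator_def)
  qed (use im in auto)
qed

lemma AE_nlog_neq: "AE x in (lborel :: 'a::euclidean_space measure). nlog x \<noteq> s"
  using AE_nlog[OF AE_lborel_singleton[of s]] by simp

text \<open>Local continuous versions agree on overlaps because they agree almost everywhere there;
  a countable subcover keeps the union of the exceptional sets null.\<close>

lemma AE_eq_continuous_glue: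
  fixes f :: "'a::euclidean_space \<Rightarrow> real"
  assumes S: "open S"
    and loc: "\<And>x. x \<in> S \<Longrightarrow> \<exists>B \<phi>. open B \<and> x \<in> B \<and> continuous_on B \<phi> \<and> (AE y in lborel. y \<in> B \<inter> S \<longrightarrow> f y = \<phi> y)"
  shows "\<exists>v. continuous_on S v \<and> (AE y in lborel. y \<in> S \<longrightarrow> f y = v y)"
proof -
  define Q where "Q x B \<phi> \<longleftrightarrow> open B \<and> x \<in> B \<and> continuous_on B \<phi> \<and>
    (AE y in lborel. y \<in> B \<inter> S \<longrightarrow> f y = \<phi> y)" for x B \<phi>
  have "\<forall>x\<in>S. \<exists>p. Q x (fst p) (snd p)"
  proof
    fix x assume "x \<in> S"
    from loc[OF this] obtain B \<phi> where "Q x B \<phi>" unfolding Q_def by blast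
    then show "\<exists>p. Q x (fst p) (snd p)" by (intro exI[of _ "(B, \<phi>)"]) simp
  qed
  then obtain p where "\<And>x. x \<in> S \<Longrightarrow> Q x (fst (p x)) (snd (p x))"
    by metis
  then have p: "\<And>x. x \<in> S \<Longrightarrow> open (fst (p x))" "\<And>x. x \<in> S \<Longrightarrow> x \<in> fst (p x)"
    "\<And>x. x \<in> S \<Longrightarrow> continuous_on (fst (p x)) (snd (p x))"
    "\<And>x. x \<in> S \<Longrightarrow> AE y in lborel. y \<in> fst (p x) \<inter> S \<longrightarrow> f y = snd (p x) y"
    by (simp_all only: Q_def)
  define v where "v x = snd (p x) x" for x
  have v: "v y = snd (p x) y" if "x \<in> S" "y \<in> S" "y \<in> fst (p x)" for x y
  proof -
    let ?T = "fst (p x) \<inter> fst (p y) \<inter> S"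
    have "AE z in lborel. z \<in> ?T \<longrightarrow> snd (p y) z = snd (p x) z"
      using p(4)[OF that(1)] p(4)[OF that(2)] by eventually_elim auto
    moreover have "open ?T" using p(1)[OF that(1)] p(1)[OF that(2)] S by (intro open_Int)
    moreover have "continuous_on ?T (snd (p x))" "continuous_on ?T (snd (p y))"
      using p(3)[OF that(1)] p(3)[OF that(2)] by (blast intro: continuous_on_subset)+
    moreover have "y \<in> ?T" using p(2)[OF that(2)] that by blast
    ultimately show ?thesis
      unfolding v_def using AE_eq_imp_eq_continuous by blast
  qed
  have "continuous_on S v"
  proof (rule continuous_at_imp_continuous_on, rule ballI)
    fix x assume x: "x \<in> S"
    have "continuous_on (fst (p x) \<inter> S) v"
    proof (subst continuous_on_cong[OF refl])
      show "v y = snd (p x) y" if "y \<in> fst (p x) \<inter> S" for y using v[OF x] that by blast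
      show "continuous_on (fst (p x) \<inter> S) (snd (p x))"
        using p(3)[OF x] by (blast intro: continuous_on_subset)
    qed
    then show "isCont v x"
      using p(1,2)[OF x] x S continuous_on_eq_continuous_at[of "fst (p x) \<inter> S" v] by blast
  qed
  moreover have "AE y in lborel. y \<in> S \<longrightarrow> f y = v y"
  proof -
    obtain \<F> where \<F>: "\<F> \<subseteq> (\<lambda>x. fst (p x)) ` S" "countable \<F>" "\<Union>\<F> = \<Union>((\<lambda>x. fst (p x)) ` S)"
      using Lindelof[of "(\<lambda>x. fst (p x)) ` S"] p(1) by (metis (no_types, lifting) imageE)
    then obtain T where T: "T \<subseteq> S" "countable T" "\<F> = (\<lambda>x. fst (p x)) ` T"
      by (metis countable_subset_image)
    have "AE y in lborel. \<forall>x\<in>T. y \<in> fst (p x) \<inter> S \<longrightarrow> f y = snd (p x) y"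
      using T p(4) by (intro AE_ball_countable[THEN iffD2]) auto
    then show ?thesis
    proof eventually_elim
      case (elim y)
      show ?case
      proof
        assume y: "y \<in> S"
        then have "y \<in> \<Union>\<F>" using \<F>(3) p(2) by blast
        then obtain x where "x \<in> T" "y \<in> fst (p x)" using T(3) by blast
        then show "f y = v y" using elim v[of x y] y T(1) by (metis IntI subsetD)
      qed
    qed
  qed
  ultimately show ?thesis by blast
qed

section \<open>Asymptotics of positive solutions of the Emden--Fowler equation\<close>

lemma first_nonpos_point:
  fixes g :: "real \<Rightarrow> real"
  assumes "continuous_on {a..b} g" "g a > 0" "g b \<le> 0" "a \<le> b"
  obtains t where "a < t" "t \<le> b" "g t \<le> 0" "\<And>s. a \<le> s \<Longrightarrow> s < t \<Longrightarrow> g s > 0"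
proof -
  let ?A = "{s \<in> {a..b}. g s \<in> {..0}}"
  have "closed ?A" using continuous_closed_preimage[OF assms(1), of "{..0}"] by (simp add: vimage_def Int_def)
  moreover have "bounded ?A" by (rule bounded_subset[of "{a..b}"]) auto
  ultimately have "compact ?A" by (simp only: compact_eq_bounded_closed)
  moreover have "?A \<noteq> {}" using assms by force
  ultimately obtain t where t: "t \<in> ?A" "\<And>s. s \<in> ?A \<Longrightarrow> t \<le> s"
    using compact_attains_inf by meson
  have "g s > 0" if "a \<le> s" "s < t" for s
    using t(2)[of s] t(1) that by force
  moreover have "a \<noteq> t" using t(1) assms(2) by auto
  ultimately show ?thesis using that[of t] t(1) by auto
qed

text \<open>The common source of the contradictions below: it is applied to \<open>y\<close>, to
  \<open>\<alpha> * y - y1\<close>, to \<open>v\<close> and to a negative power of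
  \<open>y\<close>.\<close>

lemma not_linear_decreasing_if_pos:
  fixes y :: "real \<Rightarrow> real"
  assumes "k > 0" and d: "\<And>s. t \<le> s \<Longrightarrow> (y has_real_derivative y' s) (at s)" "\<And>s. t \<le> s \<Longrightarrow> y' s \<le> - k"
    and pos: "\<And>s. t \<le> s \<Longrightarrow> 0 \<le> y s"
  shows False
proof -
  \<comment> \<open>With slope at most \<open>- k\<close> from \<open>t\<close> on, the value at
    this point is at most \<open>-1\<close>.\<close>
  define r where "r = t + (y t + 1) / k"
  have tr: "t \<le> r" using assms(1) pos[of t] by (simp add: r_def)
  have "y r + k * r \<le> y t + k * t"
  proof (rule DERIV_nonpos_imp_nonincreasing[OF tr, of "\<lambda>s. y s + k * s"])
    fix x assume "t \<le> x" "x \<le> r"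
    then show "\<exists>z. ((\<lambda>s. y s + k * s) has_real_derivative z) (at x) \<and> z \<le> 0"
      using d(2)[of x] by (intro exI[of _ "y' x + k"]) (auto intro!: derivative_eq_intros d(1))
  qed
  moreover have "k * r = k * t + y t + 1" using assms(1) by (simp add: r_def field_simps)
  ultimately show False using pos[OF tr] by simp
qed

text \<open>Gronwall: \<open>e^(-\<alpha> s) \<omega>\<close> is nonincreasing. Since
  \<open>\<omega> t \<le> 0\<close>, replacing the weight at \<open>t\<close> by the smaller weight
  at \<open>r\<close> only raises the upper bound, and then the weights cancel. In particular a
  negative value persists.\<close>

lemma exp_weight_nonincreasing:
  fixes \<omega> :: "real \<Rightarrow> real"
  assumes "0 < \<alpha>" and d: "\<And>x. t \<le> x \<Longrightarrow> x \<le> r \<Longrightarrow> \<exists>d. (\<omega> has_real_derivative d) (at x) \<and> d \<le> \<alpha> * \<omega> x"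
    and "\<omega> t \<le> 0" "t \<le> r"
  shows "\<omega> r \<le> \<omega> t"
proof -
  have "exp (- (\<alpha> * r)) * \<omega> r \<le> exp (- (\<alpha> * t)) * \<omega> t"
  proof (rule DERIV_nonpos_imp_nonincreasing[OF assms(4)])
    fix x assume "t \<le> x" "x \<le> r"
    then obtain d where d: "(\<omega> has_real_derivative d) (at x)" "d \<le> \<alpha> * \<omega> x" using d by blast
    have "((\<lambda>s. exp (- (\<alpha> * s)) * \<omega> s) has_real_derivative exp (- (\<alpha> * x)) * (d - \<alpha> * \<omega> x)) (at x)"
      by (auto intro!: derivative_eq_intros d(1) simp: algebra_simps)
    then show "\<exists>z. ((\<lambda>s. exp (- (\<alpha> * s)) * \<omega> s) has_real_derivative z) (at x) \<and> z \<le> 0"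
      using d(2) by (intro exI[of _ "exp (- (\<alpha> * x)) * (d - \<alpha> * \<omega> x)"]) (auto intro: mult_nonneg_nonpos)
  qed
  also have "\<dots> \<le> exp (- (\<alpha> * r)) * \<omega> t"
    by (rule mult_right_mono_neg) (use assms in auto)
  finally show ?thesis by simp
qed

text \<open>Positivity is left to the extension \<open>emden_pos\<close>. The profile of a weak
  solution is at first known only to be nonnegative and positive on a dense set; strict positivity
  has to be derived from the equation.\<close>

locale emden =
  fixes \<alpha> \<nu> p q \<delta> S0 :: real and y y1 :: "real \<Rightarrow> real"
  assumes \<alpha>: "\<alpha> > 0" and \<nu>: "\<nu> > 0" and q: "q = 1 + 2 / \<nu>" and pq: "p < q" and p: "p > 0"
    and \<delta>: "\<delta> = (q - p) * \<nu>"
    and dy: "\<And>s. S0 < s \<Longrightarrow> (y has_real_derivative y1 s) (at s)"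
    and dy1: "\<And>s. S0 < s \<Longrightarrow>
      (y1 has_real_derivative \<alpha> * y1 s + (y s powr q - exp (- (\<delta> * s)) * y s powr p)) (at s)"
begin

text \<open>In the original variables \<open>y = \<theta>\<close> is the level \<open>u = 1\<close>,
  where \<open>u^p = u^q\<close>; there \<open>f\<close> changes sign.\<close>

abbreviation \<theta> where "\<theta> t \<equiv> exp (- (\<nu> * t))"

definition f where "f s = y s powr q - exp (- (\<delta> * s)) * y s powr p"

lemma q1: "q > 1" using q \<nu> by simp
lemma \<delta>pos: "\<delta> > 0" using \<delta> pq \<nu> by simp

lemma dy1': "S0 < s \<Longrightarrow> (y1 has_real_derivative \<alpha> * y1 s + f s) (at s)"
  using dy1 by (simp add: f_def)

lemma f_nonpos: "0 \<le> y s \<Longrightarrow> y s \<le> \<theta> s \<Longrightarrow> f s \<le> 0"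
proof -
  assume y: "0 \<le> y s" "y s \<le> \<theta> s"
  have "y s powr (q - p) \<le> \<theta> s powr (q - p)"
    by (rule powr_mono2) (use y pq in auto)
  also have "\<dots> = exp (- (\<delta> * s))" by (simp add: exp_powr_real \<delta> mult_ac)
  finally have "y s powr (q - p) * y s powr p \<le> exp (- (\<delta> * s)) * y s powr p"
    by (rule mult_right_mono) simp
  then show "f s \<le> 0" by (simp add: f_def powr_add[symmetric])
qed

lemma f_nonneg: "\<theta> s \<le> y s \<Longrightarrow> 0 \<le> f s"
proof -
  assume y: "\<theta> s \<le> y s"
  have "exp (- (\<delta> * s)) = \<theta> s powr (q - p)" by (simp add: exp_powr_real \<delta> mult_ac)
  also have "\<dots> \<le> y s powr (q - p)" by (rule powr_mono2) (use y pq in auto)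
  finally have "exp (- (\<delta> * s)) * y s powr p \<le> y s powr (q - p) * y s powr p"
    by (rule mult_right_mono) simp
  then show "0 \<le> f s" by (simp add: f_def powr_add[symmetric])
qed

lemma dG: "S0 < s \<Longrightarrow> ((\<lambda>s. exp (- (\<alpha> * s)) * y1 s) has_real_derivative exp (- (\<alpha> * s)) * f s) (at s)"
  by (auto intro!: derivative_eq_intros dy1' simp: algebra_simps)

lemma G_nonincreasing:
  assumes "S0 < a" "a \<le> b" "\<And>s. a \<le> s \<Longrightarrow> s \<le> b \<Longrightarrow> f s \<le> 0" "y1 a \<le> 0"
  shows "y1 b \<le> y1 a"
proof (rule exp_weight_nonincreasing[where \<omega>=y1, OF \<alpha> _ assms(4,2)])
  fix x assume "a \<le> x" "x \<le> b"
  then show "\<exists>d. (y1 has_real_derivative d) (at x) \<and> d \<le> \<alpha> * y1 x"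
    using dy1'[of x] assms(1,3) by force
qed

text \<open>A zero is a minimum, so \<open>y'\<close> vanishes there; below \<open>\<theta>\<close>
  the sign of \<open>f\<close> then keeps \<open>y' \<le> 0\<close> to the right, and
  \<open>y\<close> cannot leave \<open>0\<close>. This one-sided argument stands in for uniqueness
  of solutions, as \<open>y powr p\<close> with just \<open>p > 0\<close> need not be Lipschitz at
  \<open>0\<close>.\<close>

lemma zero_imp_zero_right:
  assumes nn: "\<And>s. S0 < s \<Longrightarrow> 0 \<le> y s" and s: "S0 < s" "y s = 0"
  shows "\<exists>e>0. \<forall>t\<in>{s..s + e}. y t = 0"
proof -
  have "y1 s = 0"
    by (rule DERIV_local_min[OF dy[OF s(1)], of "s - S0"]) (use s nn in \<open>auto simp: abs_if split: if_splits\<close>)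
  have "isCont (\<lambda>t. \<theta> t - y t) s"
    by (intro continuous_intros DERIV_isCont[OF dy[OF s(1)]])
  moreover have "\<theta> s - y s > 0" using s by simp
  ultimately have "\<forall>\<^sub>F t in at s. \<theta> t - y t > 0"
    unfolding isCont_def by (rule order_tendstoD)
  then obtain e where e: "e > 0" "\<And>t. t \<noteq> s \<Longrightarrow> dist t s < e \<Longrightarrow> \<theta> t - y t > 0"
    by (auto simp: eventually_at)
  have fn: "f t \<le> 0" if "t \<in> {s..s + e/2}" for t
  proof (cases "t = s")
    case False
    then show ?thesis using e(2)[of t] that e(1) s nn[of t] by (intro f_nonpos) (auto simp: dist_real_def)
  qed (use s f_nonpos[of s] in auto)
  have y1n: "y1 t \<le> 0" if "t \<in> {s..s + e/2}" for t
    using G_nonincreasing[of s t] fn that s \<open>y1 s = 0\<close> by auto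
  have "y t = 0" if t: "t \<in> {s..s + e/2}" for t
  proof -
    have st: "s \<le> t" using t by simp
    have "y t \<le> y s"
    proof (rule DERIV_nonpos_imp_nonincreasing[OF st])
      fix x assume "s \<le> x" "x \<le> t"
      then show "\<exists>z. (y has_real_derivative z) (at x) \<and> z \<le> 0" using dy[of x] y1n[of x] t s by auto
    qed
    then show ?thesis using nn[of t] s t by auto
  qed
  then show ?thesis using e(1) by (intro exI[of _ "e/2"]) auto
qed

end

section \<open>Positive solutions: monotonicity, position relative to \<open>\<theta>\<close>, decay
  rate\<close>

locale emden_pos = emden +
  assumes pos: "\<And>s. S0 < s \<Longrightarrow> 0 < y s"
begin

text \<open>An upward slope above \<open>\<theta>\<close> is never lost, since
  \<open>f \<ge> 0\<close> keeps \<open>e^(-\<alpha> s) y'\<close> nondecreasing. Once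
  \<open>y\<close> is large, \<open>y^q\<close> with \<open>q > 1\<close> dominates and forces
  blow-up in finite time, against existence on the whole half-line.\<close>

lemma no_increase_above:
  assumes s1: "S0 < s1" "\<theta> s1 \<le> y s1" "0 < y1 s1"
  shows False
proof -
  have cy1: "continuous_on {s1..b} y1" for b
    using s1(1) DERIV_isCont[OF dy1] by (intro continuous_at_imp_continuous_on) auto
  have up: "y s1 \<le> y t" if "s1 \<le> t" "\<And>s. s1 \<le> s \<Longrightarrow> s < t \<Longrightarrow> 0 < y1 s" for t
  proof (rule DERIV_nonneg_imp_increasing_open[OF that(1)])
    show "\<exists>z. (y has_real_derivative z) (at x) \<and> 0 \<le> z" if "s1 < x" "x < t" for x
      using dy[of x] that s1(1) \<open>\<And>s. s1 \<le> s \<Longrightarrow> s < t \<Longrightarrow> 0 < y1 s\<close>[of x] by (intro exI[of _ "y1 x"]) auto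
    show "continuous_on {s1..t} y"
      using s1(1) DERIV_isCont[OF dy] by (intro continuous_at_imp_continuous_on) auto
  qed
  have Gup: "y1 s1 \<le> y1 t" if t: "s1 \<le> t" "\<And>s. s1 \<le> s \<Longrightarrow> s < t \<Longrightarrow> 0 < y1 s" for t
  proof -
    have "exp (- (\<alpha> * s1)) * y1 s1 \<le> exp (- (\<alpha> * t)) * y1 t"
    proof (rule DERIV_nonneg_imp_increasing_open[OF t(1)])
      fix x assume x: "s1 < x" "x < t"
      have "\<theta> x \<le> \<theta> s1" using x \<nu> by simp
      also have "\<dots> \<le> y x" using s1(2) up[of x] x t(2) by force
      finally show "\<exists>z. ((\<lambda>s. exp (- (\<alpha> * s)) * y1 s) has_real_derivative z) (at x) \<and> 0 \<le> z"
        using dG[of x] x s1(1) f_nonneg[of x] by (intro exI[of _ "exp (- (\<alpha> * x)) * f x"]) auto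
    next
      show "continuous_on {s1..t} (\<lambda>s. exp (- (\<alpha> * s)) * y1 s)"
        by (intro continuous_intros cy1)
    qed
    note G = this
    have "0 < exp (- (\<alpha> * s1)) * y1 s1" using s1(3) by simp
    also note G
    finally have "0 < y1 t" by (simp add: zero_less_mult_iff)
    then have "exp (- (\<alpha> * t)) * y1 t \<le> exp (- (\<alpha> * s1)) * y1 t"
      using \<alpha> t(1) by simp
    with G have "exp (- (\<alpha> * s1)) * y1 s1 \<le> exp (- (\<alpha> * s1)) * y1 t" by (rule order_trans)
    then show ?thesis by simp
  qed
  \<comment> \<open>At a first nonpositive value of \<open>y1\<close>, \<open>Gup\<close> would
    still give \<open>y1 s1 > 0\<close> as a lower bound.\<close>
  have y1pos: "0 < y1 t" if st: "s1 \<le> t" for t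
  proof (rule ccontr)
    assume "\<not> 0 < y1 t"
    then have t: "y1 t \<le> 0" by simp
    obtain r where r: "s1 < r" "y1 r \<le> 0" "\<And>s. s1 \<le> s \<Longrightarrow> s < r \<Longrightarrow> 0 < y1 s"
      by (rule first_nonpos_point[OF cy1 s1(3) t st]) blast
    then show False using Gup[of r] s1(3) by simp
  qed
  have y1ge: "y1 s1 \<le> y1 t" if "s1 \<le> t" for t using Gup[of t] y1pos that by auto
  have ylin: "y s1 + y1 s1 * (t - s1) \<le> y t" if t: "s1 \<le> t" for t
  proof -
    have "y s1 - y1 s1 * s1 \<le> y t - y1 s1 * t"
    proof (rule DERIV_nonneg_imp_nondecreasing[OF t])
      fix x assume "s1 \<le> x" "x \<le> t"
      then show "\<exists>z. ((\<lambda>s. y s - y1 s1 * s) has_real_derivative z) (at x) \<and> 0 \<le> z"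
        using y1ge[of x] s1(1) by (intro exI[of _ "y1 x - y1 s1"]) (auto intro!: derivative_eq_intros dy)
    qed
    then show ?thesis by (simp add: algebra_simps)
  qed
  \<comment> \<open>Past \<open>s2\<close> linear growth has lifted \<open>y\<close> above
    \<open>1\<close>, and \<open>e^(-\<delta> s) \<le> 1/2\<close>; together these let half of
    \<open>y^q\<close> absorb the term with \<open>y^p\<close>.\<close>
  define s2 where "s2 = max s1 (max (s1 + 1 / y1 s1) (ln 2 / \<delta>))"
  have s2: "s1 \<le> s2" "s1 + 1 / y1 s1 \<le> s2" "ln 2 / \<delta> \<le> s2" by (auto simp: s2_def)
  have ge1: "1 \<le> y t" if "s2 \<le> t" for t
  proof -
    have "1 = y1 s1 * (1 / y1 s1)" using s1(3) by simp
    also have "\<dots> \<le> y1 s1 * (t - s1)" by (rule mult_left_mono) (use s2 that s1(3) in auto)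
    also have "\<dots> \<le> y t" using ylin[of t] s2(1) that pos[OF s1(1)] by simp
    finally show ?thesis .
  qed
  have fbig: "y t powr q / 2 \<le> f t" if t: "s2 \<le> t" for t
  proof -
    have "ln 2 / \<delta> \<le> t" using s2 t by simp
    then have "ln 2 \<le> \<delta> * t" using \<delta>pos by (simp add: field_simps)
    then have "exp (- (\<delta> * t)) \<le> exp (- ln 2)" by simp
    then have "exp (- (\<delta> * t)) \<le> 1/2" by (simp add: exp_minus inverse_eq_divide)
    then have "exp (- (\<delta> * t)) * y t powr p \<le> (1/2) * y t powr q"
      by (rule mult_mono) (use ge1[OF t] pq in \<open>auto intro: powr_mono\<close>)
    then show ?thesis by (simp add: f_def)
  qed
  have s2S: "S0 < t" if "s2 \<le> t" for t using s2(1) s1(1) that by simp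
  \<comment> \<open>The first bound makes the energy \<open>y1^2 - c y^(q + 1)\<close>
    nondecreasing, because \<open>2 f \<ge> y^q\<close>; the second makes it nonnegative at
    \<open>s2\<close>.\<close>
  define c where "c = min (1 / (q + 1)) ((y1 s2)\<^sup>2 / y s2 powr (q + 1))"
  have y1s2: "0 < y1 s2" and ys2: "0 < y s2" using y1pos s2(1) pos[OF s2S] by auto
  have c: "c > 0" using y1s2 ys2 q1 by (simp add: c_def)
  have "c \<le> 1 / (q + 1)" by (simp add: c_def)
  then have c1: "c * (q + 1) \<le> 1" using q1 by (simp add: le_divide_eq)
  have c2: "c * y s2 powr (q + 1) \<le> (y1 s2)\<^sup>2"
  proof -
    have "c \<le> (y1 s2)\<^sup>2 / y s2 powr (q + 1)" by (simp add: c_def)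
    then show ?thesis using ys2 by (simp add: field_simps)
  qed
  have en: "c * y t powr (q + 1) \<le> (y1 t)\<^sup>2" if t: "s2 \<le> t" for t
  proof -
    have "(y1 s2)\<^sup>2 - c * y s2 powr (q + 1) \<le> (y1 t)\<^sup>2 - c * y t powr (q + 1)"
    proof (rule DERIV_nonneg_imp_nondecreasing[OF t])
      fix x assume x: "s2 \<le> x" "x \<le> t"
      have yx: "0 < y x" "0 < y1 x" using pos[OF s2S[OF x(1)]] y1pos s2(1) x(1) by auto
      have "c * (q + 1) * y x powr q \<le> 1 * y x powr q"
        by (rule mult_right_mono[OF c1]) simp
      also have "\<dots> \<le> 2 * f x" using fbig[OF x(1)] by simp
      also have "\<dots> \<le> 2 * (\<alpha> * y1 x + f x)" using \<alpha> yx by simp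
      finally have "c * (q + 1) * y x powr q * y1 x \<le> 2 * (\<alpha> * y1 x + f x) * y1 x"
        by (rule mult_right_mono) (use yx in simp)
      then show "\<exists>z. ((\<lambda>t. (y1 t)\<^sup>2 - c * y t powr (q + 1)) has_real_derivative z) (at x) \<and> 0 \<le> z"
        using yx by (intro exI[of _ "2 * (\<alpha> * y1 x + f x) * y1 x - c * (q + 1) * y x powr q * y1 x"])
          (auto intro!: derivative_eq_intros dy[OF s2S[OF x(1)]] dy1'[OF s2S[OF x(1)]] simp: mult_ac powr_diff)
    qed
    then show ?thesis using c2 by simp
  qed
  \<comment> \<open>The energy bound reads \<open>y1 \<ge> sqrt c * y^((q + 1)/2)\<close> with
    \<open>(q + 1)/2 = 1 + 1/\<nu>\<close>. Hence \<open>y^(-1/\<nu>)\<close> falls at a fixed rate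
    although it is nonnegative, which is the blow-up.\<close>
  show False
  proof (rule not_linear_decreasing_if_pos[of "sqrt c / \<nu>" s2 "\<lambda>s. y s powr (- (1/\<nu>))"])
    show "sqrt c / \<nu> > 0" using c \<nu> by simp
    fix s assume s: "s2 \<le> s"
    have ys: "0 < y s" "0 < y1 s" using pos[OF s2S[OF s]] y1pos s2(1) s by auto
    show "((\<lambda>s. y s powr (- (1/\<nu>))) has_real_derivative - (1/\<nu>) * y s powr (- (1/\<nu>) - 1) * y1 s) (at s)"
      using ys by (auto intro!: derivative_eq_intros dy[OF s2S[OF s]])
    have "(sqrt c * y s powr ((q + 1)/2))\<^sup>2 \<le> (y1 s)\<^sup>2"
    proof -
      have "(y s powr ((q + 1)/2))\<^sup>2 = y s powr ((q + 1)/2 + (q + 1)/2)"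
        by (simp only: power2_eq_square powr_add)
      also have "(q + 1)/2 + (q + 1)/2 = q + 1" by simp
      finally show ?thesis using en[OF s] c by (simp only: power_mult_distrib) simp
    qed
    then have "sqrt c * y s powr ((q + 1)/2) \<le> y1 s"
      by (rule power2_le_imp_le) (use ys(2) in simp)
    then have "y s powr (- (1/\<nu>) - 1) * (sqrt c * y s powr ((q + 1)/2)) \<le> y s powr (- (1/\<nu>) - 1) * y1 s"
      by (rule mult_left_mono) simp
    moreover have "y s powr (- (1/\<nu>) - 1) * (sqrt c * y s powr ((q + 1)/2)) = sqrt c"
    proof -
      have "- (1/\<nu>) - 1 + (q + 1)/2 = 0" using q \<nu> by (simp add: field_simps)
      then show ?thesis using ys(1) by (simp add: mult.left_commute[of _ "sqrt c"] powr_add[symmetric])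
    qed
    ultimately have "sqrt c \<le> y s powr (- (1/\<nu>) - 1) * y1 s" by simp
    then show "- (1/\<nu>) * y s powr (- (1/\<nu>) - 1) * y1 s \<le> - (sqrt c / \<nu>)"
      using \<nu> by (simp add: divide_right_mono)
  qed simp
qed

lemma nonincreasing_above: "S0 < s \<Longrightarrow> \<theta> s \<le> y s \<Longrightarrow> y1 s \<le> 0"
  using no_increase_above[of s] by force

text \<open>Below \<open>\<theta>\<close> a negative slope would persist and drive \<open>y\<close>
  below \<open>0\<close>; so a solution staying there would be nondecreasing, while its upper bound
  \<open>\<theta>\<close> tends to \<open>0\<close>.\<close>

lemma above_frequently:
  assumes s: "S0 < s"
  shows "\<exists>t\<ge>s. \<theta> t \<le> y t"
proof (rule ccontr)
  assume "\<not> ?thesis"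
  then have below: "y t < \<theta> t" if "s \<le> t" for t using that by force
  have fn: "f t \<le> 0" if "s \<le> t" for t
    using f_nonpos[of t] below[OF that] pos[of t] s that by simp
  have y1n: "0 \<le> y1 t" if t: "s \<le> t" for t
  proof (rule ccontr)
    assume "\<not> 0 \<le> y1 t"
    then have neg: "y1 t < 0" by simp
    show False
    proof (rule not_linear_decreasing_if_pos[of "- y1 t" t y y1])
      fix r assume r: "t \<le> r"
      show "y1 r \<le> - (- y1 t)" using G_nonincreasing[of t r] fn r t s neg by simp
    qed (use neg dy pos s t in \<open>auto intro: less_imp_le\<close>)
  qed
  have "\<forall>\<^sub>F r in at_top. \<theta> r < y s"
  proof -
    have "((\<lambda>r. \<theta> r) \<longlongrightarrow> 0) at_top" using \<nu> by real_asymp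
    then show ?thesis using pos[OF s] by (rule order_tendstoD)
  qed
  then have "\<forall>\<^sub>F r in at_top. \<theta> r < y s \<and> s \<le> r" using eventually_ge_at_top by (rule eventually_conj)
  then obtain r where r: "\<theta> r < y s" "s \<le> r"
    by (auto simp: eventually_at_top_linorder)
  have "y s \<le> y r"
  proof (rule DERIV_nonneg_imp_nondecreasing[OF r(2)])
    fix x assume "s \<le> x" "x \<le> r"
    then show "\<exists>z. (y has_real_derivative z) (at x) \<and> 0 \<le> z" using dy[of x] y1n[of x] s by auto
  qed
  then show False using below[OF r(2)] r(1) by simp
qed

text \<open>Between two crossings of \<open>\<theta>\<close>, the mean value theorem gives a first point where \<open>y' < \<theta>'\<close> and a later one
  where \<open>y' > \<theta>'\<close>; below \<open>\<theta>\<close>, however, \<open>e^(-\<alpha> s) y'\<close> is nonincreasing, while \<open>\<theta>'\<close> increases.\<close>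

lemma stays_above:
  assumes s1: "S0 < s1" "\<theta> s1 \<le> y s1" and s3: "s1 \<le> s3"
  shows "\<theta> s3 \<le> y s3"
proof (rule ccontr)
  assume "\<not> ?thesis"
  then have D3: "\<theta> s3 - y s3 > 0" by simp
  define D where "D s = \<theta> s - y s" for s
  have dD: "(D has_real_derivative - (\<nu> * \<theta> s) - y1 s) (at s)" if "S0 < s" for s
    unfolding D_def by (auto intro!: derivative_eq_intros dy that)
  have cD: "continuous_on {a..b} D" if "S0 < a" for a b
    using DERIV_isCont[OF dD] that by (intro continuous_at_imp_continuous_on) auto
  obtain t where t: "s3 \<le> t" "D t \<le> 0" using above_frequently[of s3] s1(1) s3 by (auto simp: D_def)
  obtain b where b: "s3 < b" "D b \<le> 0" "\<And>s. s3 \<le> s \<Longrightarrow> s < b \<Longrightarrow> 0 < D s"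
    using first_nonpos_point[OF cD, of s3 t] D3 t s1(1) s3 by (auto simp: D_def)
  \<comment> \<open>Reflection turns the last crossing before \<open>s3\<close> into a first
    one.\<close>
  have cr: "continuous_on {- s3..- s1} (\<lambda>s. D (- s))"
    by (rule continuous_on_compose2[OF cD[OF s1(1), of s3]]) (auto intro!: continuous_intros)
  obtain a' where a': "- s3 < a'" "a' \<le> - s1" "D (- a') \<le> 0" "\<And>s. - s3 \<le> s \<Longrightarrow> s < a' \<Longrightarrow> 0 < D (- s)"
    by (rule first_nonpos_point[OF cr]) (use D3 s1 s3 in \<open>auto simp: D_def\<close>)
  define a where "a = - a'"
  have a: "a < s3" "s1 \<le> a" "D a \<le> 0" "\<And>s. a < s \<Longrightarrow> s \<le> s3 \<Longrightarrow> 0 < D s"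
    using a' a'(4)[of "- s" for s] by (auto simp: a_def)
  have "\<exists>l z. a < z \<and> z < s3 \<and> (D has_real_derivative l) (at z) \<and> D s3 - D a = (s3 - a) * l"
  proof (rule MVT[OF a(1)])
    show "continuous_on {a..s3} D" using cD a(2) s1(1) by simp
    show "D differentiable at x" if "a < x" "x < s3" for x
      using dD[of x] that a(2) s1(1) real_differentiable_def by force
  qed
  then obtain l z where z: "a < z" "z < s3" "(D has_real_derivative l) (at z)" "D s3 - D a = (s3 - a) * l"
    by blast
  have "\<exists>l z. s3 < z \<and> z < b \<and> (D has_real_derivative l) (at z) \<and> D b - D s3 = (b - s3) * l"
  proof (rule MVT[OF b(1)])
    show "continuous_on {s3..b} D" using cD s1(1) s3 by simp
    show "D differentiable at x" if "s3 < x" "x < b" for x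
      using dD[of x] that s1(1) s3 real_differentiable_def by force
  qed
  then obtain l' z' where z': "s3 < z'" "z' < b" "(D has_real_derivative l') (at z')" "D b - D s3 = (b - s3) * l'"
    by blast
  have zS: "S0 < z" "S0 < z'" using z(1) z'(1) a(2) s1(1) s3 by auto
  have "l = - (\<nu> * \<theta> z) - y1 z" using z(3) dD[OF zS(1)] by (rule DERIV_unique)
  moreover have "0 < (s3 - a) * l" using z(4) a(3) D3 by (simp add: D_def)
  ultimately have 1: "y1 z < - (\<nu> * \<theta> z)" using a(1) by (simp add: zero_less_mult_iff)
  have "l' = - (\<nu> * \<theta> z') - y1 z'" using z'(3) dD[OF zS(2)] by (rule DERIV_unique)
  moreover have "(b - s3) * l' < 0" using z'(4) b(2) D3 by (simp add: D_def)
  ultimately have 2: "- (\<nu> * \<theta> z') < y1 z'" using b(1) by (simp add: mult_less_0_iff)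
  have 3: "\<nu> * \<theta> z' \<le> \<nu> * \<theta> z" using z z' \<nu> by simp
  have neg: "y1 z < 0" using 1 \<nu> by (smt (verit) exp_gt_zero mult_pos_pos)
  have "y1 z' \<le> y1 z"
  proof (rule G_nonincreasing[OF zS(1)])
    fix s assume s: "z \<le> s" "s \<le> z'"
    then have "0 < D s" using a(4)[of s] b(3)[of s] z z' by (cases "s \<le> s3") auto
    then show "f s \<le> 0" using pos[of s] s zS by (intro f_nonpos) (auto simp: D_def)
  qed (use z z' neg in auto)
  then show False using 1 2 3 by simp
qed

lemma eventually_above:
  obtains S1 where "S0 < S1" "S1 > 0" "\<And>s. S1 \<le> s \<Longrightarrow> \<theta> s \<le> y s" "\<And>s. S1 \<le> s \<Longrightarrow> y1 s \<le> 0"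
proof -
  obtain S1 where S1: "max S0 0 + 1 \<le> S1" "\<theta> S1 \<le> y S1"
    using above_frequently[of "max S0 0 + 1"] by fastforce
  have S1': "S0 < S1" "S1 > 0" using S1(1) by auto
  show ?thesis
    by (rule that[OF S1']) (use stays_above[OF S1'(1) S1(2)] nonincreasing_above S1' in auto)
qed

theorem asymptotics: "((\<lambda>s. y s / s powr (- \<nu> / 2)) \<longlongrightarrow> (\<alpha> * \<nu> / 2) powr (\<nu> / 2)) at_top"
proof -
  obtain S1 where S1: "S0 < S1" "S1 > 0" "\<And>s. S1 \<le> s \<Longrightarrow> \<theta> s \<le> y s" "\<And>s. S1 \<le> s \<Longrightarrow> y1 s \<le> 0"
    using eventually_above by blast
  have S: "S0 < s" if "S1 \<le> s" for s using S1(1) that by simp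
  have yp: "0 < y s" if "S1 \<le> s" for s using pos S that by blast
  have ymono: "y b \<le> y a" if "S1 \<le> a" "a \<le> b" for a b
  proof (rule DERIV_nonpos_imp_nonincreasing[OF that(2)])
    fix x assume "a \<le> x" "x \<le> b"
    then show "\<exists>z. (y has_real_derivative z) (at x) \<and> z \<le> 0" using dy[OF S, of x] S1(4)[of x] that by auto
  qed
  \<comment> \<open>This is the bound \<open>v \<le> 1 / \<alpha>\<close> in disguise. If
    \<open>\<omega> = \<alpha> y' + y^q\<close> is negative once, then
    \<open>\<omega>' \<le> \<alpha> \<omega>\<close> because \<open>y' \<le> 0\<close>; so
    \<open>\<omega>\<close> stays below that value and \<open>y\<close> falls linearly.\<close>
  have \<omega>: "0 \<le> \<alpha> * y1 t + y t powr q" if t: "S1 \<le> t" for t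
  proof (rule ccontr)
    define \<omega> where "\<omega> s = \<alpha> * y1 s + y s powr q" for s
    assume "\<not> ?thesis"
    then have neg: "\<omega> t < 0" by (simp add: \<omega>_def)
    have dec: "\<omega> r \<le> \<omega> t" if r: "t \<le> r" for r
    proof (rule exp_weight_nonincreasing[where \<omega>=\<omega>, OF \<alpha> _ less_imp_le[OF neg] r])
        fix x assume "t \<le> x" "x \<le> r"
        then have x: "S1 \<le> x" using t by simp
        have yx: "0 < y x" "y1 x \<le> 0" using yp[OF x] S1(4)[OF x] by auto
        let ?d = "\<alpha> * (\<alpha> * y1 x + f x) + q * y x powr (q - 1) * y1 x"
        have "(\<omega> has_real_derivative ?d) (at x)"
          unfolding \<omega>_def using yx by (auto intro!: derivative_eq_intros dy[OF S[OF x]] dy1'[OF S[OF x]])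
        moreover have "?d - \<alpha> * \<omega> x \<le> 0"
        proof -
          have "?d - \<alpha> * \<omega> x = - (\<alpha> * (exp (- (\<delta> * x)) * y x powr p)) + q * y x powr (q - 1) * y1 x"
            by (simp add: \<omega>_def f_def algebra_simps)
          moreover have "q * y x powr (q - 1) * y1 x \<le> 0"
            using yx q1 by (intro mult_nonneg_nonpos) auto
          moreover have "0 \<le> \<alpha> * (exp (- (\<delta> * x)) * y x powr p)" using \<alpha> by simp
          ultimately show ?thesis by linarith
        qed
        ultimately show "\<exists>d. (\<omega> has_real_derivative d) (at x) \<and> d \<le> \<alpha> * \<omega> x"
          by (intro exI[of _ ?d]) simp
    qed
    show False
    proof (rule not_linear_decreasing_if_pos[of "- \<omega> t / \<alpha>" t y y1])
      fix r assume r: "t \<le> r"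
      have "\<alpha> * y1 r \<le> \<omega> t" using dec[OF r] powr_ge_zero[of "y r" q] unfolding \<omega>_def by linarith
      then show "y1 r \<le> - (- \<omega> t / \<alpha>)" using \<alpha> by (simp add: field_simps)
    qed (use neg \<alpha> t dy[OF S] yp in \<open>auto intro: less_imp_le simp: divide_neg_pos\<close>)
  qed
  \<comment> \<open>\<open>\<alpha> y - y'\<close> is nonnegative and has derivative
    \<open>- f\<close>. If \<open>y\<close> stayed above \<open>l\<close>, then \<open>f\<close>
    would eventually exceed a positive constant, since the term with \<open>y^p\<close> decays
    exponentially for bounded \<open>y\<close>.\<close>
  have small: "\<exists>s\<ge>S1. y s < l" if l: "l > 0" for l
  proof (rule ccontr)
    assume "\<not> ?thesis"
    then have yl: "l \<le> y s" if "S1 \<le> s" for s using that by force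
    define c where "c = l powr q / 2"
    have c: "c > 0" using l by (simp add: c_def)
    have "((\<lambda>s. exp (- (\<delta> * s)) * y S1 powr p) \<longlongrightarrow> 0 * y S1 powr p) at_top"
    proof (rule tendsto_mult[OF _ tendsto_const])
      show "((\<lambda>s. exp (- (\<delta> * s))) \<longlongrightarrow> 0) at_top" using \<delta>pos by real_asymp
    qed
    then have "\<forall>\<^sub>F s in at_top. exp (- (\<delta> * s)) * y S1 powr p < c"
      using c by (intro order_tendstoD(2)[of _ 0]) auto
    then obtain S2 where S2: "\<And>s. S2 \<le> s \<Longrightarrow> exp (- (\<delta> * s)) * y S1 powr p < c"
      by (auto simp: eventually_at_top_linorder)
    define S3 where "S3 = max S1 S2"
    have fc: "c \<le> f s" if s: "S3 \<le> s" for s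
    proof -
      have s': "S1 \<le> s" "S2 \<le> s" using s by (auto simp: S3_def)
      have "exp (- (\<delta> * s)) * y s powr p \<le> exp (- (\<delta> * s)) * y S1 powr p"
        by (intro mult_left_mono powr_mono2) (use p yp[OF s'(1)] ymono[of S1 s] s' in auto)
      moreover have "l powr q \<le> y s powr q" by (rule powr_mono2) (use q1 l yl s' in auto)
      moreover have "l powr q = 2 * c" by (simp add: c_def)
      ultimately show ?thesis using S2[OF s'(2)] unfolding f_def by linarith
    qed
    show False
    proof (rule not_linear_decreasing_if_pos[of c S3 "\<lambda>s. \<alpha> * y s - y1 s" "\<lambda>s. - f s"])
      fix s assume s: "S3 \<le> s"
      then have s1: "S1 \<le> s" by (simp add: S3_def)
      show "((\<lambda>s. \<alpha> * y s - y1 s) has_real_derivative - f s) (at s)"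
        by (auto intro!: derivative_eq_intros dy[OF S[OF s1]] dy1'[OF S[OF s1]])
      show "- f s \<le> - c" using fc[OF s] by simp
      show "0 \<le> \<alpha> * y s - y1 s" using \<alpha> yp[OF s1] S1(4)[OF s1] by (smt (verit) mult_pos_pos)
    qed (use c in auto)
  qed
  have y0: "(y \<longlongrightarrow> 0) at_top"
  proof (rule tendstoI)
    fix e :: real assume "e > 0"
    then obtain s where s: "S1 \<le> s" "y s < e" using small by blast
    show "\<forall>\<^sub>F t in at_top. dist (y t) 0 < e"
      using eventually_ge_at_top[of s]
    proof eventually_elim
      case (elim t)
      then show ?case using ymono[OF s(1) elim] yp[of t] s by (simp add: dist_real_def)
    qed
  qed
  \<comment> \<open>Chosen for \<open>z' = (q - 1) v\<close>, so that the growth of \<open>z\<close>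
    is read off from the limit of \<open>v\<close>.\<close>
  define z where "z s = y s powr (- (q - 1))" for s
  define v where "v s = - y1 s * y s powr (- q)" for s
  have dz: "(z has_real_derivative (q - 1) * v s) (at s)" if "S1 \<le> s" for s
    unfolding z_def v_def using yp[OF that]
    by (auto intro!: derivative_eq_intros dy[OF S[OF that]] simp: algebra_simps)
  have v0: "0 \<le> v s" if "S1 \<le> s" for s using S1(4)[OF that] by (simp add: v_def mult_nonpos_nonneg)
  have v1: "v s \<le> 1 / \<alpha>" if s: "S1 \<le> s" for s
  proof -
    have "- y1 s * y s powr (- q) \<le> (y s powr q / \<alpha>) * y s powr (- q)"
      by (rule mult_right_mono) (use \<omega>[OF s] \<alpha> in \<open>auto simp: field_simps\<close>)
    also have "\<dots> = 1 / \<alpha>" using yp[OF s] by (simp add: powr_minus)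
    finally show ?thesis by (simp add: v_def)
  qed
  define A where "A = z S1"
  define B where "B = (q - 1) / \<alpha>"
  have AB: "A > 0" "B > 0" using yp[of S1] q1 \<alpha> by (auto simp: A_def B_def z_def)
  have zb: "z s \<le> A + B * s" if s: "S1 \<le> s" for s
  proof -
    have "z s - B * s \<le> z S1 - B * S1"
    proof (rule DERIV_nonpos_imp_nonincreasing[OF s])
      fix x assume "S1 \<le> x" "x \<le> s"
      then have "(q - 1) * v x \<le> (q - 1) * (1 / \<alpha>)" using v1[of x] q1 by (intro mult_left_mono) auto
      then show "\<exists>d. ((\<lambda>s. z s - B * s) has_real_derivative d) (at x) \<and> d \<le> 0"
        using \<open>S1 \<le> x\<close> by (intro exI[of _ "(q - 1) * v x - B"]) (auto intro!: derivative_eq_intros dz simp: B_def \<alpha>[THEN less_imp_neq, symmetric])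
    qed
    moreover have "0 \<le> B * S1" using AB S1(2) by simp
    ultimately show ?thesis by (simp add: A_def)
  qed
  define \<gamma> where "\<gamma> = (q - p) / (q - 1)"
  have \<gamma>: "\<gamma> > 0" using pq q1 by (simp add: \<gamma>_def)
  \<comment> \<open>The perturbation divided by \<open>y^q\<close>. It contains a negative power of
    \<open>y\<close>, so \<open>y\<close> must not decay too fast: by \<open>zb\<close> the factor
    \<open>y^(p - q) = z^\<gamma>\<close> grows at most polynomially, and the exponential
    wins.\<close>
  define e where "e s = exp (- (\<delta> * s)) * y s powr (p - q)" for s
  have e0: "(e \<longlongrightarrow> 0) at_top"
  proof (rule tendsto_sandwich)
    show "\<forall>\<^sub>F s in at_top. 0 \<le> e s" by (simp add: e_def)
    show "\<forall>\<^sub>F s in at_top. e s \<le> exp (- (\<delta> * s)) * (A + B * s) powr \<gamma>"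
      using eventually_ge_at_top[of S1]
    proof eventually_elim
      case (elim s)
      have "(q - 1) * \<gamma> = q - p" using q1 by (simp add: \<gamma>_def)
      then have "- (q - 1) * \<gamma> = p - q" by linarith
      then have "z s powr \<gamma> = y s powr (p - q)"
        by (simp only: z_def powr_powr)
      moreover have "z s powr \<gamma> \<le> (A + B * s) powr \<gamma>"
        by (rule powr_mono2) (use \<gamma> zb[OF elim] in \<open>auto simp: z_def\<close>)
      ultimately show ?case by (simp add: e_def)
    qed
    show "((\<lambda>s. exp (- (\<delta> * s)) * (A + B * s) powr \<gamma>) \<longlongrightarrow> 0) at_top"
      using AB \<gamma> \<delta>pos by real_asymp
  qed simp
  \<comment> \<open>A Riccati-type equation whose last two terms tend to \<open>0\<close>: the first
    by \<open>e0\<close>, the second because \<open>v\<close> is bounded and \<open>y\<close> tends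
    to \<open>0\<close>.\<close>
  have dv: "(v has_real_derivative \<alpha> * v s - 1 + e s + q * (v s)\<^sup>2 * y s powr (q - 1)) (at s)" if s: "S1 \<le> s" for s
  proof -
    have ys: "0 < y s" by (rule yp[OF s])
    have "(v has_real_derivative - (\<alpha> * y1 s + f s) * y s powr (- q) + (- y1 s) * (- q * y s powr (- q - 1) * y1 s)) (at s)"
      unfolding v_def using ys
      by (auto intro!: derivative_eq_intros dy[OF S[OF s]] dy1'[OF S[OF s]] simp: algebra_simps)
    moreover have "f s * y s powr (- q) = 1 - e s"
      using ys by (simp add: f_def e_def left_diff_distrib powr_add[symmetric] mult.assoc)
    then have "- (\<alpha> * y1 s + f s) * y s powr (- q) = \<alpha> * v s - 1 + e s"
      by (simp add: v_def algebra_simps)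
    moreover have "(- y1 s) * (- q * y s powr (- q - 1) * y1 s) = q * (v s)\<^sup>2 * y s powr (q - 1)"
    proof -
      have "(y s powr (- q))\<^sup>2 * y s powr (q - 1) = y s powr (- q - 1)"
      proof -
        have "(y s powr (- q))\<^sup>2 * y s powr (q - 1) = y s powr (- q + - q + (q - 1))"
          by (simp only: power2_eq_square powr_add)
        then show ?thesis by simp
      qed
      then have A: "q * (v s)\<^sup>2 * y s powr (q - 1) = q * (y1 s)\<^sup>2 * y s powr (- q - 1)"
        by (simp add: v_def power_mult_distrib mult.assoc)
      show ?thesis unfolding A by (simp add: power2_eq_square)
    qed
    ultimately show ?thesis by (simp only:)
  qed
  have vlim: "(v \<longlongrightarrow> 1 / \<alpha>) at_top"
  proof (rule tendstoI)
    fix \<eta> :: real assume \<eta>: "\<eta> > 0"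
    have "((\<lambda>s. y s powr (q - 1)) \<longlongrightarrow> 0) at_top"
    proof -
      have "\<forall>\<^sub>F s in at_top. 0 \<le> y s"
        using eventually_ge_at_top[of S1] by eventually_elim (rule less_imp_le[OF yp])
      then have "((\<lambda>s. y s powr (q - 1)) \<longlongrightarrow> 0 powr (q - 1)) at_top"
        using q1 by (intro tendsto_powr'[OF y0 tendsto_const]) auto
      then show ?thesis using q1 by simp
    qed
    from tendsto_add[OF e0 tendsto_mult[OF tendsto_const[of "q * (1 / \<alpha>)\<^sup>2"] this]]
    have "((\<lambda>s. e s + q * (1 / \<alpha>)\<^sup>2 * y s powr (q - 1)) \<longlongrightarrow> 0) at_top" by simp
    then have "\<forall>\<^sub>F s in at_top. e s + q * (1 / \<alpha>)\<^sup>2 * y s powr (q - 1) < \<alpha> * (\<eta> / 2)"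
      by (rule order_tendstoD(2)) (use \<alpha> \<eta> in simp)
    then obtain S2 where S2: "\<And>s. S2 \<le> s \<Longrightarrow> e s + q * (1 / \<alpha>)\<^sup>2 * y s powr (q - 1) < \<alpha> * (\<eta> / 2)"
      by (auto simp: eventually_at_top_linorder)
    define S3 where "S3 = max S1 S2"
    \<comment> \<open>Here the repelling equilibrium is used: once \<open>v\<close> is below
      \<open>1 / \<alpha> - \<eta> / 2\<close>, the difference stays negative and \<open>v\<close>
      falls linearly, although \<open>v \<ge> 0\<close>.\<close>
    have low: "0 \<le> v t - 1 / \<alpha> + \<eta> / 2" if t: "S3 \<le> t" for t
    proof (rule ccontr)
      define \<omega> where "\<omega> s = v s - 1 / \<alpha> + \<eta> / 2" for s
      assume "\<not> ?thesis"
      then have neg: "\<omega> t < 0" by (simp add: \<omega>_def)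
      have d\<omega>: "\<exists>d. (\<omega> has_real_derivative d) (at x) \<and> d \<le> \<alpha> * \<omega> x" if "t \<le> x" for x
      proof -
        have x: "S1 \<le> x" "S2 \<le> x" using that t by (auto simp: S3_def)
        have "(v x)\<^sup>2 \<le> (1 / \<alpha>)\<^sup>2" using v0[OF x(1)] v1[OF x(1)] by (rule power_mono[rotated])
        then have "q * (v x)\<^sup>2 * y x powr (q - 1) \<le> q * (1 / \<alpha>)\<^sup>2 * y x powr (q - 1)"
          using q1 by (intro mult_right_mono mult_left_mono) auto
        moreover have "\<alpha> * \<omega> x = \<alpha> * v x - 1 + \<alpha> * (\<eta> / 2)" using \<alpha> by (simp add: \<omega>_def field_simps)
        moreover have "(\<omega> has_real_derivative \<alpha> * v x - 1 + e x + q * (v x)\<^sup>2 * y x powr (q - 1)) (at x)"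
          unfolding \<omega>_def by (auto intro!: derivative_eq_intros dv[OF x(1)])
        ultimately show ?thesis using S2[OF x(2)] by (intro exI conjI) auto
      qed
      have dec: "\<omega> r \<le> \<omega> t" if r: "t \<le> r" for r
        by (rule exp_weight_nonincreasing[where \<omega>=\<omega>, OF \<alpha> d\<omega> less_imp_le[OF neg] r])
      have "\<exists>d. (v has_real_derivative d) (at x) \<and> d \<le> - (- (\<alpha> * \<omega> t))" if x: "t \<le> x" for x
      proof -
        obtain d where d: "(\<omega> has_real_derivative d) (at x)" "d \<le> \<alpha> * \<omega> x" using d\<omega>[OF x] by blast
        have "((\<lambda>s. \<omega> s + (1 / \<alpha> - \<eta> / 2)) has_real_derivative d + 0) (at x)"
          by (intro DERIV_add d(1) DERIV_const)
        then have "(v has_real_derivative d) (at x)" by (simp add: \<omega>_def)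
        moreover have "\<alpha> * \<omega> x \<le> \<alpha> * \<omega> t" using dec[OF x] \<alpha> by simp
        ultimately show ?thesis using d(2) by (intro exI[of _ d]) auto
      qed
      then obtain v' where v': "\<And>x. t \<le> x \<Longrightarrow> (v has_real_derivative v' x) (at x)"
        "\<And>x. t \<le> x \<Longrightarrow> v' x \<le> - (- (\<alpha> * \<omega> t))" by metis
      show False
        by (rule not_linear_decreasing_if_pos[OF _ v'])
          (use neg \<alpha> v0 t in \<open>auto simp: S3_def mult_pos_neg\<close>)
    qed
    show "\<forall>\<^sub>F s in at_top. dist (v s) (1 / \<alpha>) < \<eta>"
      using eventually_ge_at_top[of S3]
    proof eventually_elim
      case (elim s)
      have "v s \<le> 1 / \<alpha>" by (rule v1) (use elim in \<open>simp add: S3_def\<close>)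
      then show ?case using low[OF elim] \<eta> unfolding dist_real_def by linarith
    qed
  qed
  have zs: "((\<lambda>s. z s / s) \<longlongrightarrow> B) at_top"
  proof (rule lhospital_at_top_at_top[where f'="\<lambda>s. (q - 1) * v s" and g'="\<lambda>_. 1"])
    show "LIM s at_top. s :> at_top" by (rule filterlim_ident)
    show "\<forall>\<^sub>F s in at_top. (z has_real_derivative (q - 1) * v s) (at s)"
      using eventually_ge_at_top[of S1] by eventually_elim (rule dz)
    show "((\<lambda>s. (q - 1) * v s / 1) \<longlongrightarrow> B) at_top"
      using tendsto_mult[OF tendsto_const[of "q - 1"] vlim] by (simp add: B_def)
  qed auto
  have "((\<lambda>s. (z s / s) powr (- (\<nu> / 2))) \<longlongrightarrow> B powr (- (\<nu> / 2))) at_top"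
    by (rule tendsto_powr[OF zs tendsto_const]) (use AB in simp)
  \<comment> \<open>Since \<open>q - 1 = 2 / \<nu>\<close>, the power \<open>- \<nu> / 2\<close>
    inverts the definition of \<open>z\<close>, and \<open>B\<close> is the reciprocal of
    \<open>\<alpha> * \<nu> / 2\<close>.\<close>
  moreover have "B powr (- (\<nu> / 2)) = (\<alpha> * \<nu> / 2) powr (\<nu> / 2)"
  proof -
    have "B = inverse (\<alpha> * \<nu> / 2)" using \<nu> \<alpha> by (simp add: B_def q field_simps)
    then show ?thesis using \<alpha> \<nu> by (simp only: powr_minus inverse_powr) (simp add: powr_divide powr_mult field_simps)
  qed
  moreover have "\<forall>\<^sub>F s in at_top. (z s / s) powr (- (\<nu> / 2)) = y s / s powr (- \<nu> / 2)"
    using eventually_ge_at_top[of S1]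
  proof eventually_elim
    case (elim s)
    have "z s powr (- (\<nu> / 2)) = y s"
      using yp[OF elim] \<nu> by (simp add: z_def powr_powr q)
    then show ?case using S1(2) elim by (simp add: powr_divide z_def)
  qed
  ultimately show ?thesis by (simp add: tendsto_cong)
qed

end

section \<open>Radial functions with a weak gradient\<close>

lemma nlog_integral:
  fixes b :: "'a::euclidean_space \<Rightarrow> real"
  assumes b[measurable]: "b \<in> borel_measurable borel" and nn: "\<And>x. 0 \<le> b x" and bd: "\<And>x. b x \<le> B"
    and hom: "\<And>c x. c > 0 \<Longrightarrow> b (c *\<^sub>R x) = b x" and k[measurable]: "k \<in> borel_measurable borel"
  shows "(LBINT x. b x * k (nlog x)) = cone_const b * (LBINT s. exp (- (real DIM('a) * s)) * k s)"
    and "integrable lborel (\<lambda>x. b x * k (nlog x)) \<longleftrightarrow>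
      integrable lborel (\<lambda>s. cone_const b * exp (- (real DIM('a) * s)) * k s)"
proof -
  have nonneg: "0 \<le> cone_const b * exp (- (real DIM('a) * s))" for s
    by (simp add: cone_const_def)
  have D: "distr (density lborel (\<lambda>x. ennreal (b x))) borel nlog =
      density lborel (\<lambda>s. ennreal (cone_const b * exp (- (real DIM('a) * s))))"
    by (rule distr_nlog_density[OF b nn bd hom])
  have "(LBINT x. b x * k (nlog x)) = (LINT x|density lborel (\<lambda>x. ennreal (b x)). k (nlog x))"
    by (subst integral_density) (use nn in auto)
  also have "\<dots> = (LINT s|distr (density lborel (\<lambda>x. ennreal (b x))) borel nlog. k s)"
    by (subst integral_distr) auto
  also have "\<dots> = (LBINT s. cone_const b * exp (- (real DIM('a) * s)) * k s)"
    by (subst D, subst integral_density) (use nonneg in auto)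
  finally show "(LBINT x. b x * k (nlog x)) = cone_const b * (LBINT s. exp (- (real DIM('a) * s)) * k s)"
    by (simp add: mult.assoc)
  have "integrable lborel (\<lambda>x. b x * k (nlog x)) \<longleftrightarrow> integrable (density lborel (\<lambda>x. ennreal (b x))) (\<lambda>x. k (nlog x))"
    by (subst integrable_density) (use nn in auto)
  also have "\<dots> \<longleftrightarrow> integrable (distr (density lborel (\<lambda>x. ennreal (b x))) borel nlog) k"
    by (subst integrable_distr_eq) auto
  also have "\<dots> \<longleftrightarrow> integrable lborel (\<lambda>s. cone_const b * exp (- (real DIM('a) * s)) * k s)"
    by (subst D, subst integrable_density) (use nonneg in auto)
  finally show "integrable lborel (\<lambda>x. b x * k (nlog x)) \<longleftrightarrow>
      integrable lborel (\<lambda>s. cone_const b * exp (- (real DIM('a) * s)) * k s)" .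
qed

lemma L1_loc_mult_integrable:
  fixes f \<theta> :: "real^'n \<Rightarrow> real"
  assumes f: "f \<in> L1_loc \<Omega>" and \<theta>: "continuous_on UNIV \<theta>"
    and K: "compact K" "K \<subseteq> \<Omega>" "\<And>x. \<theta> x \<noteq> 0 \<Longrightarrow> x \<in> K"
  shows "set_integrable lebesgue \<Omega> (\<lambda>x. f x * \<theta> x)"
proof -
  have "bounded (\<theta> ` K)"
    by (intro compact_imp_bounded compact_continuous_image continuous_on_subset[OF \<theta>] K(1)) simp
  then obtain B where B: "\<And>x. x \<in> K \<Longrightarrow> \<bar>\<theta> x\<bar> \<le> B" unfolding bounded_iff by force
  have B': "\<bar>\<theta> x\<bar> \<le> max B 0" for x
    using B[of x] K(3)[of x] by (cases "\<theta> x = 0") auto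
  have m: "\<theta> \<in> borel_measurable lebesgue"
    using borel_measurable_continuous_onI[OF \<theta>] by (simp add: measurable_completion)
  have "integrable lebesgue (\<lambda>x. (indicator K x * f x) * \<theta> x)"
  proof (rule integrable_mult_bounded[OF _ m B'])
    show "integrable lebesgue (\<lambda>x. indicator K x * f x)"
      using f K(1,2) by (simp add: L1_loc_def set_integrable_def)
  qed
  also have "(\<lambda>x. (indicator K x * f x) * \<theta> x) = (\<lambda>x. indicator \<Omega> x *\<^sub>R (f x * \<theta> x))"
  proof
    fix x show "(indicator K x * f x) * \<theta> x = indicator \<Omega> x *\<^sub>R (f x * \<theta> x)"
      using K(2) K(3)[of x] by (cases "\<theta> x = 0") (auto simp: indicator_def)
  qed
  finally show ?thesis by (simp add: set_integrable_def)
qed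

lemma L1_loc_component:
  fixes g :: "real^'n \<Rightarrow> real^'n"
  assumes "g \<in> L1_loc \<Omega>"
  shows "(\<lambda>x. g x $ i) \<in> L1_loc \<Omega>"
proof -
  have "integrable lebesgue (\<lambda>x. indicator K x *\<^sub>R g x $ i)" if "compact K" "K \<subseteq> \<Omega>" for K
  proof -
    have "integrable lebesgue (\<lambda>x. indicator K x *\<^sub>R g x)"
      using assms that by (simp add: L1_loc_def set_integrable_def)
    from integrable_bounded_linear[OF bounded_linear_vec_nth[of i] this] show ?thesis by simp
  qed
  then show ?thesis by (simp add: L1_loc_def set_integrable_def)
qed

lemma L1_loc_inner:
  fixes g :: "real^'n \<Rightarrow> real^'n"
  assumes "g \<in> L1_loc \<Omega>"
  shows "(\<lambda>x. g x \<bullet> x) \<in> L1_loc \<Omega>"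
proof -
  have "integrable lebesgue (\<lambda>x. indicator K x *\<^sub>R (g x \<bullet> x))" if K: "compact K" "K \<subseteq> \<Omega>" for K
  proof -
    obtain B where B: "\<And>x. x \<in> K \<Longrightarrow> norm x \<le> B" using compact_imp_bounded[OF K(1)] bounded_iff by blast
    have "integrable lebesgue (\<lambda>x. (indicator K x *\<^sub>R g x $ i) * (indicator K x * x $ i))" for i
    proof (rule integrable_mult_bounded)
      show "integrable lebesgue (\<lambda>x. indicator K x *\<^sub>R g x $ i)"
        using L1_loc_component[OF assms, of i] K by (simp add: L1_loc_def set_integrable_def)
      have "K \<in> sets borel" using K(1) by (simp add: borel_compact)
      moreover have "(\<lambda>x::real^'n. x $ i) \<in> borel_measurable borel"
        by (intro borel_measurable_continuous_onI continuous_intros)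
      ultimately have "(\<lambda>x. indicator K x * x $ i) \<in> borel_measurable borel"
        by (intro borel_measurable_times borel_measurable_indicator)
      then show "(\<lambda>x. indicator K x * x $ i) \<in> borel_measurable lebesgue"
        by (simp add: measurable_completion)
      show "\<bar>indicator K x * x $ i\<bar> \<le> max B 0" for x
        using B[of x] component_le_norm_cart[of x i] by (cases "x \<in> K") auto
    qed
    then have "integrable lebesgue (\<lambda>x. \<Sum>i\<in>UNIV. (indicator K x *\<^sub>R g x $ i) * (indicator K x * x $ i))"
      by (intro Bochner_Integration.integrable_sum)
    also have "(\<lambda>x. \<Sum>i\<in>UNIV. (indicator K x *\<^sub>R g x $ i) * (indicator K x * x $ i)) = (\<lambda>x. indicator K x *\<^sub>R (g x \<bullet> x))"
    proof
      fix x show "(\<Sum>i\<in>UNIV. (indicator K x *\<^sub>R g x $ i) * (indicator K x * x $ i)) = indicator K x *\<^sub>R (g x \<bullet> x)"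
        by (cases "x \<in> K") (simp_all add: inner_vec_def)
    qed
    finally show ?thesis .
  qed
  then show ?thesis by (simp add: L1_loc_def set_integrable_def)
qed

lemma frechet_derivative_eq_0_outside:
  fixes f :: "'a::real_normed_vector \<Rightarrow> real"
  assumes f: "smooth_on UNIV f" and K: "compact K" "\<And>y. f y \<noteq> 0 \<Longrightarrow> y \<in> K" and x: "x \<notin> K"
  shows "frechet_derivative f (at x) = (\<lambda>h. 0)"
proof -
  have "(f has_derivative frechet_derivative f (at x)) (at x)"
    using smooth_on_differentiable[OF f] by (simp add: frechet_derivative_works[symmetric])
  then have "((\<lambda>x. 0) has_derivative frechet_derivative f (at x)) (at x)"
    by (rule has_derivative_transform_within_open[of _ _ _ _ "- K"])
      (use K x in \<open>auto simp: compact_imp_closed open_Compl\<close>)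
  then show ?thesis using has_derivative_unique[OF _ has_derivative_const] by blast
qed

lemma test_functionsI:
  assumes "smooth_on UNIV \<phi>" "compact K" "K \<subseteq> \<Omega>" "\<And>x. \<phi> x \<noteq> 0 \<Longrightarrow> x \<in> K"
  shows "\<phi> \<in> test_functions \<Omega>"
proof -
  have sub: "closure {x. \<phi> x \<noteq> 0} \<subseteq> K"
    by (rule closure_minimal) (use assms in \<open>auto simp: compact_imp_closed\<close>)
  have "compact (closure {x. \<phi> x \<noteq> 0})"
    using compact_Int_closed[OF assms(2) closed_closure[of "{x. \<phi> x \<noteq> 0}"]] sub
    by (simp only: inf.absorb2)
  then show ?thesis using assms sub by (simp add: test_functions_def)
qed

text \<open>The convention \<open>b 0 = 0\<close> discards the junk value of \<open>nlog\<close> at the origin.\<close>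

locale cone =
  fixes \<Omega> Cn :: "(real^'n) set" and J :: "real set" and b :: "real^'n \<Rightarrow> real" and N :: real
  assumes N: "N = real CARD('n)" and J: "open J" "is_interval J" "J \<noteq> {}"
    and \<Omega>: "open \<Omega>"
    and b_smooth: "smooth_on (-{0}) b" and b_nonneg: "\<And>x. 0 \<le> b x" and b_le: "\<And>x. b x \<le> 1"
    and b_hom: "\<And>c x. c > 0 \<Longrightarrow> b (c *\<^sub>R x) = b x" and b_0: "b 0 = 0"
    and b_supp: "\<And>x. b x \<noteq> 0 \<Longrightarrow> x \<in> Cn" and b_pos: "\<exists>x. 0 < b x"
    and Cn: "closed Cn" "\<And>x. x \<in> Cn \<Longrightarrow> x \<noteq> 0 \<Longrightarrow> nlog x \<in> J \<Longrightarrow> x \<in> \<Omega>"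
begin

lemma b_measurable [measurable]: "b \<in> borel_measurable borel"
proof -
  have "(\<lambda>x. indicator (-{0}) x *\<^sub>R b x) \<in> borel_measurable borel"
    by (rule borel_measurable_continuous_on_indicator) (use smooth_on_continuous[OF b_smooth] in auto)
  also have "(\<lambda>x. indicator (-{0}) x *\<^sub>R b x) = b"
  proof
    show "indicator (-{0}) x *\<^sub>R b x = b x" for x using b_0 by (cases "x = 0") auto
  qed
  finally show ?thesis .
qed

lemma b_cone_const_pos: "0 < cone_const b"
proof -
  let ?U = "{x \<in> ball 0 1 - {0}. b x \<in> {0<..}}"
  obtain x where x: "0 < b x" using b_pos by blast
  then have x0: "x \<noteq> 0" using b_0 by auto
  have "(1 / (2 * norm x)) *\<^sub>R x \<in> ?U"
    using x x0 b_hom[of "1 / (2 * norm x)" x] by simp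
  then have ne: "?U \<noteq> {}" by blast
  have "continuous_on (ball 0 1 - {0}) b"
    using smooth_on_continuous[OF b_smooth] by (rule continuous_on_subset) auto
  then have op: "open ?U"
    using continuous_open_preimage[of "ball 0 1 - {0}" b "{0<..}"]
    by (simp add: vimage_def Int_def open_delete)
  show ?thesis
    by (rule cone_const_pos[OF b_measurable b_nonneg b_le op ne]) auto
qed

lemmas nlog_integral_b = nlog_integral[OF b_measurable b_nonneg b_le b_hom, simplified, folded N]

text \<open>Phrased with norms so that closedness and boundedness are visible. It avoids the
  origin.\<close>

definition sector where "sector c d = {x \<in> Cn. exp (- d) \<le> norm x \<and> norm x \<le> exp (- c)}"

lemma compact_sector: "compact (sector c d)"
proof -
  have "closed (Cn \<inter> {x. exp (- d) \<le> norm x} \<inter> {x. norm x \<le> exp (- c)})"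
    by (intro closed_Int Cn(1) closed_Collect_le continuous_intros)
  moreover have "sector c d = Cn \<inter> {x. exp (- d) \<le> norm x} \<inter> {x. norm x \<le> exp (- c)}"
    by (auto simp: sector_def)
  moreover have "bounded (sector c d)" by (auto simp: sector_def bounded_iff)
  ultimately show ?thesis by (simp add: compact_eq_bounded_closed)
qed

lemma sector_iff: "x \<in> sector c d \<longleftrightarrow> x \<in> Cn \<and> x \<noteq> 0 \<and> nlog x \<in> {c..d}"
proof (cases "x = 0")
  case True then show ?thesis by (auto simp: sector_def not_le)
next
  case False
  have "exp (- d) \<le> norm x \<longleftrightarrow> nlog x \<le> d" using less_nlog_iff[OF False, of d] by (simp add: not_less[symmetric])
  moreover have "norm x \<le> exp (- c) \<longleftrightarrow> c \<le> nlog x" using nlog_less_iff[OF False, of c] by (simp add: not_less[symmetric])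
  ultimately show ?thesis using False by (auto simp: sector_def)
qed

lemma sector_subset: "{c..d} \<subseteq> J \<Longrightarrow> sector c d \<subseteq> \<Omega>"
  using Cn(2) sector_iff by blast

lemma in_sector: "b x \<noteq> 0 \<Longrightarrow> nlog x \<in> {c..d} \<Longrightarrow> x \<in> sector c d"
  using b_supp b_0 sector_iff by blast

definition \<psi> where "\<psi> a x = b x * a (nlog x)"

lemma \<psi>_support: "\<forall>s. s \<notin> {c<..<d} \<longrightarrow> a s = 0 \<Longrightarrow> \<psi> a x \<noteq> 0 \<Longrightarrow> x \<in> sector c d"
  by (rule in_sector) (auto simp: \<psi>_def, (meson greaterThanLessThan_iff less_imp_le not_le)+)

text \<open>Near the origin \<open>nlog\<close> lies beyond the support of \<open>a\<close>, and at
  the origin \<open>b\<close> is \<open>0\<close>, so \<open>\<psi> a\<close> vanishes on a ball;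
  off the origin both factors are smooth.\<close>

lemma \<psi>_smooth:
  assumes a: "a \<in> tests J"
  shows "smooth_on UNIV (\<psi> a)"
proof -
  obtain c d where cd: "c < d" "{c..d} \<subseteq> J" "\<forall>s. s \<notin> {c<..<d} \<longrightarrow> a s = 0"
    using testsE[OF a] by blast
  have 1: "smooth_on (-{0}) (\<psi> a)"
  proof -
    have "smooth_on (-{0}) (\<lambda>x::real^'n. a (nlog x))"
      by (rule smooth_on_compose[OF _ open_UNIV _ tests_smooth[OF a]])
        (use smooth_on_neg_ln_norm[where 'a="real^'n"] in \<open>auto simp: nlog_def[abs_def]\<close>)
    then show ?thesis unfolding \<psi>_def[abs_def]
      by (intro smooth_on_mult b_smooth) auto
  qed
  have "\<psi> a x = 0" if "x \<in> ball 0 (exp (- d))" for x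
  proof (rule ccontr)
    assume "\<psi> a x \<noteq> 0"
    then have "x \<in> sector c d" using \<psi>_support[OF cd(3)] by blast
    then show False using that by (simp add: sector_def)
  qed
  then have 2: "smooth_on (ball 0 (exp (- d))) (\<psi> a)"
    by (intro smooth_on_cong[OF _ _ smooth_on_const[of _ 0]]) auto
  have "- {0} \<union> ball 0 (exp (- d)) = (UNIV :: (real^'n) set)" by auto
  then show ?thesis using smooth_on_Un[OF _ _ 1 2] by (simp add: open_Compl)
qed

text \<open>Along a ray \<open>b\<close> is constant and \<open>nlog\<close> shifts by
  \<open>- ln t\<close>, so no derivative of \<open>b\<close> enters. This is what makes angular
  cutoffs harmless.\<close>

lemma \<psi>_radial_derivative:
  assumes a: "a \<in> tests J" and a': "\<And>s. (a has_real_derivative a' s) (at s)"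
  shows "frechet_derivative (\<psi> a) (at x) x = - (b x * a' (nlog x))"
proof -
  have diff: "\<psi> a differentiable (at x)" using smooth_on_differentiable[OF \<psi>_smooth[OF a]] by simp
  then have lin: "linear (frechet_derivative (\<psi> a) (at x))" by (rule linear_frechet_derivative)
  show ?thesis
  proof (cases "x = 0")
    case True
    then show ?thesis using linear_0[OF lin] b_0 by simp
  next
    case False
    have hd: "(\<psi> a has_derivative frechet_derivative (\<psi> a) (at x)) (at (1 *\<^sub>R x))"
      using diff by (simp add: frechet_derivative_works)
    have "((\<lambda>t. t *\<^sub>R x) has_derivative (\<lambda>h. h *\<^sub>R x)) (at (1::real))"
      by (intro derivative_eq_intros | simp)+
    from has_derivative_compose[OF this hd]
    have "((\<lambda>t. \<psi> a (t *\<^sub>R x)) has_derivative (\<lambda>h. frechet_derivative (\<psi> a) (at x) (h *\<^sub>R x))) (at 1)" .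
    also have "(\<lambda>h. frechet_derivative (\<psi> a) (at x) (h *\<^sub>R x)) = (\<lambda>h. frechet_derivative (\<psi> a) (at x) x * h)"
      using linear_scale[OF lin] by auto
    finally have 1: "((\<lambda>t. \<psi> a (t *\<^sub>R x)) has_real_derivative frechet_derivative (\<psi> a) (at x) x) (at 1)"
      by (simp add: has_field_derivative_def)
    have "((\<lambda>t. b x * a (nlog x - ln t)) has_real_derivative b x * (a' (nlog x - ln 1) * (0 - 1 / 1))) (at 1)"
      by (intro DERIV_cmult DERIV_chain2[OF a'] DERIV_diff DERIV_const DERIV_ln_divide) simp
    then have "((\<lambda>t. b x * a (nlog x - ln t)) has_real_derivative - (b x * a' (nlog x))) (at 1)"
      by simp
    then have 2: "((\<lambda>t. \<psi> a (t *\<^sub>R x)) has_real_derivative - (b x * a' (nlog x))) (at 1)"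
      by (rule has_field_derivative_transform_within_open[of _ _ _ "{0<..}"])
        (use False in \<open>auto simp: \<psi>_def b_hom nlog_scaleR\<close>)
    show ?thesis using DERIV_unique[OF 1 2] .
  qed
qed

lemma integrable_\<psi>:
  assumes "f \<in> L1_loc \<Omega>" "a \<in> tests J"
  shows "set_integrable lebesgue \<Omega> (\<lambda>x. f x * \<psi> a x)"
proof -
  obtain c d where cd: "c < d" "{c..d} \<subseteq> J" "\<forall>s. s \<notin> {c<..<d} \<longrightarrow> a s = 0"
    using testsE[OF assms(2)] by blast
  show ?thesis
    by (rule L1_loc_mult_integrable[OF assms(1) smooth_on_continuous[OF \<psi>_smooth[OF assms(2)]] compact_sector sector_subset[OF cd(2)]])
      (rule \<psi>_support[OF cd(3)])
qed

text \<open>The weak gradient is tested with the components of the vector field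
  \<open>\<psi> a x *\<^sub>R x\<close>. By \<open>\<psi>_radial_derivative\<close> its divergence
  is \<open>b (N a - a')\<close>, evaluated at \<open>nlog x\<close>, and on the other side only the
  radial component of \<open>g\<close> appears.\<close>

lemma radial_divergence_identity:
  assumes wg: "weak_gradient \<Omega> u g" and a: "a \<in> tests J" "a' \<in> tests J" "\<And>s. (a has_real_derivative a' s) (at s)"
  shows "(LINT x:\<Omega>|lebesgue. u x * \<psi> (\<lambda>s. N * a s - a' s) x) = - (LINT x:\<Omega>|lebesgue. (g x \<bullet> x) * \<psi> a x)"
proof -
  obtain c d where cd: "c < d" "{c..d} \<subseteq> J" "\<forall>s. s \<notin> {c<..<d} \<longrightarrow> a s = 0"
    using testsE[OF a(1)] by blast
  have u: "u \<in> L1_loc \<Omega>" and g: "g \<in> L1_loc \<Omega>" using wg by (auto simp: weak_gradient_def)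
  define \<phi> where "\<phi> i x = \<psi> a x * x $ i" for i and x :: "real^'n"
  have sm: "smooth_on UNIV (\<phi> i)" for i
    unfolding \<phi>_def by (intro smooth_on_mult \<psi>_smooth a smooth_on_linear bounded_linear_vec_nth) auto
  have supp: "x \<in> sector c d" if "\<phi> i x \<noteq> 0" for i x
    using \<psi>_support[OF cd(3), where x=x] that by (auto simp: \<phi>_def)
  have \<phi>t: "\<phi> i \<in> test_functions \<Omega>" for i
    by (rule test_functionsI[OF sm compact_sector sector_subset[OF cd(2)] supp])
  define D where "D x = frechet_derivative (\<psi> a) (at x)" for x
  have dD: "(\<psi> a has_derivative D x) (at x)" for x
    using smooth_on_differentiable[OF \<psi>_smooth[OF a(1)]] by (simp add: D_def frechet_derivative_works[symmetric])
  have gr: "grad (\<phi> i) x $ i = \<psi> a x + D x (axis i 1) * x $ i" for i x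
  proof -
    have "(\<phi> i has_derivative (\<lambda>h. \<psi> a x * h $ i + D x h * x $ i)) (at x)"
      unfolding \<phi>_def by (intro has_derivative_mult dD bounded_linear_imp_has_derivative bounded_linear_vec_nth)
    then have "frechet_derivative (\<phi> i) (at x) = (\<lambda>h. \<psi> a x * h $ i + D x h * x $ i)"
      by (simp add: frechet_derivative_at[symmetric])
    then show ?thesis by (simp add: grad_def axis_def)
  qed
  have Dx: "D x x = (\<Sum>i\<in>UNIV. D x (axis i 1) * x $ i)" for x
  proof -
    have lin: "linear (D x)" using dD[of x] has_derivative_linear by blast
    have "D x x = D x (\<Sum>i\<in>UNIV. x $ i *\<^sub>R axis i 1)"
      using basis_expansion[of x] by (simp add: scalar_mult_eq_scaleR)
    also have "\<dots> = (\<Sum>i\<in>UNIV. D x (axis i 1) * x $ i)"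
      unfolding linear_sum[OF lin] using linear_scale[OF lin] by (simp add: mult.commute)
    finally show ?thesis .
  qed
  have sum1: "(\<Sum>i\<in>UNIV. u x * grad (\<phi> i) x $ i) = u x * \<psi> (\<lambda>s. N * a s - a' s) x" for x
  proof -
    have "(\<Sum>i\<in>UNIV. u x * grad (\<phi> i) x $ i) = u x * (N * \<psi> a x + D x x)"
      by (simp add: N gr Dx sum.distrib sum_distrib_left algebra_simps)
    also have "D x x = - (b x * a' (nlog x))" unfolding D_def by (rule \<psi>_radial_derivative[OF a(1,3)])
    finally show ?thesis by (simp add: \<psi>_def algebra_simps)
  qed
  have sum2: "(\<Sum>i\<in>UNIV. g x $ i * \<phi> i x) = (g x \<bullet> x) * \<psi> a x" for x
    by (simp add: \<phi>_def inner_vec_def sum_distrib_left mult_ac)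
  have gradK: "grad (\<phi> i) x $ i = 0" if "x \<notin> sector c d" for i x
    using frechet_derivative_eq_0_outside[OF sm compact_sector supp that] by (simp add: grad_def)
  have gradc: "continuous_on UNIV (\<lambda>x. grad (\<phi> i) x $ i)" for i
    using smooth_on_continuous[OF smooth_on_frechet[OF sm, of i "axis i 1"]] by (simp add: grad_def)
  have i1: "set_integrable lebesgue \<Omega> (\<lambda>x. u x * grad (\<phi> i) x $ i)" for i
    by (rule L1_loc_mult_integrable[OF u gradc compact_sector sector_subset[OF cd(2)]]) (use gradK in blast)
  have i2: "set_integrable lebesgue \<Omega> (\<lambda>x. g x $ i * \<phi> i x)" for i
    by (rule L1_loc_mult_integrable[OF L1_loc_component[OF g] smooth_on_continuous[OF sm] compact_sector sector_subset[OF cd(2)] supp])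
  have "(LINT x:\<Omega>|lebesgue. u x * \<psi> (\<lambda>s. N * a s - a' s) x) = (LINT x:\<Omega>|lebesgue. (\<Sum>i\<in>UNIV. u x * grad (\<phi> i) x $ i))"
    by (simp only: sum1)
  also have "\<dots> = (\<Sum>i\<in>UNIV. (LINT x:\<Omega>|lebesgue. u x * grad (\<phi> i) x $ i))"
    unfolding set_lebesgue_integral_def scaleR_sum_right
    by (rule Bochner_Integration.integral_sum) (use i1 in \<open>simp add: set_integrable_def\<close>)
  also have "\<dots> = (\<Sum>i\<in>UNIV. - (LINT x:\<Omega>|lebesgue. g x $ i * \<phi> i x))"
    using wg \<phi>t by (simp add: weak_gradient_def)
  also have "\<dots> = - (LINT x:\<Omega>|lebesgue. (\<Sum>i\<in>UNIV. g x $ i * \<phi> i x))"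
    unfolding set_lebesgue_integral_def scaleR_sum_right sum_negf
    by (subst Bochner_Integration.integral_sum) (use i2 in \<open>simp_all add: set_integrable_def\<close>)
  finally show ?thesis by (simp only: sum2)
qed

text \<open>Polar coordinates for a function that is almost everywhere a profile of
  \<open>nlog\<close>: integrals over compact sectors control the profile locally, and pairing with
  \<open>\<psi> k\<close> becomes pairing on the line with density
  \<open>cone_const b * e^(-N s)\<close>.\<close>

lemma radial_transfer:
  assumes f: "f \<in> L1_loc \<Omega>" and F[measurable]: "F \<in> borel_measurable borel"
    and fF: "AE x in lborel. x \<in> \<Omega> \<and> x \<noteq> 0 \<and> nlog x \<in> J \<longrightarrow> f x = F (nlog x)"
  shows "loc_integrable J F"
    and "k \<in> tests J \<Longrightarrow> (LINT x:\<Omega>|lebesgue. f x * \<psi> k x) = cone_const b * (LBINT s. F s * (exp (- (N * s)) * k s))"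
proof -
  show "loc_integrable J F"
    unfolding loc_integrable_def
  proof (intro allI impI)
    fix c d :: real assume cd: "{c..d} \<subseteq> J"
    let ?k = "\<lambda>s. indicator {c..d} s * F s"
    let ?h = "\<lambda>x. (indicator (sector c d) x * f x) * (b x * indicator {c..d} (nlog x))"
    have "integrable lebesgue ?h"
    proof (rule integrable_mult_bounded)
      show "integrable lebesgue (\<lambda>x. indicator (sector c d) x * f x)"
        using f compact_sector sector_subset[OF cd] by (simp add: L1_loc_def set_integrable_def)
      have "(\<lambda>x. b x * indicator {c..d} (nlog x)) \<in> borel_measurable lborel" by measurable
      then show "(\<lambda>x. b x * indicator {c..d} (nlog x)) \<in> borel_measurable lebesgue"
        by (rule measurable_completion)
      show "\<bar>b x * indicator {c..d} (nlog x)\<bar> \<le> 1" for x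
        using b_nonneg[of x] b_le[of x] by (simp add: indicator_def)
    qed
    moreover have "AE x in lborel. ?h x = b x * ?k (nlog x)"
      using fF
    proof eventually_elim
      case (elim x)
      show ?case
      proof (cases "b x \<noteq> 0 \<and> nlog x \<in> {c..d}")
        case True
        then have xK: "x \<in> sector c d" using in_sector by blast
        then have "x \<in> \<Omega>" "x \<noteq> 0" "nlog x \<in> J" using sector_subset[OF cd] sector_iff cd by blast+
        then show ?thesis using elim xK True by simp
      qed (auto simp: indicator_def)
    qed
    ultimately have "integrable lborel (\<lambda>x. b x * ?k (nlog x))"
      using integral_lebesgue_cong_AE(2)[of "\<lambda>x. b x * ?k (nlog x)" ?h] by simp
    then have i: "integrable lborel (\<lambda>s. cone_const b * exp (- (N * s)) * ?k s)"
      using nlog_integral_b(2)[of ?k] by simp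
    \<comment> \<open>The density is bounded away from \<open>0\<close> on \<open>{c..d}\<close>, so
      a bounded factor removes it.\<close>
    have "integrable lborel (\<lambda>s. (cone_const b * exp (- (N * s)) * ?k s) * (indicator {c..d} s * exp (N * s) / cone_const b))"
    proof (rule integrable_mult_bounded[OF i])
      show "\<bar>indicator {c..d} s * exp (N * s) / cone_const b\<bar> \<le> exp (N * d) / cone_const b" for s
        using b_cone_const_pos by (auto simp: N indicator_def intro!: divide_right_mono mult_left_mono)
    qed simp
    also have "(\<lambda>s. (cone_const b * exp (- (N * s)) * ?k s) * (indicator {c..d} s * exp (N * s) / cone_const b)) = (\<lambda>s. indicator {c..d} s *\<^sub>R F s)"
      using b_cone_const_pos by (auto simp: indicator_def exp_minus)
    finally show "set_integrable lborel {c..d} F" by (simp add: set_integrable_def)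
  qed
  assume k: "k \<in> tests J"
  obtain c d where cd: "c < d" "{c..d} \<subseteq> J" "\<forall>s. s \<notin> {c<..<d} \<longrightarrow> k s = 0"
    using testsE[OF k] by blast
  have km[measurable]: "k \<in> borel_measurable borel" by (rule borel_measurable_continuous_onI[OF tests_continuous[OF k]])
  have "(LINT x:\<Omega>|lebesgue. f x * \<psi> k x) = (LBINT x. b x * (k (nlog x) * F (nlog x)))"
    unfolding set_lebesgue_integral_def
  proof (rule integral_lebesgue_cong_AE(1))
    show "AE x in lborel. indicator \<Omega> x *\<^sub>R (f x * \<psi> k x) = b x * (k (nlog x) * F (nlog x))"
      using fF
    proof eventually_elim
      case (elim x)
      show ?case
      proof (cases "\<psi> k x = 0")
        case True then show ?thesis by (auto simp: \<psi>_def)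
      next
        case False
        then have "x \<in> sector c d" using \<psi>_support[OF cd(3)] by blast
        then have "x \<in> \<Omega>" "x \<noteq> 0" "nlog x \<in> J" using sector_subset[OF cd(2)] sector_iff cd(2) by blast+
        then show ?thesis using elim by (simp add: \<psi>_def)
      qed
    qed
  qed measurable
  also have "\<dots> = cone_const b * (LBINT s. exp (- (N * s)) * (k s * F s))"
    by (rule nlog_integral_b(1)) measurable
  finally show "(LINT x:\<Omega>|lebesgue. f x * \<psi> k x) = cone_const b * (LBINT s. F s * (exp (- (N * s)) * k s))"
    by (simp add: mult_ac)
qed

text \<open>The profile \<open>w\<close> is an arbitrary function: its measurability is obtained by restricting a Borel version
  of \<open>u\<close> to a generic ray, which by Fubini misses the exceptional null set almost everywhere.\<close>

lemma radial_borel: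
  fixes u :: "real^'n \<Rightarrow> real"
  assumes um: "set_borel_measurable lebesgue \<Omega> u" and w: "AE x in lebesgue. x \<in> \<Omega> \<longrightarrow> u x = w (norm x)"
  shows "\<exists>F\<in>borel_measurable borel. AE x in lborel. x \<in> \<Omega> \<and> x \<noteq> 0 \<and> nlog x \<in> J \<longrightarrow> u x = F (nlog x)"
proof -
  obtain u' where u': "u' \<in> borel_measurable lborel" "AE x in lborel. indicator \<Omega> x *\<^sub>R u x = u' x"
    using completion_ex_borel_measurable_real[of "\<lambda>x. indicator \<Omega> x *\<^sub>R u x" lborel] um
    unfolding set_borel_measurable_def by blast
  have "AE x in lborel. x \<in> \<Omega> \<longrightarrow> u' x = w (norm x)"
    using u'(2) w[unfolded AE_completion_iff] by eventually_elim auto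
  from AE_E3[OF this] obtain Z where Z: "\<And>x. x \<in> space lborel - Z \<Longrightarrow> x \<in> \<Omega> \<longrightarrow> u' x = w (norm x)"
    "Z \<in> null_sets lborel" by metis
  \<comment> \<open>Where \<open>b > 0\<close>, the entire open ray through the point lies in
    \<open>Cn\<close>, hence in \<open>\<Omega>\<close> as long as \<open>nlog\<close> is in
    \<open>J\<close>.\<close>
  let ?U = "{x \<in> - {0}. b x \<in> {0<..}}"
  have opU: "open ?U"
    using continuous_open_preimage[OF smooth_on_continuous[OF b_smooth], of "{0<..}"]
    by (simp add: vimage_def Int_def open_Compl)
  obtain x0 where "0 < b x0" using b_pos by blast
  then have "x0 \<in> ?U" using b_0 by auto
  have "\<exists>x\<in>?U. AE s in lborel. exp (- s) *\<^sub>R x \<notin> Z"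
    by (rule AE_open_ex[OF opU _ AE_ray[OF Z(2)]]) (use \<open>x0 \<in> ?U\<close> in blast)
  then obtain x1 where x1: "x1 \<noteq> 0" "0 < b x1" "AE s in lborel. exp (- s) *\<^sub>R x1 \<notin> Z" by auto
  define e where "e = (1 / norm x1) *\<^sub>R x1"
  have ne: "norm e = 1" "e \<noteq> 0" using x1(1) by (auto simp: e_def)
  have be: "0 < b e" using x1 b_hom[of "1 / norm x1" x1] by (simp add: e_def)
  \<comment> \<open>Passing from \<open>x1\<close> to the unit vector \<open>e\<close> translates
    the parameter by \<open>nlog x1\<close>, which preserves null sets.\<close>
  have "AE s in lborel. exp (- (nlog x1 * (-1) + 1 * s)) *\<^sub>R x1 \<notin> Z"
  proof -
    have "AE s in density (distr lborel borel (\<lambda>s. nlog x1 * (-1) + 1 * s)) (\<lambda>_. ennreal (abs 1)). exp (- s) *\<^sub>R x1 \<notin> Z"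
      using x1(3) by (subst lborel_real_affine[symmetric]) auto
    then have "AE s in distr lborel borel (\<lambda>s. nlog x1 * (-1) + 1 * s). exp (- s) *\<^sub>R x1 \<notin> Z"
      by (subst (asm) AE_density) auto
    moreover have "(\<lambda>s. nlog x1 * (-1) + 1 * s) \<in> lborel \<rightarrow>\<^sub>M borel" by measurable
    moreover have "{s \<in> space borel. exp (- s) *\<^sub>R x1 \<notin> Z} \<in> sets borel"
    proof -
      have "(\<lambda>s::real. exp (- s) *\<^sub>R x1) \<in> borel \<rightarrow>\<^sub>M borel" by measurable
      moreover have "- Z \<in> sets borel" using Z(2) by auto
      ultimately have "(\<lambda>s::real. exp (- s) *\<^sub>R x1) -` (- Z) \<inter> space borel \<in> sets borel"
        by (rule measurable_sets)
      then show ?thesis by (simp add: vimage_def)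
    qed
    ultimately show ?thesis by (simp only: AE_distr_iff)
  qed
  moreover have "exp (- (nlog x1 * (-1) + 1 * s)) *\<^sub>R x1 = exp (- s) *\<^sub>R e" for s
  proof -
    have "exp (- (nlog x1 * (-1) + 1 * s)) = exp (- s) * exp (nlog x1)"
      by (simp add: exp_add[symmetric])
    also have "exp (nlog x1) = 1 / norm x1"
      using x1(1) by (simp add: nlog_def exp_minus inverse_eq_divide)
    finally show ?thesis by (simp add: e_def)
  qed
  ultimately have ray: "AE s in lborel. exp (- s) *\<^sub>R e \<notin> Z" by simp
  define F where "F s = u' (exp (- s) *\<^sub>R e)" for s
  have Fm: "F \<in> borel_measurable borel"
    unfolding F_def[abs_def] using u'(1) by measurable
  have "AE s in lborel. s \<in> J \<longrightarrow> F s = w (exp (- s))"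
    using ray
  proof eventually_elim
    case (elim s)
    show ?case
    proof
      assume s: "s \<in> J"
      have "b (exp (- s) *\<^sub>R e) = b e" by (rule b_hom) simp
      then have "exp (- s) *\<^sub>R e \<in> Cn" using be b_supp by simp
      moreover have "nlog (exp (- s) *\<^sub>R e) = s" using ne by (simp add: nlog_def)
      ultimately have "exp (- s) *\<^sub>R e \<in> \<Omega>" using Cn(2) s ne by simp
      then show "F s = w (exp (- s))" using elim Z(1)[of "exp (- s) *\<^sub>R e"] ne by (simp add: F_def)
    qed
  qed
  from AE_nlog[OF this]
  have "AE x in lborel. nlog (x::real^'n) \<in> J \<longrightarrow> F (nlog x) = w (exp (- nlog x))" .
  then have "AE x in lborel. x \<in> \<Omega> \<and> x \<noteq> 0 \<and> nlog x \<in> J \<longrightarrow> u x = F (nlog x)"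
    using w[unfolded AE_completion_iff] by eventually_elim (auto simp: exp_neg_nlog)
  then show ?thesis using Fm by blast
qed

text \<open>The equation is not involved, only the weak gradient. Tested with functions of
  \<open>nlog\<close>, it says that \<open>cone_const b * F\<close> and \<open>- H\<close>, with
  \<open>H\<close> a cumulative integral of the weighted radial component of \<open>g\<close>, have
  the same weak derivative. So they differ by a constant, and \<open>H\<close> is continuous because
  spheres are null sets.\<close>

lemma radial_continuous:
  assumes wg: "weak_gradient \<Omega> u g"
    and um: "set_borel_measurable lebesgue \<Omega> u" and w: "AE x in lebesgue. x \<in> \<Omega> \<longrightarrow> u x = w (norm x)"
  shows "\<exists>W\<in>borel_measurable borel. continuous_on J W \<and>
    (AE x in lborel. x \<in> \<Omega> \<and> x \<noteq> 0 \<and> nlog x \<in> J \<longrightarrow> u x = W (nlog x))"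
proof -
  have u: "u \<in> L1_loc \<Omega>" and g: "g \<in> L1_loc \<Omega>" using wg by (auto simp: weak_gradient_def)
  obtain F where F[measurable]: "F \<in> borel_measurable borel"
    and uF: "AE x in lborel. x \<in> \<Omega> \<and> x \<noteq> 0 \<and> nlog x \<in> J \<longrightarrow> u x = F (nlog x)"
    using radial_borel[OF um w] by blast
  note T = radial_transfer[OF u F uF]
  note smN = smooth_on_exp_mult[of N]
  have ident: "cone_const b * (LBINT s. F s * c' s) = (LINT x:\<Omega>|lebesgue. (g x \<bullet> x) * \<psi> (\<lambda>s. exp (N * s) * c s) x)"
    if c: "c \<in> tests J" "c' \<in> tests J" "\<And>s. (c has_real_derivative c' s) (at s)" for c c'
  proof -
    \<comment> \<open>The factor \<open>e^(N s)\<close> cancels the density and turns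
      \<open>N a - a'\<close> into \<open>- e^(N s) c'\<close>, so that just \<open>F c'\<close>
      remains.\<close>
    define a where "a s = exp (N * s) * c s" for s
    define a' where "a' s = exp (N * s) * (N * c s + c' s)" for s
    have a: "a \<in> tests J" unfolding a_def by (rule tests_mult[OF c(1) smN])
    have a': "a' \<in> tests J" unfolding a'_def
      by (intro tests_mult[OF _ smN] tests_add tests_mult c J smooth_on_const) auto
    have d: "(a has_real_derivative a' s) (at s)" for s
      unfolding a_def a'_def by (auto intro!: derivative_eq_intros c(3) simp: algebra_simps)
    define k where "k s = N * a s - a' s" for s
    have k_eq: "k s = (- exp (N * s)) * c' s" for s by (simp add: k_def a_def a'_def algebra_simps)
    have kt: "k \<in> tests J"
    proof -
      have "(\<lambda>s. - 1 * (exp (N * s) * c' s)) \<in> tests J"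
        by (intro tests_mult[OF tests_mult[OF c(2) smN] smooth_on_const]) auto
      then show ?thesis by (simp add: k_eq[abs_def])
    qed
    have "cone_const b * (LBINT s. F s * (exp (- (N * s)) * k s)) = - (LINT x:\<Omega>|lebesgue. (g x \<bullet> x) * \<psi> a x)"
      using radial_divergence_identity[OF wg a a' d] T(2)[OF kt] by (simp add: k_def[abs_def])
    moreover have "F s * (exp (- (N * s)) * k s) = - (F s * c' s)" for s
      by (simp add: k_eq exp_minus)
    ultimately show ?thesis by (simp add: a_def[abs_def])
  qed
  have "\<exists>B \<phi>. open B \<and> s0 \<in> B \<and> continuous_on B \<phi> \<and> (AE s in lborel. s \<in> B \<inter> J \<longrightarrow> F s = \<phi> s)" if s0: "s0 \<in> J" for s0
  proof -
    \<comment> \<open>The radial component of \<open>g\<close> is integrable only on compact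
      sectors, so \<open>H\<close> is formed on a small subinterval and the local versions are glued
      afterwards.\<close>
    obtain \<epsilon> where \<epsilon>: "\<epsilon> > 0" "cball s0 \<epsilon> \<subseteq> J" using J(1) s0 open_contains_cball by blast
    define l r where "l = s0 - \<epsilon>" and "r = s0 + \<epsilon>"
    have lr: "{l..r} \<subseteq> J" "l < s0" "s0 < r" using \<epsilon> by (simp_all add: l_def r_def cball_eq_atLeastAtMost)
    let ?J = "{l<..<r}"
    have subJ: "?J \<subseteq> J" using lr(1) by auto
    let ?\<theta> = "\<lambda>x. indicator (sector l r) x * (b x * exp (N * nlog x))"
    let ?h = "\<lambda>x. (indicator (sector l r) x * (g x \<bullet> x)) * ?\<theta> x"
    have "integrable lebesgue ?h"
    proof (rule integrable_mult_bounded)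
      show "integrable lebesgue (\<lambda>x. indicator (sector l r) x * (g x \<bullet> x))"
        using L1_loc_inner[OF g] compact_sector sector_subset[OF lr(1)] by (simp add: L1_loc_def set_integrable_def)
      have [measurable]: "sector l r \<in> sets borel" using compact_sector by (simp add: borel_compact)
      have "?\<theta> \<in> borel_measurable lborel" by measurable
      then show "?\<theta> \<in> borel_measurable lebesgue" by (rule measurable_completion)
      show "\<bar>?\<theta> x\<bar> \<le> exp (N * r)" for x
      proof (cases "x \<in> sector l r")
        case True
        then have "exp (N * nlog x) \<le> exp (N * r)" using sector_iff[of x l r] by (auto simp: N intro!: mult_left_mono)
        then have "b x * exp (N * nlog x) \<le> 1 * exp (N * r)"
          using b_le[of x] b_nonneg[of x] by (intro mult_mono) auto
        then show ?thesis using True b_nonneg[of x] by (simp add: abs_mult)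
      qed simp
    qed
    then obtain h where h: "h \<in> borel_measurable borel" "integrable lborel h" "AE x in lborel. ?h x = h x"
      using lebesgue_ex_borel by blast
    define H where "H s = (LBINT x. h x * indicator {..<s} (nlog x))" for s
    have Hc: "continuous_on UNIV H"
      unfolding H_def by (rule continuous_cdf[OF h(2) _ AE_nlog_neq]) simp
    have "\<exists>C. AE s in lborel. s \<in> ?J \<longrightarrow> cone_const b * F s + H s = C"
    proof (rule du_Bois_Reymond)
      show "open ?J" "is_interval ?J" "?J \<noteq> {}" using lr by (auto simp: is_interval_1)
      have lF: "loc_integrable ?J F" using T(1) subJ by (auto simp: loc_integrable_def)
      have "loc_integrable ?J (\<lambda>s. cone_const b * F s)"
        using lF by (auto simp: loc_integrable_def)
      moreover have lH: "loc_integrable ?J (\<lambda>s. - H s)"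
        using Hc by (intro loc_integrable_continuous continuous_intros continuous_on_subset[OF Hc]) auto
      ultimately have "loc_integrable ?J (\<lambda>s. cone_const b * F s - - H s)" by (rule loc_integrable_diff)
      then show "loc_integrable ?J (\<lambda>s. cone_const b * F s + H s)" by simp
      fix c c' assume c: "c \<in> tests ?J" "c' \<in> tests ?J" "\<And>s. (c has_real_derivative c' s) (at s)"
      have cJ: "c \<in> tests J" "c' \<in> tests J" using c(1,2) tests_mono[OF subJ] by auto
      obtain c1 c2 where c12: "{c1..c2} \<subseteq> ?J" "\<forall>s. s \<notin> {c1<..<c2} \<longrightarrow> c s = 0"
        using testsE[OF c(1)] by metis
      have c0: "c s = 0" if "s \<notin> {l..r}" for s
      proof -
        have "{c1<..<c2} \<subseteq> {l..r}" using c12(1) by (meson greaterThanLessThan_subseteq_atLeastAtMost_iff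
            greaterThanLessThan_subseteq_atLeastLessThan_iff order_trans atLeastAtMost_iff greaterThanLessThan_iff less_imp_le subsetD subsetI)
        then show ?thesis using c12(2) that by blast
      qed
      have "cone_const b * (LBINT s. F s * c' s) = (LBINT x. h x * c (nlog x))"
        unfolding ident[OF cJ c(3)] set_lebesgue_integral_def
      proof (rule integral_lebesgue_cong_AE(1))
        have [measurable]: "c \<in> borel_measurable borel" by (rule borel_measurable_continuous_onI[OF tests_continuous[OF c(1)]])
        show "(\<lambda>x. h x * c (nlog x)) \<in> borel_measurable borel" using h(1) by measurable
        show "AE x in lborel. indicator \<Omega> x *\<^sub>R ((g x \<bullet> x) * \<psi> (\<lambda>s. exp (N * s) * c s) x) = h x * c (nlog x)"
          using h(3)
        proof eventually_elim
          case (elim x)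
          show ?case
          proof (cases "x \<in> sector l r")
            case True
            then have "x \<in> \<Omega>" using sector_subset[OF lr(1)] by blast
            then show ?thesis using True elim[symmetric] by (simp add: \<psi>_def)
          next
            case False
            have "b x = 0 \<or> c (nlog x) = 0" using in_sector[of x l r] c0[of "nlog x"] False by blast
            then show ?thesis using False elim[symmetric] by (auto simp: \<psi>_def)
          qed
        qed
      qed
      also have "\<dots> = - (LBINT s. H s * c' s)"
        unfolding H_def by (rule integral_compose_eq_cdf[OF h(1,2) _ c]) simp
      finally have "cone_const b * (LBINT s. F s * c' s) + (LBINT s. H s * c' s) = 0" by simp
      moreover have "integrable lborel (\<lambda>s. F s * c' s)" by (rule loc_integrable_tests[OF lF c(2)])
      moreover have "integrable lborel (\<lambda>s. H s * c' s)"
        by (rule loc_integrable_tests[OF loc_integrable_continuous[OF continuous_on_subset[OF Hc]] c(2)]) simp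
      ultimately show "(LBINT s. (cone_const b * F s + H s) * c' s) = 0"
        by (simp add: distrib_right mult.assoc)
    qed
    then obtain C where C: "AE s in lborel. s \<in> ?J \<longrightarrow> cone_const b * F s + H s = C" by blast
    have "AE s in lborel. s \<in> ?J \<inter> J \<longrightarrow> F s = (C - H s) / cone_const b"
      using C by eventually_elim (use b_cone_const_pos in \<open>auto simp: field_simps\<close>)
    moreover have "continuous_on ?J (\<lambda>s. (C - H s) / cone_const b)"
      using b_cone_const_pos by (intro continuous_intros continuous_on_subset[OF Hc]) auto
    ultimately show ?thesis using lr by (intro exI[of _ ?J] exI[of _ "\<lambda>s. (C - H s) / cone_const b"]) auto
  qed
  then obtain W where W: "continuous_on J W" "AE s in lborel. s \<in> J \<longrightarrow> F s = W s"
    using AE_eq_continuous_glue[OF J(1), of F] by blast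
  \<comment> \<open>Extension by \<open>0\<close> makes the profile Borel on the whole line without
    changing it on \<open>J\<close>.\<close>
  let ?W = "\<lambda>s. indicator J s *\<^sub>R W s"
  have "?W \<in> borel_measurable borel"
    by (rule borel_measurable_continuous_on_indicator[OF _ W(1)]) (use J in auto)
  moreover have "continuous_on J ?W"
    using W(1) by (rule continuous_on_eq) simp
  moreover have "AE x in lborel. x \<in> \<Omega> \<and> x \<noteq> 0 \<and> nlog x \<in> J \<longrightarrow> u x = ?W (nlog x)"
    using uF AE_nlog[OF W(2)] by eventually_elim simp
  ultimately show ?thesis by blast
qed

end

section \<open>Radial weak solutions\<close>

lemma continuous_on_nlog: "continuous_on (-{0}) (nlog :: 'a::euclidean_space \<Rightarrow> real)"
  unfolding nlog_def[abs_def] by (auto intro!: continuous_intros)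

lemma open_nlog_vimage:
  assumes "open J"
  shows "open {x::'a::euclidean_space. x \<noteq> 0 \<and> nlog x \<in> J}"
  using continuous_open_preimage[OF continuous_on_nlog _ assms] by (simp add: open_Compl vimage_def Int_def)

text \<open>With \<open>b = 1\<close> off the origin the test function is radial and its gradient at
  \<open>x\<close> is \<open>- a' |x|^(-2) x\<close>, so the equation sees \<open>g\<close> only
  through \<open>g x \<bullet> x\<close>; the divergence identity converts this into a term in the
  profile. An angular cutoff would bring in the tangential part of \<open>g\<close>, about which
  nothing is known.\<close>

lemma (in cone) radial_weak_equation:
  assumes b1: "\<And>x. x \<noteq> 0 \<Longrightarrow> b x = 1" and ws: "weak_solution \<Omega> \<mu> p q u"
    and W[measurable]: "W \<in> borel_measurable borel" and Wc: "continuous_on J W"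
    and uW: "AE x in lborel. x \<in> \<Omega> \<and> x \<noteq> 0 \<and> nlog x \<in> J \<longrightarrow> u x = W (nlog x)"
    and a: "a \<in> tests J" "a' \<in> tests J" "a'' \<in> tests J"
      "\<And>s. (a has_real_derivative a' s) (at s)" "\<And>s. (a' has_real_derivative a'' s) (at s)"
  shows "(LBINT s. W s * (exp (- (N - 2) * s) * (a'' s - (N - 2) * a' s))) =
    - (LBINT s. (exp (- (N - 2) * s) * (\<mu> * W s) + exp (- (N * s)) * (W s powr p - W s powr q)) * a s)"
proof -
  obtain g where wg: "weak_gradient \<Omega> u g" and
    eq: "\<And>\<phi>. \<phi> \<in> test_functions \<Omega> \<Longrightarrow> (LINT x:\<Omega>|lebesgue. g x \<bullet> grad \<phi> x)
            - \<mu> * (LINT x:\<Omega>|lebesgue. u x / (norm x)\<^sup>2 * \<phi> x)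
          = (LINT x:\<Omega>|lebesgue. (u x powr p - u x powr q) * \<phi> x)"
    using ws unfolding weak_solution_def by blast
  have L: "u \<in> L1_loc \<Omega>" "(\<lambda>x. u x / (norm x)\<^sup>2) \<in> L1_loc \<Omega>" "(\<lambda>x. u x powr p) \<in> L1_loc \<Omega>" "(\<lambda>x. u x powr q) \<in> L1_loc \<Omega>"
    using wg ws by (auto simp: weak_gradient_def weak_solution_def)
  obtain c d where cd: "c < d" "{c..d} \<subseteq> J" "\<forall>s. s \<notin> {c<..<d} \<longrightarrow> a s = 0"
    using testsE[OF a(1)] by metis
  have \<psi>t: "\<psi> a \<in> test_functions \<Omega>"
    by (rule test_functionsI[OF \<psi>_smooth[OF a(1)] compact_sector sector_subset[OF cd(2)] \<psi>_support[OF cd(3)]])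
  \<comment> \<open>The factor \<open>e^(2 s)\<close> is the \<open>|x|^(-2)\<close> in the gradient
    of \<open>nlog\<close>.\<close>
  define a1 where "a1 s = exp (2 * s) * a' s" for s
  define a1' where "a1' s = exp (2 * s) * (2 * a' s + a'' s)" for s
  note sm = smooth_on_exp_mult[of 2]
  have a1: "a1 \<in> tests J" unfolding a1_def by (rule tests_mult[OF a(2) sm])
  have a1': "a1' \<in> tests J" unfolding a1'_def
    by (intro tests_mult[OF _ sm] tests_add tests_mult a J smooth_on_const) auto
  have da1: "(a1 has_real_derivative a1' s) (at s)" for s
    unfolding a1_def a1'_def by (auto intro!: derivative_eq_intros a(5) simp: algebra_simps)
  have gr: "g x \<bullet> grad (\<psi> a) x = - ((g x \<bullet> x) * \<psi> a1 x)" for x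
  proof (cases "x = 0")
    case True
    have "x \<notin> sector c d" using True by (simp add: sector_iff)
    from frechet_derivative_eq_0_outside[OF \<psi>_smooth[OF a(1)] compact_sector \<psi>_support[OF cd(3)] this]
    have "frechet_derivative (\<psi> a) (at x) = (\<lambda>h. 0)" .
    then have "grad (\<psi> a) x = 0" by (simp add: grad_def vec_eq_iff)
    then show ?thesis using True by simp
  next
    case False
    have "((\<lambda>x. a (nlog x)) has_derivative (\<lambda>h. a' (nlog x) * (- (inverse (norm x) * (sgn x \<bullet> h))))) (at x)"
    proof -
      have n: "(nlog has_derivative (\<lambda>h. - (inverse (norm x) * (sgn x \<bullet> h)))) (at x)"
        unfolding nlog_def[abs_def] using False
        by (auto intro!: derivative_eq_intros has_derivative_norm simp: inner_commute divide_inverse mult.commute)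
      show ?thesis
        using has_derivative_compose[OF n, of a "\<lambda>h. a' (nlog x) * h"] a(4)[of "nlog x"]
        by (simp add: has_field_derivative_def)
    qed
    then have "(\<psi> a has_derivative (\<lambda>h. a' (nlog x) * (- (inverse (norm x) * (sgn x \<bullet> h))))) (at x)"
      by (rule has_derivative_transform_within_open[of _ _ _ _ "-{0}"])
        (use False in \<open>auto simp: \<psi>_def b1 open_Compl\<close>)
    then have "frechet_derivative (\<psi> a) (at x) = (\<lambda>h. a' (nlog x) * (- (inverse (norm x) * (sgn x \<bullet> h))))"
      by (simp add: frechet_derivative_at[symmetric])
    then have "grad (\<psi> a) x = (- a' (nlog x) * (inverse (norm x))\<^sup>2) *\<^sub>R x"
      by (simp add: grad_def vec_eq_iff inner_axis sgn_div_norm power2_eq_square divide_inverse mult_ac)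
    also have "(inverse (norm x))\<^sup>2 = exp (2 * nlog x)"
      using exp_double_nlog[OF False] ..
    finally have G: "grad (\<psi> a) x = (- a' (nlog x) * exp (2 * nlog x)) *\<^sub>R x" .
    show ?thesis unfolding G using False by (simp add: \<psi>_def b1 a1_def mult_ac)
  qed
  let ?I = "\<lambda>F k. cone_const b * (LBINT s. F s * (exp (- (N * s)) * k s))"
  have k: "(\<lambda>s. N * a1 s - a1' s) \<in> tests J"
  proof -
    have "(\<lambda>s. N * a1 s + (- 1) * a1' s) \<in> tests J"
      by (intro tests_add tests_mult a1 a1' J smooth_on_const) auto
    then show ?thesis by simp
  qed
  have T1: "(LINT x:\<Omega>|lebesgue. g x \<bullet> grad (\<psi> a) x) = ?I W (\<lambda>s. N * a1 s - a1' s)"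
    using radial_divergence_identity[OF wg a1 a1' da1] radial_transfer(2)[OF L(1) W uW k]
    by (simp add: gr set_lebesgue_integral_def)
  have "AE x in lborel. x \<in> \<Omega> \<and> x \<noteq> 0 \<and> nlog x \<in> J \<longrightarrow> u x / (norm x)\<^sup>2 = exp (2 * nlog x) * W (nlog x)"
    using uW
    by eventually_elim (auto simp: exp_double_nlog divide_inverse power_inverse)
  from radial_transfer(2)[OF L(2) _ this a(1)]
  have T2: "(LINT x:\<Omega>|lebesgue. u x / (norm x)\<^sup>2 * \<psi> a x) = ?I (\<lambda>s. exp (2 * s) * W s) a" by simp
  have "AE x in lborel. x \<in> \<Omega> \<and> x \<noteq> 0 \<and> nlog x \<in> J \<longrightarrow> u x powr r = W (nlog x) powr r" for r
    using uW by eventually_elim simp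
  note T3 = radial_transfer(2)[OF L(3) _ this a(1)] radial_transfer(2)[OF L(4) _ this a(1)]
  have "(LINT x:\<Omega>|lebesgue. (u x powr p - u x powr q) * \<psi> a x) =
      (LINT x:\<Omega>|lebesgue. u x powr p * \<psi> a x) - (LINT x:\<Omega>|lebesgue. u x powr q * \<psi> a x)"
    unfolding left_diff_distrib
    by (rule set_integral_diff(2)) (rule integrable_\<psi>[OF L(3) a(1)] integrable_\<psi>[OF L(4) a(1)])+
  with eq[OF \<psi>t] T1 T2 T3 have "?I W (\<lambda>s. N * a1 s - a1' s) - \<mu> * ?I (\<lambda>s. exp (2 * s) * W s) a =
      ?I (\<lambda>s. W s powr p) a - ?I (\<lambda>s. W s powr q) a"
    by simp
  then have "cone_const b * ((LBINT s. W s * (exp (- (N * s)) * (N * a1 s - a1' s)))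
      - \<mu> * (LBINT s. exp (2 * s) * W s * (exp (- (N * s)) * a s))) =
    cone_const b * ((LBINT s. W s powr p * (exp (- (N * s)) * a s)) - (LBINT s. W s powr q * (exp (- (N * s)) * a s)))"
    by (simp add: algebra_simps)
  then have E: "(LBINT s. W s * (exp (- (N * s)) * (N * a1 s - a1' s)))
      - \<mu> * (LBINT s. exp (2 * s) * W s * (exp (- (N * s)) * a s)) =
     (LBINT s. W s powr p * (exp (- (N * s)) * a s)) - (LBINT s. W s powr q * (exp (- (N * s)) * a s))"
    using b_cone_const_pos by simp
  have smN: "smooth_on UNIV (\<lambda>s. exp (- (N * s)))"
    using smooth_on_exp_mult[of "- N"] by simp
  have t: "(\<lambda>s. exp (- (N * s)) * a s) \<in> tests J" by (rule tests_mult[OF a(1) smN])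
  have "AE x in lborel. x \<in> \<Omega> \<and> x \<noteq> 0 \<and> nlog x \<in> J \<longrightarrow> u x powr r = W (nlog x) powr r" for r
    using uW by eventually_elim simp
  note li = loc_integrable_tests[OF radial_transfer(1)[OF L(3) _ this] t]
    loc_integrable_tests[OF radial_transfer(1)[OF L(4) _ this] t]
  have i2: "integrable lborel (\<lambda>s. exp (2 * s) * W s * (exp (- (N * s)) * a s))"
    by (rule loc_integrable_tests[OF loc_integrable_continuous t]) (intro continuous_intros Wc)
  have c1: "W s * (exp (- (N * s)) * (N * a1 s - a1' s)) = - (W s * (exp (- (N - 2) * s) * (a'' s - (N - 2) * a' s)))" for s
  proof -
    have "exp (- (N - 2) * s) = exp (- (N * s)) * exp (2 * s)"
      by (simp add: exp_add[symmetric] algebra_simps)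
    then show ?thesis by (simp add: a1_def a1'_def algebra_simps)
  qed
  have c2: "(exp (- (N - 2) * s) * (\<mu> * W s) + exp (- (N * s)) * (W s powr p - W s powr q)) * a s =
     \<mu> * (exp (2 * s) * W s * (exp (- (N * s)) * a s)) +
     (W s powr p * (exp (- (N * s)) * a s) - W s powr q * (exp (- (N * s)) * a s))" for s
  proof -
    have "exp (- (N - 2) * s) = exp (- (N * s)) * exp (2 * s)"
      by (simp add: exp_add[symmetric] algebra_simps)
    then show ?thesis by (simp add: algebra_simps)
  qed
  have i3: "integrable lborel (\<lambda>s. W s powr p * (exp (- (N * s)) * a s))"
    and i4: "integrable lborel (\<lambda>s. W s powr q * (exp (- (N * s)) * a s))"
    using li by simp_all
  show ?thesis
    unfolding c2 using E i2 i3 i4 by (simp add: c1)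
qed

text \<open>The whole punctured ball lies in \<open>\<Omega>\<close>, so no angular cutoff is needed
  and the equation can be tested radially. Positivity of \<open>u\<close> almost everywhere gives
  just \<open>W \<ge> 0\<close> with positive values arbitrarily close to the right of each point;
  strict positivity awaits the differential equation.\<close>

lemma radial_weak_solution_C2:
  fixes \<Omega> :: "(real^'n) set"
  assumes \<Omega>: "open \<Omega>" and \<rho>: "0 < \<rho>" "ball 0 \<rho> \<subseteq> \<Omega>" and N: "N = real CARD('n)"
    and um: "set_borel_measurable lebesgue \<Omega> u" and rad: "radial_on \<Omega> u"
    and pos: "AE x in lebesgue. x \<in> \<Omega> \<longrightarrow> 0 < u x"
    and ws: "weak_solution \<Omega> \<mu> p q u" and pq: "0 < p" "0 < q"
  shows "\<exists>W D. (\<forall>s > - ln \<rho>. (W has_real_derivative D s) (at s)) \<and>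
    (\<forall>s > - ln \<rho>. (D has_real_derivative
      (N - 2) * D s - \<mu> * W s - exp (- (2 * s)) * (W s powr p - W s powr q)) (at s)) \<and>
    (\<forall>s > - ln \<rho>. 0 \<le> W s \<and> (\<forall>e>0. \<exists>t\<in>{s<..<s + e}. 0 < W t)) \<and>
    (AE x in lborel. x \<in> ball 0 \<rho> - {0} \<longrightarrow> u x = W (nlog x))"
proof -
  define J where "J = {- ln \<rho><..}"
  define b where "b x = (if x = 0 then 0 else 1 :: real)" for x :: "real^'n"
  have J: "open J" "is_interval J" "J \<noteq> {}" by (auto simp: J_def is_interval_1)
  have Jball: "nlog x \<in> J \<longleftrightarrow> x \<in> ball 0 \<rho>" if "x \<noteq> 0" for x :: "real^'n"
    using less_nlog_iff[OF that, of "- ln \<rho>"] \<rho>(1) by (simp add: J_def)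
  obtain g where wg: "weak_gradient \<Omega> u g" using ws unfolding weak_solution_def by blast
  obtain w where w: "AE x in lebesgue. x \<in> \<Omega> \<longrightarrow> u x = w (norm x)" using rad unfolding radial_on_def by blast
  interpret cone \<Omega> UNIV J b N
  proof
    show "smooth_on (- {0}) b"
      by (rule smooth_on_cong[OF _ _ smooth_on_const[of _ 1]]) (auto simp: b_def)
    show "x \<in> \<Omega>" if "x \<noteq> 0" "nlog x \<in> J" for x using that Jball \<rho>(2) by blast
    show "\<exists>x. 0 < b x" by (rule exI[of _ "axis undefined 1"]) (simp add: b_def axis_eq_0_iff)
  qed (use N J \<Omega> in \<open>auto simp: b_def\<close>)
  obtain W where Wm: "W \<in> borel_measurable borel" and Wc: "continuous_on J W"
    and uW: "AE x in lborel. x \<in> \<Omega> \<and> x \<noteq> 0 \<and> nlog x \<in> J \<longrightarrow> u x = W (nlog x)"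
    using radial_continuous[OF wg um w] by blast
  \<comment> \<open>A nonempty open shell has positive measure, so it contains a point where all the
    almost-everywhere statements hold.\<close>
  have Wex: "\<exists>s\<in>V. 0 < W s" if V: "open V" "V \<noteq> {}" "V \<subseteq> J" for V
  proof -
    let ?U = "{x::real^'n. x \<noteq> 0 \<and> nlog x \<in> V}"
    obtain s where s: "s \<in> V" using V(2) by blast
    have "nlog (exp (- s) *\<^sub>R (axis undefined 1 :: real^'n)) = s" by (simp add: nlog_def)
    then have "exp (- s) *\<^sub>R (axis undefined 1 :: real^'n) \<in> ?U" using s by (simp add: axis_eq_0_iff)
    then have "?U \<noteq> {}" by blast
    moreover have "AE x in lborel. x \<in> \<Omega> \<longrightarrow> 0 < u x \<and> (x \<noteq> 0 \<and> nlog x \<in> J \<longrightarrow> u x = W (nlog x))"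
      using uW pos[unfolded AE_completion_iff] by eventually_elim blast
    ultimately obtain x where x: "x \<in> ?U" "x \<in> \<Omega> \<longrightarrow> 0 < u x \<and> (x \<noteq> 0 \<and> nlog x \<in> J \<longrightarrow> u x = W (nlog x))"
      using AE_open_ex[OF open_nlog_vimage[OF V(1)]] by blast
    then have "x \<noteq> 0" "nlog x \<in> J" "nlog x \<in> V" using V(3) by auto
    moreover from this have "x \<in> \<Omega>" using Jball \<rho>(2) by blast
    ultimately show ?thesis using x(2) by metis
  qed
  have Wnn: "0 \<le> W s" if s: "s \<in> J" for s
  proof (rule ccontr)
    assume "\<not> 0 \<le> W s"
    then have ne: "{t \<in> J. W t \<in> {..<0}} \<noteq> {}" using s by auto
    have "open {t \<in> J. W t \<in> {..<0}}"
      using continuous_open_preimage[OF Wc J(1), of "{..<0}"] by (simp add: vimage_def Int_def)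
    from Wex[OF this ne] show False by auto
  qed
  have Wpow: "continuous_on J (\<lambda>s. W s powr r)" if "0 < r" for r
    by (rule continuous_on_powr'[OF Wc continuous_on_const]) (use that Wnn in auto)
  define F where "F s = exp (- (N - 2) * s) * (\<mu> * W s) + exp (- (N * s)) * (W s powr p - W s powr q)" for s
  have Fc: "continuous_on J F"
    unfolding F_def by (intro continuous_intros Wc Wpow pq)
  have weak: "(LBINT s. W s * (exp (- (N - 2) * s) * (a'' s - (N - 2) * a' s))) = - (LBINT s. F s * a s)"
    if "a \<in> tests J" "a' \<in> tests J" "a'' \<in> tests J"
      "\<And>s. (a has_real_derivative a' s) (at s)" "\<And>s. (a' has_real_derivative a'' s) (at s)" for a a' a''
    unfolding F_def
    by (rule radial_weak_equation[OF _ ws Wm Wc uW that]) (simp add: b_def)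
  have "\<exists>D. (\<forall>s\<in>J. (W has_real_derivative D s) (at s)) \<and>
      (\<forall>s\<in>J. ((\<lambda>s. exp (- (N - 2) * s) * D s) has_real_derivative - F s) (at s))"
    by (rule weak_second_order_C2[OF J Wc Fc weak])
  then obtain D where D: "\<And>s. s \<in> J \<Longrightarrow> (W has_real_derivative D s) (at s)"
    "\<And>s. s \<in> J \<Longrightarrow> ((\<lambda>s. exp (- (N - 2) * s) * D s) has_real_derivative - F s) (at s)"
    by blast
  have D': "(D has_real_derivative (N - 2) * D s - \<mu> * W s - exp (- (2 * s)) * (W s powr p - W s powr q)) (at s)"
    if s: "s \<in> J" for s
  proof -
    \<comment> \<open>Multiplication by \<open>e^((N - 2) s)\<close> undoes the divergence form and
      exhibits \<open>D\<close> itself as differentiable.\<close>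
    have "((\<lambda>s. exp ((N - 2) * s) * (exp (- (N - 2) * s) * D s)) has_real_derivative
        exp ((N - 2) * s) * (- F s) + ((N - 2) * exp ((N - 2) * s)) * (exp (- (N - 2) * s) * D s)) (at s)"
      by (rule DERIV_mult'[OF _ D(2)[OF s]]) (auto intro!: derivative_eq_intros)
    also have "(\<lambda>s. exp ((N - 2) * s) * (exp (- (N - 2) * s) * D s)) = D"
    proof
      fix s
      have "exp ((N - 2) * s) * exp (- (N - 2) * s) = exp ((N - 2) * s + - (N - 2) * s)" by (rule exp_add[symmetric])
      also have "(N - 2) * s + - (N - 2) * s = 0" by algebra
      finally show "exp ((N - 2) * s) * (exp (- (N - 2) * s) * D s) = D s" by (simp add: mult.assoc[symmetric])
    qed
    also have "exp ((N - 2) * s) * (- F s) + ((N - 2) * exp ((N - 2) * s)) * (exp (- (N - 2) * s) * D s) =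
        (N - 2) * D s - \<mu> * W s - exp (- (2 * s)) * (W s powr p - W s powr q)"
    proof -
      have "exp ((N - 2) * s) * exp (- (N - 2) * s) = exp ((N - 2) * s + - (N - 2) * s)" by (rule exp_add[symmetric])
      also have "(N - 2) * s + - (N - 2) * s = 0" by algebra
      finally have 1: "exp ((N - 2) * s) * exp (- (N - 2) * s) = 1" by simp
      have 2: "exp ((N - 2) * s) * exp (- (N * s)) = exp (- (2 * s))"
        by (simp add: exp_add[symmetric] algebra_simps)
      have "exp ((N - 2) * s) * (- F s) = - ((exp ((N - 2) * s) * exp (- (N - 2) * s)) * (\<mu> * W s))
          - (exp ((N - 2) * s) * exp (- (N * s))) * (W s powr p - W s powr q)"
        unfolding F_def by algebra
      moreover have "((N - 2) * exp ((N - 2) * s)) * (exp (- (N - 2) * s) * D s) =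
          (exp ((N - 2) * s) * exp (- (N - 2) * s)) * ((N - 2) * D s)" by algebra
      ultimately show ?thesis unfolding 1 2 by simp
    qed
    finally show ?thesis .
  qed
  have uW': "AE x in lborel. x \<in> ball 0 \<rho> - {0} \<longrightarrow> u x = W (nlog x)"
    using uW by eventually_elim (use Jball \<rho>(2) in blast)
  have Wex': "\<exists>t\<in>{s<..<s + e}. 0 < W t" if "- ln \<rho> < s" "0 < e" for s e
    by (rule Wex) (use that in \<open>auto simp: J_def\<close>)
  show ?thesis
    by (rule exI[of _ W], rule exI[of _ D]) (use D(1) D' Wnn Wex' uW' in \<open>simp add: J_def\<close>)
qed

text \<open>The shell through \<open>x0\<close> may leave \<open>\<Omega>\<close>, so the test
  functions are confined to a narrow cone around \<open>x0\<close>. The cone is used only to obtain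
  a continuous profile; radiality then gives \<open>u x = W (nlog x)\<close> on all of
  \<open>\<Omega>\<close> within the shell.\<close>

lemma radial_continuous_near:
  fixes \<Omega> :: "(real^'n) set"
  assumes \<Omega>: "open \<Omega>" and x0: "x0 \<in> \<Omega>" "x0 \<noteq> 0"
    and wg: "weak_gradient \<Omega> u g" and um: "set_borel_measurable lebesgue \<Omega> u" and rad: "radial_on \<Omega> u"
  shows "\<exists>B \<phi>. open B \<and> x0 \<in> B \<and> continuous_on B \<phi> \<and> (AE x in lborel. x \<in> B \<inter> (\<Omega> - {0}) \<longrightarrow> u x = \<phi> x)"
proof -
  obtain w where w: "AE x in lebesgue. x \<in> \<Omega> \<longrightarrow> u x = w (norm x)" using rad unfolding radial_on_def by blast
  obtain \<delta> where \<delta>: "0 < \<delta>" "ball x0 \<delta> \<subseteq> \<Omega>" using \<Omega> x0(1) open_contains_ball by blast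
  define r where "r = norm x0"
  have r: "0 < r" using x0(2) by (simp add: r_def)
  define e where "e = (1 / r) *\<^sub>R x0"
  have e: "norm e = 1" "e \<noteq> 0" "x0 = r *\<^sub>R e" using r x0(2) by (auto simp: e_def r_def)
  \<comment> \<open>\<open>\<eta> \<le> r / 2\<close> keeps \<open>norm x \<le> 2 * r\<close> in the
    shell, and \<open>\<eta> \<le> \<delta> / 2\<close> bounds the radial deviation from
    \<open>x0\<close>.\<close>
  define \<eta> where "\<eta> = min (r / 2) (\<delta> / 2)"
  have \<eta>: "0 < \<eta>" "\<eta> \<le> r / 2" "\<eta> \<le> \<delta> / 2" using r \<delta> by (auto simp: \<eta>_def)
  \<comment> \<open>In the cone \<open>|x - x0|^2 \<le> (|x| - r)^2 + 2 r \<kappa> |x|\<close>. With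
    \<open>|x| \<le> 2 r\<close> this \<open>\<kappa>\<close> makes each summand at most
    \<open>\<delta>^2 / 4\<close>, so the truncated cone lies in the ball of radius
    \<open>\<delta>\<close>.\<close>
  define \<kappa> where "\<kappa> = min (1 / 2) (\<delta>\<^sup>2 / (16 * r\<^sup>2))"
  have \<kappa>: "0 < \<kappa>" "\<kappa> < 1" using r \<delta> by (auto simp: \<kappa>_def)
  have \<kappa>r: "4 * r\<^sup>2 * \<kappa> \<le> \<delta>\<^sup>2 / 4"
  proof -
    have "\<kappa> \<le> \<delta>\<^sup>2 / (16 * r\<^sup>2)" by (simp add: \<kappa>_def)
    then show ?thesis using r by (simp add: field_simps)
  qed
  define J where "J = {- ln (r + \<eta>)<..<- ln (r - \<eta>)}"
  have rJ: "- ln r \<in> J" using r \<eta> by (simp add: J_def)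
  have J: "open J" "is_interval J" "J \<noteq> {}" using rJ by (auto simp: J_def is_interval_1)
  have nJ: "nlog x \<in> J \<longleftrightarrow> r - \<eta> < norm x \<and> norm x < r + \<eta>" if "x \<noteq> 0" for x :: "real^'n"
    using less_nlog_iff[OF that, of "- ln (r + \<eta>)"] nlog_less_iff[OF that, of "- ln (r - \<eta>)"] r \<eta>
    by (auto simp: J_def)
  define Cn where "Cn = {x. (1 - \<kappa>) * norm x \<le> x \<bullet> e}"
  \<comment> \<open>A cutoff in the cosine of the angle to \<open>e\<close>.\<close>
  define b where "b x = (if x = 0 then 0 else bump (x \<bullet> e / norm x - (1 - \<kappa>)))" for x
  interpret cone \<Omega> Cn J b "real CARD('n)"
  proof
    show "smooth_on (- {0}) b"
    proof -
      have 1: "smooth_on (-{0}) (\<lambda>x::real^'n. exp (nlog x))"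
        by (rule smooth_on_compose[OF _ open_UNIV _ smooth_on_exp])
          (use smooth_on_neg_ln_norm[where 'a="real^'n"] in \<open>auto simp: nlog_def[abs_def]\<close>)
      have 2: "smooth_on (-{0}) (\<lambda>x. x \<bullet> e)"
        by (rule smooth_on_linear) (auto intro: bounded_linear_inner_left)
      have "smooth_on (-{0}) (\<lambda>x. (x \<bullet> e) * exp (nlog x) + (- (1 - \<kappa>)))"
        by (rule smooth_on_add[OF _ smooth_on_mult[OF _ 2 1] smooth_on_const]) auto
      then have "smooth_on (-{0}) (\<lambda>x. bump ((x \<bullet> e) * exp (nlog x) + (- (1 - \<kappa>))))"
        by (intro smooth_on_compose[OF _ open_UNIV subset_UNIV smooth_bump_poly]) (simp_all add: open_Compl)
      moreover have "bump ((x \<bullet> e) * exp (nlog x) + (- (1 - \<kappa>))) = b x" if "x \<in> -{0}" for x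
        using that by (simp add: b_def nlog_def exp_minus divide_inverse algebra_simps)
      ultimately show ?thesis
        by (intro smooth_on_cong[of "-{0}" "\<lambda>x. bump ((x \<bullet> e) * exp (nlog x) + (- (1 - \<kappa>)))" b])
          (simp_all add: open_Compl)
    qed
    show "b (c *\<^sub>R x) = b x" if "0 < c" for c x using that by (simp add: b_def)
    show "x \<in> Cn" if "b x \<noteq> 0" for x
    proof -
      have x: "x \<noteq> 0" using that by (auto simp: b_def)
      then have "bump (x \<bullet> e / norm x - (1 - \<kappa>)) \<noteq> 0" using that by (simp add: b_def)
      then have "0 < bump (x \<bullet> e / norm x - (1 - \<kappa>))" by (simp add: bump_nonneg order_less_le)
      then have "0 < x \<bullet> e / norm x - (1 - \<kappa>)" by (simp only: bump_pos_iff)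
      then show ?thesis using x by (simp add: Cn_def field_simps)
    qed
    show "\<exists>x. 0 < b x" using e \<kappa> by (intro exI[of _ e]) (simp add: b_def bump_pos_iff dot_square_norm)
    show "closed Cn" unfolding Cn_def by (intro closed_Collect_le continuous_intros)
    show "x \<in> \<Omega>" if x: "x \<in> Cn" "x \<noteq> 0" "nlog x \<in> J" for x
    proof -
      have nx: "r - \<eta> < norm x" "norm x < r + \<eta>" using nJ x by auto
      have "(norm (x - x0))\<^sup>2 = (norm x)\<^sup>2 + r\<^sup>2 - 2 * r * (x \<bullet> e)"
      proof -
        have "e \<bullet> e = 1" using e(1) by (simp add: norm_eq_1)
        then show ?thesis unfolding e(3) power2_norm_eq_inner
          by (simp add: inner_diff_left inner_diff_right inner_commute power2_eq_square)
      qed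
      also have "\<dots> \<le> (norm x)\<^sup>2 + r\<^sup>2 - 2 * r * ((1 - \<kappa>) * norm x)"
        using x(1) r by (simp add: Cn_def)
      also have "\<dots> = (norm x - r)\<^sup>2 + 2 * r * \<kappa> * norm x"
        by (simp add: power2_eq_square algebra_simps)
      also have "\<dots> \<le> (\<delta> / 2)\<^sup>2 + 2 * r * \<kappa> * (2 * r)"
      proof (rule add_mono)
        have "\<bar>norm x - r\<bar> \<le> \<bar>\<delta> / 2\<bar>" using nx \<eta> by linarith
        then show "(norm x - r)\<^sup>2 \<le> (\<delta> / 2)\<^sup>2" by (rule abs_le_square_iff[THEN iffD1])
        show "2 * r * \<kappa> * norm x \<le> 2 * r * \<kappa> * (2 * r)"
          using nx \<eta> r \<kappa> by (intro mult_left_mono) auto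
      qed
      also have "\<dots> \<le> \<delta>\<^sup>2 / 2" using \<kappa>r by (simp add: power2_eq_square mult_ac)
      also have "\<dots> < \<delta>\<^sup>2" using \<delta>(1) by simp
      finally have "norm (x - x0) < \<delta>" using \<delta>(1) by (simp add: power2_less_imp_less)
      then show ?thesis using \<delta>(2) by (auto simp: dist_norm norm_minus_commute)
    qed
  qed (use J \<Omega> in \<open>auto simp: b_def bump_nonneg bump_le_1\<close>)
  obtain W where W: "continuous_on J W" "AE x in lborel. x \<in> \<Omega> \<and> x \<noteq> 0 \<and> nlog x \<in> J \<longrightarrow> u x = W (nlog x)"
    using radial_continuous[OF wg um w] by blast
  \<comment> \<open>The neighbourhood is the full shell, not only its part in the cone.\<close>
  let ?B = "{x::real^'n. x \<noteq> 0 \<and> nlog x \<in> J}"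
  have "continuous_on ?B (\<lambda>x. W (nlog x))"
    by (rule continuous_on_compose2[OF W(1)]) (auto intro: continuous_on_subset[OF continuous_on_nlog])
  moreover have "x0 \<in> ?B" using x0(2) rJ by (simp add: nlog_def r_def)
  moreover have "AE x in lborel. x \<in> ?B \<inter> (\<Omega> - {0}) \<longrightarrow> u x = W (nlog x)"
    using W(2) by eventually_elim auto
  ultimately show ?thesis using open_nlog_vimage[OF J(1)] by blast
qed

text \<open>\<open>ind\<close> is the indicial equation and removes the term linear in
  \<open>y\<close>; \<open>\<nu> * q = 2 + \<nu>\<close> makes the coefficient of \<open>y^q\<close>
  constant and leaves the exponentially small factor at \<open>y^p\<close> when
  \<open>p < q\<close>.\<close>

lemma emden_fowler_transform:
  fixes W D :: "real \<Rightarrow> real"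
  assumes \<nu>: "0 < \<nu>" and ind: "\<nu> * (N - 2 - \<nu>) = \<mu>" and q: "q = (2 + \<nu>) / \<nu>"
    and W: "(W has_real_derivative D s) (at s)"
    and D: "(D has_real_derivative (N - 2) * D s - \<mu> * W s - exp (- (2 * s)) * (W s powr p - W s powr q)) (at s)"
    and W0: "0 \<le> W s"
  defines "y \<equiv> \<lambda>s. exp (- (\<nu> * s)) * W s" and "y1 \<equiv> \<lambda>s. exp (- (\<nu> * s)) * (D s - \<nu> * W s)"
  shows "(y has_real_derivative y1 s) (at s)"
    and "(y1 has_real_derivative (N - 2 - 2 * \<nu>) * y1 s + (y s powr q - exp (- ((q - p) * \<nu> * s)) * y s powr p)) (at s)"
proof -
  show "(y has_real_derivative y1 s) (at s)"
    unfolding y_def y1_def by (auto intro!: derivative_eq_intros W simp: algebra_simps)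
  have yr: "y s powr r = exp (- (\<nu> * r * s)) * W s powr r" for r
    using W0 by (simp add: y_def powr_mult exp_powr_real mult_ac)
  have \<nu>q: "\<nu> * q = 2 + \<nu>" using \<nu> q by simp
  have "exp (- (\<nu> * q * s)) = exp (- (\<nu> * s)) * exp (- (2 * s))"
    unfolding \<nu>q by (simp add: exp_add[symmetric] algebra_simps)
  then have yq: "y s powr q = exp (- (\<nu> * s)) * exp (- (2 * s)) * W s powr q" by (simp add: yr)
  have "exp (- ((q - p) * \<nu> * s)) * exp (- (\<nu> * p * s)) = exp (- (\<nu> * q * s))"
    by (simp add: exp_add[symmetric] algebra_simps)
  also have "\<dots> = exp (- (\<nu> * s)) * exp (- (2 * s))"
    unfolding \<nu>q by (simp add: exp_add[symmetric] algebra_simps)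
  finally have yp: "exp (- ((q - p) * \<nu> * s)) * y s powr p = exp (- (\<nu> * s)) * exp (- (2 * s)) * W s powr p"
    by (simp add: yr mult.assoc[symmetric])
  let ?d = "exp (- (\<nu> * s)) * ((N - 2) * D s - \<mu> * W s - exp (- (2 * s)) * (W s powr p - W s powr q) - \<nu> * D s)
    + (- \<nu> * exp (- (\<nu> * s))) * (D s - \<nu> * W s)"
  have "(y1 has_real_derivative ?d) (at s)"
    unfolding y1_def by (auto intro!: derivative_eq_intros W D simp: algebra_simps)
  also have "?d = (N - 2 - 2 * \<nu>) * y1 s + (y s powr q - exp (- ((q - p) * \<nu> * s)) * y s powr p)"
    unfolding yq yp y1_def ind[symmetric] by algebra
  finally show "(y1 has_real_derivative (N - 2 - 2 * \<nu>) * y1 s + (y s powr q - exp (- ((q - p) * \<nu> * s)) * y s powr p)) (at s)" .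
qed

text \<open>A limit at a point has no meaning for a class modulo null sets. The conclusion therefore
  concerns the continuous representative on \<open>\<Omega> - {0}\<close>, which \<open>u\<close>
  determines uniquely.\<close>

theorem theorem1p7:
  fixes \<Omega> :: "(real^'n) set"
    and u :: "real^'n \<Rightarrow> real"
    and N \<mu>bar \<mu> \<nu> \<alpha> p q crit :: real
  assumes "CARD('n) \<ge> 3"
    and "N = real CARD('n)"
    and "\<mu>bar = ((N - 2) / 2)\<^sup>2"
    and "0 < \<mu>" and "\<mu> < \<mu>bar"
    and "\<nu> = sqrt \<mu>bar - sqrt (\<mu>bar - \<mu>)"
    and "\<alpha> = N - 2 - 2 * \<nu>"
    and "q = (2 + \<nu>) / \<nu>"
    and "crit = 2 * N / (N - 2)"
    and "crit - 1 \<le> p" and "p < q"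
    and "smooth_domain \<Omega>" and "0 \<in> \<Omega>"
    and "radial_on \<Omega> u"
    and "AE x in lebesgue. x \<in> \<Omega> \<longrightarrow> u x > 0"
    and "u \<in> H10 \<Omega>" and "u \<in> Lp (q + 1) \<Omega>"
    and "weak_solution \<Omega> \<mu> p q u"
  shows "\<exists>v. continuous_on (\<Omega> - {0}) v \<and>
             (AE x in lebesgue. x \<in> \<Omega> \<longrightarrow> v x = u x) \<and>
             ((\<lambda>x. v x / (norm x powr (- \<nu>) * \<bar>ln (norm x)\<bar> powr (- \<nu> / 2)))
                \<longlongrightarrow> (\<alpha> * \<nu> / 2) powr (\<nu> / 2)) (at 0)"
proof -
  note CARD = assms(1) and N = assms(2)
  have N3: "3 \<le> N" using CARD N by simp
  have sq: "sqrt \<mu>bar = (N - 2) / 2" using assms(3) N3 by simp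
  define \<beta> where "\<beta> = sqrt (\<mu>bar - \<mu>)"
  have \<beta>: "0 < \<beta>" "\<beta>\<^sup>2 = \<mu>bar - \<mu>" "\<beta> < sqrt \<mu>bar" using assms(4,5) by (simp_all add: \<beta>_def)
  have \<nu>: "\<nu> = (N - 2) / 2 - \<beta>" "0 < \<nu>" using assms(6) sq \<beta>(3) unfolding \<beta>_def by linarith+
  have \<alpha>: "\<alpha> = 2 * \<beta>" using assms(7) \<nu> by argo
  \<comment> \<open>The indicial roots are \<open>(N - 2) / 2\<close> plus and minus
    \<open>\<beta>\<close>; \<open>\<nu>\<close> is the smaller one, and
    \<open>\<alpha> = 2 * \<beta>\<close> is their difference.\<close>
  have ind: "\<nu> * (N - 2 - \<nu>) = \<mu>"
  proof -
    have "\<nu> * (N - 2 - \<nu>) = ((N - 2) / 2)\<^sup>2 - \<beta>\<^sup>2" unfolding \<nu>(1) by (simp add: power2_eq_square field_simps)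
    then show ?thesis using \<beta>(2) assms(3) by simp
  qed
  have q: "q = 1 + 2 / \<nu>" using assms(8) \<nu>(2) by (simp add: add_divide_distrib)
  have p: "0 < p"
  proof -
    have "1 < 2 * N / (N - 2)" using N3 by simp
    then show ?thesis using assms(9,10) by simp
  qed
  have q0: "0 < q" using p assms(11) by simp
  have \<Omega>: "open \<Omega>" using assms(12) by (simp add: smooth_domain_def)
  have um: "set_borel_measurable lebesgue \<Omega> u" using assms(16) by (auto simp: H10_def Lp_def)
  obtain g where wg: "weak_gradient \<Omega> u g" using assms(18) unfolding weak_solution_def by blast
  have "\<exists>v. continuous_on (\<Omega> - {0}) v \<and> (AE x in lborel. x \<in> \<Omega> - {0} \<longrightarrow> u x = v x)"
    by (rule AE_eq_continuous_glue)
      (use \<Omega> radial_continuous_near[OF \<Omega> _ _ wg um assms(14)] in \<open>auto simp: open_delete\<close>)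
  then obtain v where v: "continuous_on (\<Omega> - {0}) v" "AE x in lborel. x \<in> \<Omega> - {0} \<longrightarrow> u x = v x" by blast
  obtain \<rho> where \<rho>: "0 < \<rho>" "ball 0 \<rho> \<subseteq> \<Omega>" using \<Omega> assms(13) open_contains_ball by blast
  obtain W D where WD: "\<forall>s > - ln \<rho>. (W has_real_derivative D s) (at s)"
    "\<forall>s > - ln \<rho>. (D has_real_derivative
      (N - 2) * D s - \<mu> * W s - exp (- (2 * s)) * (W s powr p - W s powr q)) (at s)"
    "\<forall>s > - ln \<rho>. 0 \<le> W s \<and> (\<forall>e>0. \<exists>t\<in>{s<..<s + e}. 0 < W t)"
    "AE x in lborel. x \<in> ball 0 \<rho> - {0} \<longrightarrow> u x = W (nlog x)"
    using radial_weak_solution_C2[OF \<Omega> \<rho> N um assms(14,15,18) p q0] by (elim exE conjE)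
  note W = WD(1)[rule_format] and D = WD(2)[rule_format] and uW = WD(4)
  have W0: "0 \<le> W s" if "- ln \<rho> < s" for s using WD(3) that by simp
  have Wpos: "\<exists>t\<in>{s<..<s + e}. 0 < W t" if "- ln \<rho> < s" "0 < e" for s e using WD(3) that by blast
  define y where "y s = exp (- (\<nu> * s)) * W s" for s
  define y1 where "y1 s = exp (- (\<nu> * s)) * (D s - \<nu> * W s)" for s
  have y_eq: "y = (\<lambda>s. exp (- (\<nu> * s)) * W s)" "y1 = (\<lambda>s. exp (- (\<nu> * s)) * (D s - \<nu> * W s))"
    by (simp_all add: fun_eq_iff y_def y1_def)
  interpret emden \<alpha> \<nu> p q "(q - p) * \<nu>" "- ln \<rho>" y y1
  proof
    fix s assume s: "- ln \<rho> < s"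
    note ef = emden_fowler_transform[OF \<nu>(2) ind assms(8) W[OF s] D[OF s] W0[OF s], folded y_eq]
    show "(y has_real_derivative y1 s) (at s)" by (rule ef(1)[unfolded y1_def[symmetric]])
    show "(y1 has_real_derivative \<alpha> * y1 s + (y s powr q - exp (- ((q - p) * \<nu> * s)) * y s powr p)) (at s)"
      using ef(2) unfolding assms(7) y_eq by simp
  qed (use \<alpha> \<beta> \<nu>(2) q p assms(11) in auto)
  have y0: "0 \<le> y s" if "- ln \<rho> < s" for s using W0[OF that] by (simp add: y_def)
  \<comment> \<open>A zero of \<open>y\<close> would spread to an interval on its right, yet
    \<open>W\<close> takes positive values in every such interval.\<close>
  interpret emden_pos \<alpha> \<nu> p q "(q - p) * \<nu>" "- ln \<rho>" y y1
  proof
    fix s assume s: "- ln \<rho> < s"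
    show "0 < y s"
    proof (rule ccontr)
      assume "\<not> 0 < y s"
      then have "y s = 0" using y0[OF s] by simp
      then obtain e where e: "0 < e" "\<forall>t\<in>{s..s + e}. y t = 0" using zero_imp_zero_right[OF y0 s] by blast
      obtain t where t: "t \<in> {s<..<s + e}" "0 < W t" using Wpos[OF s e(1)] by blast
      then have "y t = 0" using e(2) by simp
      then show False using t(2) by (simp add: y_def)
    qed
  qed
  \<comment> \<open>Both sides are continuous on the punctured ball and equal \<open>u\<close>
    almost everywhere, so they agree at every point; this carries the asymptotics of the profile
    over to \<open>v\<close>.\<close>
  have vW: "v x = W (nlog x)" if x: "x \<in> ball 0 \<rho> - {0}" for x
  proof -
    have op: "open (ball 0 \<rho> - {0::real^'n})" by (simp add: open_delete)
    have "nlog x \<in> {- ln \<rho><..}" if "x \<in> ball 0 \<rho> - {0}" for x :: "real^'n"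
      using less_nlog_iff[of x "- ln \<rho>"] that \<rho>(1) by simp
    then have sub: "nlog ` (ball 0 \<rho> - {0::real^'n}) \<subseteq> {- ln \<rho><..}" by blast
    have cW: "continuous_on {- ln \<rho><..} W"
      by (rule continuous_at_imp_continuous_on) (simp add: DERIV_isCont[OF W])
    have "continuous_on (ball 0 \<rho> - {0::real^'n}) nlog"
      by (rule continuous_on_subset[OF continuous_on_nlog]) blast
    then have "continuous_on (ball 0 \<rho> - {0}) (\<lambda>x::real^'n. W (nlog x))"
      by (rule continuous_on_compose2[OF cW _ sub])
    moreover have "continuous_on (ball 0 \<rho> - {0}) v"
      using v(1) \<rho>(2) by (auto intro: continuous_on_subset)
    moreover have "AE x in lborel. x \<in> ball 0 \<rho> - {0} \<longrightarrow> v x = W (nlog x)"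
      using v(2) uW by eventually_elim (use \<rho>(2) in auto)
    ultimately show ?thesis using AE_eq_imp_eq_continuous[OF op _ _ _ x] by blast
  qed
  have lim_nlog: "LIM x at (0::real^'n). nlog x :> at_top"
  proof -
    have "LIM x at (0::real^'n). norm x :> at_right 0"
      by (simp add: filterlim_at eventually_at_filter tendsto_norm_zero)
    from filterlim_compose[OF ln_at_0 this] show ?thesis
      unfolding nlog_def[abs_def] filterlim_uminus_at_top[symmetric]
      by (simp add: filterlim_uminus_at_top)
  qed
  have "((\<lambda>x. y (nlog x) / nlog x powr (- \<nu> / 2)) \<longlongrightarrow> (\<alpha> * \<nu> / 2) powr (\<nu> / 2)) (at (0::real^'n))"
    by (rule filterlim_compose[OF asymptotics lim_nlog])
  moreover have "\<forall>\<^sub>F x in at (0::real^'n). y (nlog x) / nlog x powr (- \<nu> / 2) =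
      v x / (norm x powr (- \<nu>) * \<bar>ln (norm x)\<bar> powr (- \<nu> / 2))"
  proof -
    \<comment> \<open>Off the origin \<open>nlog x > 0\<close> means \<open>norm x < 1\<close>,
      which fixes the sign in \<open>\<bar>ln (norm x)\<bar> = nlog x\<close>.\<close>
    have "\<forall>\<^sub>F x in at (0::real^'n). 0 < nlog x"
      using lim_nlog by (simp add: filterlim_at_top_dense)
    moreover have "\<forall>\<^sub>F x in at (0::real^'n). x \<in> ball 0 \<rho> - {0}"
      using \<rho>(1) by (auto simp: eventually_at intro!: exI[of _ \<rho>])
    ultimately show ?thesis
    proof eventually_elim
      case (elim x)
      have "norm x powr (- \<nu>) = exp (\<nu> * nlog x)" using elim(2) by (simp add: powr_def nlog_def)
      then have "norm x powr (- \<nu>) * exp (- (\<nu> * nlog x)) = 1" by (simp add: exp_add[symmetric])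
      then have "W (nlog x) / norm x powr (- \<nu>) = y (nlog x)"
        using elim(2) by (simp add: y_def field_simps)
      moreover have "\<bar>ln (norm x)\<bar> = nlog x" using elim(1) by (simp add: nlog_def)
      ultimately show ?case using vW[OF elim(2)] by (simp add: divide_divide_eq_left[symmetric])
    qed
  qed
  ultimately have "((\<lambda>x. v x / (norm x powr (- \<nu>) * \<bar>ln (norm x)\<bar> powr (- \<nu> / 2)))
      \<longlongrightarrow> (\<alpha> * \<nu> / 2) powr (\<nu> / 2)) (at 0)"
    by (rule Lim_transform_eventually)
  moreover have "AE x in lebesgue. x \<in> \<Omega> \<longrightarrow> v x = u x"
    unfolding AE_completion_iff using v(2) AE_lborel_nonzero by eventually_elim auto
  ultimately show ?thesis using v(1) by blast
qed

end
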